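(* Let $p\ge 2$ be an integer, let $c\ge 1$, $s\ge 0$, $M$ and $T>0$ be given, let $K\ge 1$ be an integer, and assume that the exact solution $(y(t),\dot y(t))$ of the system $\ddot y(t)=-\Omega^2y(t)+f(y(t))$ in $\mathbb{C}^{\mathcal K}$ (the spectral semi-discretization of $u_{tt}=u_{xx}+u^p$) satisfies $$\|y(t)\|_{s+1}+\|\dot y(t)\|_s\le M\qquad\text{for } 0\le t-t_0\le T.$$ Then there exists $h_0>0$ such that for all time step-sizes $0<h\le h_0$ the following error bound holds for the numerical solution $(y^n,\dot y^n)$ computed with the trigonometric integrator (with step-size $h$, started from $(y^0,\dot y^0)=(y(t_0),\dot y(t_0))$): if, for some $-1\le\alpha\le 1$, the filter assumption $A(\beta,c)$ holds for $\beta=0$ and for $\beta=\alpha$, then $$\|y(t_n)-y^n\|_{s+1-\alpha}+\|\dot y(t_n)-\dot y^n\|_{s-\alpha}\le C h^{1+\alpha}\qquad\text{for } 0\le t_n-t_0=nh\le T.$$ The constants $C$ and $h_0$ depend only on $M$, $s$, $p$, $T$ and $c$ (in particular they are independent of $K$).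
   Context: Spatial semi-discretization. For an integer $K\ge1$ let $\mathcal K=\{-K,\dots,K-1\}$, and let $\mathbb C^{\mathcal K}$ be the set of complex vectors $y=(y_j)_{j\in\mathcal K}$. Let $\Omega=\operatorname{diag}(\omega_j)_{j\in\mathcal K}$ with $\omega_j=|j|$. The discrete convolution is $(y\ast z)_j=\sum_{k,l\in\mathcal K,\ k+l\equiv j \bmod 2K}y_kz_l$ for $j\in\mathcal K$, and $f(y)=y\ast\cdots\ast y$ ($p$ factors). The system $\ddot y=-\Omega^2y+f(y)$ with given initial values $y(t_0),\dot y(t_0)\in\mathbb C^{\mathcal K}$ is the spectral collocation semi-discretization of the wave equation $u_{tt}=u_{xx}+u^p$ with $2\pi$-periodic boundary conditions in one space dimension ($y_j$ are Fourier coefficients). Norms. For $\sigma\in\mathbb R$ and $y\in\mathbb C^{\mathcal K}$, $\|y\|_\sigma=\bigl(\sum_{j\in\mathcal K}\langle j\rangle^{2\sigma}|y_j|^2\bigr)^{1/2}$ with $\langle j\rangle=\max(1,|j|)$. Trigonometric integrator. Let $\operatorname{sinc}(\xi)=\sin(\xi)/\xi$, $\operatorname{sinc}(0)=1$, and $$R(t)=\begin{pmatrix}\cos(t\Omega)&t\operatorname{sinc}(t\Omega)\\-\Omega\sin(t\Omega)&\cos(t\Omega)\end{pmatrix}.$$ Given filter functions $\phi,\psi,\psi_0,\psi_1$ with $\phi(0)=\psi(0)=\psi_0(0)=\psi_1(0)=1$ and a step-size $h>0$, put $\Phi=\phi(h\Omega)$, $\Psi=\psi(h\Omega)$, $\Psi_0=\psi_0(h\Omega)$,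 $\Psi_1=\psi_1(h\Omega)$ (diagonal matrices). The integrator computes approximations $(y^n,\dot y^n)$ to $(y(t_n),\dot y(t_n))$ at $t_n=t_0+nh$ by $$\begin{pmatrix}y^{n+1}\\\dot y^{n+1}\end{pmatrix}=R(h)\begin{pmatrix}y^n\\\dot y^n\end{pmatrix}+\begin{pmatrix}\frac12h^2\Psi f(\Phi y^n)\\\frac12h\Psi_0f(\Phi y^n)+\frac12h\Psi_1f(\Phi y^{n+1})\end{pmatrix}.$$ Filter assumption $A(\beta,c)$, for $-1\le\beta\le1$ and a constant $c$: for all $\xi=h\omega_j$ with $j\in\mathcal K$ and $\omega_j\ne0$, (1) $|\phi(\xi)|\le c$; (2) $|\psi(\xi)|\le c\,\xi^\beta$ if $-1\le\beta\le0$; (3) $|1-\psi(\xi)|\le c\,\xi^\beta$ if $0<\beta\le1$; (4) $|1-\chi(\xi)|\le c\,\xi^{1+\beta}$ for $\chi=\phi,\psi_0,\psi_1$. *)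

theory Defs
  imports
    "HOL-Analysis.Analysis"
    "HOL-Number_Theory.Cong"
    "HOL-Probability.Sinc_Integral"
begin

text \<open>
  Since \<open>K\<close> is quantified inside the theorem, a vector indexed by \<open>modes K = {-K, ..., K - 1}\<close> is
  represented by a function \<open>int \<Rightarrow> complex\<close> of which only the components in \<open>modes K\<close> are meaningful:
  all norms, sums, differential equations and conditions below look at these components only.
\<close>

type_synonym cvec = "int \<Rightarrow> complex"

definition modes :: "nat \<Rightarrow> int set" where
  "modes K = {- int K ..< int K}"

definition freq :: "int \<Rightarrow> real" where
  "freq j = real_of_int \<bar>j\<bar>"

definition conv :: "nat \<Rightarrow> cvec \<Rightarrow> cvec \<Rightarrow> cvec" where
  "conv K y z j =
     (\<Sum>(k, l) \<in> {(k, l). k \<in> modes K \<and> l \<in> modes K \<and> [k + l = j] (mod (2 * int K))}. y k * z l)"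

text \<open>The product \<open>y * ... * y\<close> with \<open>p\<close> factors, for \<open>p \<ge> 1\<close>.\<close>

definition nonlin :: "nat \<Rightarrow> nat \<Rightarrow> cvec \<Rightarrow> cvec" where
  "nonlin K p y = (conv K y ^^ (p - 1)) y"

definition sob_norm :: "nat \<Rightarrow> real \<Rightarrow> cvec \<Rightarrow> real" where
  "sob_norm K \<sigma> y = sqrt (\<Sum>j\<in>modes K. max 1 (freq j) powr (2 * \<sigma>) * (cmod (y j))\<^sup>2)"

text \<open>
  \<open>(y, v)\<close> with \<open>v\<close> the time derivative of \<open>y\<close> solves the second order system on \<open>[t0, t0 + T]\<close>
  (with one-sided derivatives at the end points).
\<close>

definition exact_solution ::
  "nat \<Rightarrow> nat \<Rightarrow> real \<Rightarrow> real \<Rightarrow> (real \<Rightarrow> cvec) \<Rightarrow> (real \<Rightarrow> cvec) \<Rightarrow> bool" where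
  "exact_solution K p t0 T y v \<longleftrightarrow>
     (\<forall>t\<in>{t0..t0 + T}. \<forall>j\<in>modes K.
        ((\<lambda>\<tau>. y \<tau> j) has_vector_derivative v t j) (at t within {t0..t0 + T}) \<and>
        ((\<lambda>\<tau>. v \<tau> j) has_vector_derivative
           (- complex_of_real ((freq j)\<^sup>2) * y t j + nonlin K p (y t) j))
          (at t within {t0..t0 + T}))"

text \<open>The diagonal matrix \<open>g(h \<Omega>)\<close> applied to a vector.\<close>

definition diag_op :: "(real \<Rightarrow> complex) \<Rightarrow> real \<Rightarrow> cvec \<Rightarrow> cvec" where
  "diag_op g h y = (\<lambda>j. g (h * freq j) * y j)"

definition R_flow :: "real \<Rightarrow> cvec \<times> cvec \<Rightarrow> cvec \<times> cvec" where
  "R_flow t = (\<lambda>(y, v).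
     (\<lambda>j. complex_of_real (cos (t * freq j)) * y j + complex_of_real (t * sinc (t * freq j)) * v j,
      \<lambda>j. complex_of_real (- freq j * sin (t * freq j)) * y j
            + complex_of_real (cos (t * freq j)) * v j))"

text \<open>
  The nonlinearity in the second component is also evaluated at the new position, which is computed
  first, so that the scheme is explicit.
\<close>

definition trig_step ::
  "nat \<Rightarrow> nat \<Rightarrow> (real \<Rightarrow> complex) \<Rightarrow> (real \<Rightarrow> complex) \<Rightarrow> (real \<Rightarrow> complex) \<Rightarrow> (real \<Rightarrow> complex) \<Rightarrow>
     real \<Rightarrow> cvec \<times> cvec \<Rightarrow> cvec \<times> cvec" where
  "trig_step K p \<phi> \<psi> \<psi>0 \<psi>1 h u =
     (let f_old = nonlin K p (diag_op \<phi> h (fst u));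
          y_new = (\<lambda>j. fst (R_flow h u) j + complex_of_real (h\<^sup>2 / 2) * diag_op \<psi> h f_old j);
          f_new = nonlin K p (diag_op \<phi> h y_new);
          v_new = (\<lambda>j. snd (R_flow h u) j + complex_of_real (h / 2) * diag_op \<psi>0 h f_old j
                                        + complex_of_real (h / 2) * diag_op \<psi>1 h f_new j)
      in (y_new, v_new))"

definition trig_integrator ::
  "nat \<Rightarrow> nat \<Rightarrow> (real \<Rightarrow> complex) \<Rightarrow> (real \<Rightarrow> complex) \<Rightarrow> (real \<Rightarrow> complex) \<Rightarrow> (real \<Rightarrow> complex) \<Rightarrow>
     real \<Rightarrow> cvec \<times> cvec \<Rightarrow> nat \<Rightarrow> cvec \<times> cvec" where
  "trig_integrator K p \<phi> \<psi> \<psi>0 \<psi>1 h u0 n = (trig_step K p \<phi> \<psi> \<psi>0 \<psi>1 h ^^ n) u0"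

definition filter_assm ::
  "nat \<Rightarrow> real \<Rightarrow> (real \<Rightarrow> complex) \<Rightarrow> (real \<Rightarrow> complex) \<Rightarrow> (real \<Rightarrow> complex) \<Rightarrow> (real \<Rightarrow> complex) \<Rightarrow>
     real \<Rightarrow> real \<Rightarrow> bool" where
  "filter_assm K h \<phi> \<psi> \<psi>0 \<psi>1 \<beta> c \<longleftrightarrow>
     (\<forall>\<xi> \<in> {h * freq j | j. j \<in> modes K \<and> freq j \<noteq> 0}.
        cmod (\<phi> \<xi>) \<le> c \<and>
        (-1 \<le> \<beta> \<and> \<beta> \<le> 0 \<longrightarrow> cmod (\<psi> \<xi>) \<le> c * \<xi> powr \<beta>) \<and>
        (0 < \<beta> \<and> \<beta> \<le> 1 \<longrightarrow> cmod (1 - \<psi> \<xi>) \<le> c * \<xi> powr \<beta>) \<and>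
        (\<forall>g \<in> {\<phi>, \<psi>0, \<psi>1}. cmod (1 - g \<xi>) \<le> c * \<xi> powr (1 + \<beta>)))"

end

theory Submission
  imports Defs
begin

text \<open>
  A time derivative of the solution costs one power of \<open>\<langle>j\<rangle> = max 1 |j|\<close>, so in the one-step defects of
  the scheme without filters every gained factor \<open>h\<close> is paid for by one order of the Sobolev norm.
  These defects are estimated in norms that differ by integer orders, and fractional \<open>\<alpha>\<close> follow by
  interpolation (\<open>sob_norm_interpolation\<close>). The filter assumption has the same trade-off built in, so
  the filters contribute local errors of the same size: \<open>h powr (2 + \<alpha>)\<close> in the norms of order
  \<open>s + 1 - \<alpha>\<close> (positions) and \<open>s - \<alpha>\<close> (velocities). Summing them over \<open>T / h\<close> steps loses one power.

  The nonlinearity is controlled by two estimates that are uniform in \<open>K\<close>. Convolution maps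
  \<open>H\<^sup>\<sigma> \<times> H\<^sup>\<tau>\<close> to \<open>H\<^sup>\<sigma>\<close> for \<open>\<bar>\<sigma>\<bar> \<le> \<tau>\<close> and \<open>\<tau> \<ge> 1\<close> (\<open>sob_norm_conv\<close>), which makes \<open>f\<close> Lipschitz in
  every norm of order between \<open>-(s + 1)\<close> and \<open>s + 1\<close> on balls of order \<open>s + 1\<close>; negative orders occur
  because \<open>s - \<alpha>\<close> may be \<open>-1\<close>. Convolution also maps \<open>H\<^sup>s \<times> H\<^sup>s\<close> to order \<open>s - 1\<close>
  (\<open>sob_norm_conv_lossy\<close>). With this second estimate, \<open>f\<close> commutes with linear interpolation in time up
  to an error of second order (\<open>cpow_linear_interpolation\<close>); this takes the place of a bound on the second
  time derivative of \<open>f(y(t))\<close> in the analysis of the trapezoidal rule for the velocities.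

  Transporting the exact solution back along the free flow turns the variation
  of constants formula into a statement about derivatives (\<open>back_propagation_derivative\<close>), and a
  defect is bounded by the mean value inequality \<open>sob_norm_increment_le\<close>.

  For the global error, the free flow expands the energy norm by at most \<open>1 + h\<close>. The case \<open>\<alpha> = 0\<close>
  comes first: a discrete Gronwall argument shows, as long as the numerical solution stays in a ball
  of order \<open>s + 1\<close>, that its error in that order is \<open>O(h)\<close>, and for small \<open>h\<close> this bound keeps the
  numerical solution in the ball (\<open>global_error_bootstrap\<close>). With the ball secured, \<open>\<alpha> \<ge> 0\<close> is another
  Gronwall argument. For \<open>\<alpha> < 0\<close> the error is measured in stronger norms than the solution is known
  to have. However, the filter \<open>\<psi>\<close> lowers the order that the positions require from \<open>s + 1 - \<alpha>\<close> to
  \<open>s + 1\<close>, and the velocities require at most that order anyway, so the \<open>O(h)\<close> bound of order \<open>s + 1\<close>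
  from the case \<open>\<alpha> = 0\<close> controls the nonlinear terms (\<open>global_error\<close>).
\<close>

section \<open>Weighted norms\<close>

text \<open>
  The Japanese bracket \<open>\<langle>j\<rangle>\<close>, the weight in all norms.
\<close>
definition jap :: "int \<Rightarrow> real" where
  "jap j = max 1 (freq j)"

lemma jap_ge_1 [simp]: "1 \<le> jap j" and jap_pos [simp]: "0 < jap j"
  by (auto simp: jap_def)

lemma jap_nonneg [simp]: "0 \<le> jap j"
  by (rule less_imp_le) simp

lemma jap_neq_0 [simp]: "jap j \<noteq> 0"
  by (metis jap_pos less_irrefl)

lemma freq_nonneg [simp]: "0 \<le> freq j" and freq_le_jap: "freq j \<le> jap j"
  by (auto simp: jap_def freq_def)

lemma jap_eq_freq: "freq j \<noteq> 0 \<Longrightarrow> jap j = freq j"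
  by (auto simp: jap_def freq_def)

lemma jap_eq_1: "freq j = 0 \<Longrightarrow> jap j = 1"
  by (auto simp: jap_def)

lemma finite_modes [simp]: "finite (modes K)"
  by (simp add: modes_def)

lemma powr_double: "a powr (2 * \<sigma>) = (a powr \<sigma>)\<^sup>2" for a \<sigma> :: real
  by (simp add: power2_eq_square flip: powr_add)

lemma sob_norm_L2: "sob_norm K \<sigma> y = L2_set (\<lambda>j. jap j powr \<sigma> * cmod (y j)) (modes K)"
  by (simp add: sob_norm_def L2_set_def jap_def power_mult_distrib powr_double)

lemma sob_norm_nonneg [simp]: "0 \<le> sob_norm K \<sigma> y"
  by (simp add: sob_norm_L2)

lemma sob_norm_zero [simp]: "sob_norm K \<sigma> (\<lambda>j. 0) = 0"
  by (simp add: sob_norm_def)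

text \<open>
  Every diagonal operator below, be it a filter, \<open>\<Omega>\<close> or an entry of the free flow, enters through a
  symbol bound of this form: growth \<open>\<langle>j\<rangle> powr \<delta>\<close> of the symbol costs \<open>\<delta>\<close> orders of the norm.
\<close>
lemma sob_norm_multiplier:
  assumes "\<And>j. j \<in> modes K \<Longrightarrow> cmod (x j) \<le> B * jap j powr \<delta> * cmod (y j)" and "0 \<le> B"
  shows "sob_norm K \<sigma> x \<le> B * sob_norm K (\<sigma> + \<delta>) y"
proof -
  have "jap j powr \<sigma> * cmod (x j) \<le> B * (jap j powr (\<sigma> + \<delta>) * cmod (y j))" if "j \<in> modes K" for j
    using mult_left_mono[OF assms(1)[OF that], of "jap j powr \<sigma>"] by (simp add: powr_add mult_ac)
  then show ?thesis
    unfolding sob_norm_L2 L2_set_right_distrib[OF \<open>0 \<le> B\<close>] by (intro L2_set_mono) auto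
qed

lemma sob_norm_mono:
  assumes "\<And>j. j \<in> modes K \<Longrightarrow> cmod (x j) \<le> cmod (y j)" and "\<sigma> \<le> \<sigma>'"
  shows "sob_norm K \<sigma> x \<le> sob_norm K \<sigma>' y"
  using sob_norm_multiplier[of K x 1 "\<sigma>' - \<sigma>" y \<sigma>] assms
  by (smt (verit) add_diff_cancel_left' diff_add_cancel jap_ge_1 ge_one_powr_ge_zero le_add_diff_inverse
      mult_cancel_right1 mult_right_mono norm_ge_zero add.commute)

lemma sob_norm_order_mono: "\<sigma> \<le> \<sigma>' \<Longrightarrow> sob_norm K \<sigma> x \<le> sob_norm K \<sigma>' x"
  by (rule sob_norm_mono) auto

lemma sob_norm_scale: "sob_norm K \<sigma> (\<lambda>j. a * y j) = cmod a * sob_norm K \<sigma> y"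
  by (simp add: sob_norm_L2 norm_mult L2_set_right_distrib mult_ac)

lemma sob_norm_triangle:
  "sob_norm K \<sigma> (\<lambda>j. x j + y j) \<le> sob_norm K \<sigma> x + sob_norm K \<sigma> y"
proof -
  have "sob_norm K \<sigma> (\<lambda>j. x j + y j)
      \<le> L2_set (\<lambda>j. jap j powr \<sigma> * cmod (x j) + jap j powr \<sigma> * cmod (y j)) (modes K)"
    unfolding sob_norm_L2
    by (intro L2_set_mono) (auto simp: distrib_left[symmetric] intro!: mult_left_mono norm_triangle_ineq)
  also have "\<dots> \<le> sob_norm K \<sigma> x + sob_norm K \<sigma> y"
    unfolding sob_norm_L2 by (rule L2_set_triangle_ineq)
  finally show ?thesis .
qed

lemma sob_norm_triangle_diff:
  "sob_norm K \<sigma> (\<lambda>j. x j - y j) \<le> sob_norm K \<sigma> x + sob_norm K \<sigma> y"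
  using sob_norm_triangle[of K \<sigma> x "\<lambda>j. - y j"] sob_norm_scale[of K \<sigma> "-1" y] by simp

text \<open>
  Pointwise this is \<open>q powr \<theta> \<le> 1 + q\<close> for \<open>q = 1 / (h \<langle>j\<rangle>)\<close>. It trades powers of \<open>h\<close> for orders of the
  norm and reduces fractional orders to the two integer end points.
\<close>
lemma sob_norm_interpolation:
  assumes "0 \<le> \<theta>" "\<theta> \<le> 1" "0 < h"
    and "sob_norm K \<sigma> x \<le> A" and "sob_norm K (\<sigma> - 1) x \<le> A * h"
  shows "sob_norm K (\<sigma> - \<theta>) x \<le> 2 * A * h powr \<theta>"
proof -
  have pt: "jap j powr (\<sigma> - \<theta>) * cmod (x j) \<le>
     h powr \<theta> * (jap j powr \<sigma> * cmod (x j)) + h powr \<theta> / h * (jap j powr (\<sigma> - 1) * cmod (x j))" for j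
  proof -
    define q where "q = 1 / (h * jap j)"
    have q: "0 < q" using assms by (simp add: q_def)
    have "q powr \<theta> \<le> 1 + q"
    proof (cases "q \<le> 1")
      case True
      then show ?thesis using powr_le1[of \<theta> q] q assms(1) by linarith
    next
      case False
      then show ?thesis using powr_mono[of \<theta> 1 q] q assms(2) by simp
    qed
    then have "h powr \<theta> * (jap j powr \<sigma> * cmod (x j)) * q powr \<theta>
        \<le> h powr \<theta> * (jap j powr \<sigma> * cmod (x j)) * (1 + q)"
      by (intro mult_left_mono) auto
    moreover have "h powr \<theta> * (jap j powr \<sigma> * cmod (x j)) * q powr \<theta> = jap j powr (\<sigma> - \<theta>) * cmod (x j)"
      using assms by (simp add: q_def powr_divide powr_mult powr_diff)
    moreover have "h powr \<theta> * (jap j powr \<sigma> * cmod (x j)) * (1 + q) =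
      h powr \<theta> * (jap j powr \<sigma> * cmod (x j)) + h powr \<theta> / h * (jap j powr (\<sigma> - 1) * cmod (x j))"
      using assms by (simp add: q_def powr_diff field_simps)
    ultimately show ?thesis by simp
  qed
  have "sob_norm K (\<sigma> - \<theta>) x \<le> L2_set (\<lambda>j. h powr \<theta> * (jap j powr \<sigma> * cmod (x j))
      + h powr \<theta> / h * (jap j powr (\<sigma> - 1) * cmod (x j))) (modes K)"
    unfolding sob_norm_L2 by (intro L2_set_mono pt) auto
  also have "\<dots> \<le> h powr \<theta> * sob_norm K \<sigma> x + h powr \<theta> / h * sob_norm K (\<sigma> - 1) x"
    unfolding sob_norm_L2
    by (rule order_trans[OF L2_set_triangle_ineq]) (use assms(3) in \<open>simp add: L2_set_right_distrib del: times_divide_eq_left\<close>)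
  also have "\<dots> \<le> h powr \<theta> * A + h powr \<theta> / h * (A * h)"
    using assms by (intro add_mono mult_left_mono) auto
  also have "\<dots> = 2 * A * h powr \<theta>" using assms(3) by simp
  finally show ?thesis .
qed

text \<open>
  Mean value inequality. The scalar mean value theorem applies to the pairing of \<open>x\<close> with the fixed
  vector \<open>x b - x a\<close>, in the inner product that belongs to the norm; the pairing with the increment
  itself is the square of the norm, and Cauchy-Schwarz bounds the derivative of the pairing.
\<close>
lemma sob_norm_increment_le:
  assumes "a \<le> b"
    and der: "\<And>t j. t \<in> {a..b} \<Longrightarrow> j \<in> modes K \<Longrightarrow>
        ((\<lambda>\<tau>. x \<tau> j) has_vector_derivative x' t j) (at t within {a..b})"
    and bd: "\<And>t. t \<in> {a..b} \<Longrightarrow> sob_norm K \<sigma> (x' t) \<le> B"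
  shows "sob_norm K \<sigma> (\<lambda>j. x b j - x a j) \<le> B * (b - a)"
proof (cases "a = b")
  case True
  then show ?thesis by simp
next
  case False
  then have "a < b" using assms by simp
  define w where "w = (\<lambda>j. x b j - x a j)"
  define W where "W = (\<lambda>j. complex_of_real (jap j powr (2 * \<sigma>)) * cnj (w j))"
  define g where "g = (\<lambda>t. Re (\<Sum>j\<in>modes K. W j * x t j))"
  define g' where "g' = (\<lambda>t. Re (\<Sum>j\<in>modes K. W j * x' t j))"
  have dg: "(g has_vector_derivative g' t) (at t within {a..b})" if "t \<in> {a..b}" for t
    unfolding g_def g'_def
    by (intro bounded_linear.has_vector_derivative[OF bounded_linear_Re] has_vector_derivative_sum has_vector_derivative_mult_right der that) auto
  obtain z where z: "z \<in> {a<..<b}" "g b - g a = (b - a) * g' z"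
  proof -
    have "\<exists>z\<in>{a<..<b}. g b - g a = (\<lambda>h. h *\<^sub>R g' z) (b - a)"
      using \<open>a < b\<close> dg by (intro mvt_simple) (auto simp: has_vector_derivative_def)
    then show ?thesis using that by auto
  qed
  have "g b - g a = Re (\<Sum>j\<in>modes K. W j * w j)"
    by (simp add: g_def w_def right_diff_distrib sum_subtractf)
  also have "\<dots> = (\<Sum>j\<in>modes K. (jap j powr \<sigma> * cmod (w j))\<^sup>2)"
    unfolding Re_sum
  proof (intro sum.cong refl)
    fix j
    have "W j * w j = complex_of_real (jap j powr (2 * \<sigma>)) * complex_of_real ((cmod (w j))\<^sup>2)"
      unfolding W_def complex_norm_square by simp
    then show "Re (W j * w j) = (jap j powr \<sigma> * cmod (w j))\<^sup>2"
      by (metis Re_complex_of_real powr_double of_real_mult power_mult_distrib)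
  qed
  also have "\<dots> = (sob_norm K \<sigma> w)\<^sup>2"
    by (simp add: sob_norm_L2 L2_set_def sum_nonneg)
  finally have gw: "g b - g a = (sob_norm K \<sigma> w)\<^sup>2" .
  have "g' z \<le> (\<Sum>j\<in>modes K. cmod (W j * x' z j))"
    unfolding g'_def by (rule order_trans[OF complex_Re_le_cmod norm_sum])
  also have "\<dots> = (\<Sum>j\<in>modes K. \<bar>jap j powr \<sigma> * cmod (w j)\<bar> * \<bar>jap j powr \<sigma> * cmod (x' z j)\<bar>)"
    by (intro sum.cong) (auto simp: W_def norm_mult powr_double power2_eq_square)
  also have "\<dots> \<le> sob_norm K \<sigma> w * sob_norm K \<sigma> (x' z)"
    unfolding sob_norm_L2 by (rule L2_set_mult_ineq)
  also have "\<dots> \<le> sob_norm K \<sigma> w * B"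
    using z by (intro mult_left_mono bd) auto
  finally have "(sob_norm K \<sigma> w)\<^sup>2 \<le> (b - a) * (sob_norm K \<sigma> w * B)"
    using gw z(2) \<open>a < b\<close> by (metis diff_ge_0_iff_ge less_imp_le mult_left_mono)
  then have *: "sob_norm K \<sigma> w * sob_norm K \<sigma> w \<le> sob_norm K \<sigma> w * (B * (b - a))"
    by (simp add: power2_eq_square mult_ac)
  show ?thesis
  proof (cases "sob_norm K \<sigma> w = 0")
    case True
    have "0 \<le> B" using bd[of a] \<open>a < b\<close> by (meson atLeastAtMost_iff order_refl less_imp_le order_trans sob_norm_nonneg)
    then show ?thesis using True \<open>a < b\<close> by (simp add: w_def)
  next
    case False
    then have "0 < sob_norm K \<sigma> w" by (metis less_eq_real_def sob_norm_nonneg)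
    then show ?thesis using * by (simp add: w_def)
  qed
qed

section \<open>Product estimates for the discrete convolution\<close>

definition resonant_pairs :: "nat \<Rightarrow> int \<Rightarrow> (int \<times> int) set" where
  "resonant_pairs K j = {(k, l). k \<in> modes K \<and> l \<in> modes K \<and> [k + l = j] (mod (2 * int K))}"

definition representative :: "nat \<Rightarrow> int \<Rightarrow> int" where
  "representative K m = (m + int K) mod (2 * int K) - int K"

lemma conv_eq: "conv K y z j = (\<Sum>(k, l)\<in>resonant_pairs K j. y k * z l)"
  by (simp add: conv_def resonant_pairs_def)

lemma representative_in_modes: "K \<ge> 1 \<Longrightarrow> representative K m \<in> modes K"
  using pos_mod_bound[of "2 * int K" "m + int K"] pos_mod_sign[of "2 * int K" "m + int K"]
  by (auto simp: representative_def modes_def)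

lemma cong_representative: "[representative K m = m] (mod (2 * int K))"
  using cong_diff[OF cong_mod_left[THEN iffD2, OF cong_refl] cong_refl, of "m + int K" "2 * int K" "int K"]
  by (simp add: representative_def)

lemma modes_cong_unique:
  assumes "k \<in> modes K" "l \<in> modes K" "[k = l] (mod (2 * int K))"
  shows "k = l"
proof -
  have "[k + int K = l + int K] (mod (2 * int K))"
    using assms(3) by (simp add: cong_add_rcancel)
  then have "k + int K = l + int K"
    by (rule cong_less_imp_eq_int[rotated 4]) (use assms(1,2) in \<open>auto simp: modes_def\<close>)
  then show ?thesis by simp
qed

text \<open>
  For given \<open>j\<close> each \<open>k\<close> has exactly one partner, so sums over resonant pairs are single sums.
\<close>
lemma sum_resonant_pairs:
  assumes "K \<ge> 1"
  shows "(\<Sum>(k, l)\<in>resonant_pairs K j. g k l) = (\<Sum>k\<in>modes K. g k (representative K (j - k)))"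
proof (rule sum.reindex_bij_witness[of _ "\<lambda>k. (k, representative K (j - k))" fst])
  fix p assume p: "p \<in> resonant_pairs K j"
  obtain k l where [simp]: "p = (k, l)" by (cases p)
  have kl: "k \<in> modes K" "l \<in> modes K" "[k + l = j] (mod (2 * int K))"
    using p by (auto simp: resonant_pairs_def)
  have "[representative K (j - k) = j - k] (mod (2 * int K))" by (rule cong_representative)
  moreover have "[l = j - k] (mod (2 * int K))"
    using cong_diff[OF kl(3) cong_refl[of k]] by simp
  ultimately have "representative K (j - k) = l"
    by (intro modes_cong_unique[OF representative_in_modes[OF assms] kl(2)])
       (metis cong_sym cong_trans)
  then show "(fst p, representative K (j - fst p)) = p" by simp
  then show "g (fst p) (representative K (j - fst p)) = (case p of (k, l) \<Rightarrow> g k l)" by simp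
  show "fst p \<in> modes K" using kl by simp
next
  fix k assume k: "k \<in> modes K"
  have "[k + representative K (j - k) = k + (j - k)] (mod (2 * int K))"
    by (intro cong_add cong_refl cong_representative)
  then show "(k, representative K (j - k)) \<in> resonant_pairs K j"
    using k representative_in_modes[OF assms] by (simp add: resonant_pairs_def)
qed auto

lemma bij_betw_representative_minus:
  assumes "K \<ge> 1"
  shows "bij_betw (\<lambda>k. representative K (j - k)) (modes K) (modes K)"
    and "bij_betw (\<lambda>k. representative K (k - j)) (modes K) (modes K)"
proof -
  have inv: "representative K (f (representative K (g k))) = k"
    if "k \<in> modes K" "\<And>x. [f (representative K (g k)) = f (g k)] (mod (2 * int K))" "f (g k) = k" for f g k
    using that modes_cong_unique[OF representative_in_modes[OF assms] that(1)]
    by (metis cong_representative cong_trans)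
  show "bij_betw (\<lambda>k. representative K (j - k)) (modes K) (modes K)"
    by (rule bij_betw_byWitness[where f' = "\<lambda>k. representative K (j - k)"])
       (auto intro!: representative_in_modes[OF assms] inv[of _ "\<lambda>k. j - k" "\<lambda>k. j - k"] cong_diff
         cong_representative)
  show "bij_betw (\<lambda>k. representative K (k - j)) (modes K) (modes K)"
    by (rule bij_betw_byWitness[where f' = "\<lambda>k. representative K (k + j)"])
       (auto intro!: representative_in_modes[OF assms] inv[of _ "\<lambda>k. k - j" "\<lambda>k. k + j"]
         inv[of _ "\<lambda>k. k + j" "\<lambda>k. k - j"] cong_diff cong_add cong_representative)
qed

lemma L2_set_sum_le: "finite I \<Longrightarrow> L2_set (\<lambda>j. \<Sum>i\<in>I. f i j) A \<le> (\<Sum>i\<in>I. L2_set (f i) A)"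
proof (induction I rule: finite_induct)
  case empty
  then show ?case by (simp add: L2_set_def)
next
  case (insert i I)
  then show ?case
    using L2_set_triangle_ineq[of "f i" "\<lambda>j. \<Sum>i\<in>I. f i j" A] by simp
qed

lemma L2_set_reindex: "bij_betw \<pi> A A \<Longrightarrow> L2_set (\<lambda>j. f (\<pi> j)) A = L2_set f A"
  unfolding L2_set_def by (subst sum.reindex_bij_betw[of \<pi> A A "\<lambda>j. (f j)\<^sup>2", symmetric]) auto

text \<open>
  For fixed \<open>k\<close> the partner of \<open>k\<close> runs through all modes as \<open>j\<close> does; Minkowski's inequality then
  sums the resulting copies of \<open>w\<close>. This is the estimate \<open>\<ell>\<^sup>1 * \<ell>\<^sup>2 \<subseteq> \<ell>\<^sup>2\<close>.
\<close>
lemma discrete_Young: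
  fixes u w :: "int \<Rightarrow> real"
  assumes "K \<ge> 1" and "\<And>k. 0 \<le> u k"
  shows "L2_set (\<lambda>j. \<Sum>(k, l)\<in>resonant_pairs K j. u k * w l) (modes K)
      \<le> (\<Sum>k\<in>modes K. u k) * L2_set w (modes K)"
proof -
  have "L2_set (\<lambda>j. \<Sum>(k, l)\<in>resonant_pairs K j. u k * w l) (modes K)
      \<le> (\<Sum>k\<in>modes K. L2_set (\<lambda>j. u k * w (representative K (j - k))) (modes K))"
    unfolding sum_resonant_pairs[OF assms(1)] by (rule L2_set_sum_le) simp
  also have "\<dots> = (\<Sum>k\<in>modes K. u k * L2_set w (modes K))"
    by (intro sum.cong refl)
       (simp add: assms(2) L2_set_reindex[OF bij_betw_representative_minus(2)[OF assms(1)], of w]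
         flip: L2_set_right_distrib)
  finally show ?thesis by (simp add: sum_distrib_right)
qed

text \<open>
  The companion estimate \<open>\<ell>\<^sup>2 * \<ell>\<^sup>2 \<subseteq> \<ell>\<^sup>\<infinity>\<close>.
\<close>
lemma resonant_Cauchy_Schwarz:
  fixes u w :: "int \<Rightarrow> real"
  assumes "K \<ge> 1" and "\<And>k. 0 \<le> u k" and "\<And>k. 0 \<le> w k"
  shows "(\<Sum>(k, l)\<in>resonant_pairs K j. u k * w l) \<le> L2_set u (modes K) * L2_set w (modes K)"
  using L2_set_mult_ineq[of u "\<lambda>k. w (representative K (j - k))" "modes K"] assms
  by (simp add: sum_resonant_pairs L2_set_reindex[OF bij_betw_representative_minus(1)[OF assms(1)], of w])

lemma resonant_swap: "(\<Sum>(k, l)\<in>resonant_pairs K j. g k l) = (\<Sum>(k, l)\<in>resonant_pairs K j. g l k)"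
  by (rule sum.reindex_bij_witness[of _ prod.swap prod.swap])
     (auto simp: resonant_pairs_def add.commute)

lemma conv_commute: "conv K y z = conv K z y"
  by (rule ext) (subst conv_eq, subst resonant_swap, simp add: conv_eq mult.commute)

lemma conv_add_left: "conv K (\<lambda>j. x j + y j) z j = conv K x z j + conv K y z j"
  and conv_diff_left: "conv K (\<lambda>j. x j - y j) z j = conv K x z j - conv K y z j"
  and conv_add_right: "conv K z (\<lambda>j. x j + y j) j = conv K z x j + conv K z y j"
  and conv_diff_right: "conv K z (\<lambda>j. x j - y j) j = conv K z x j - conv K z y j"
  and conv_scale_left: "conv K (\<lambda>j. a * y j) z j = a * conv K y z j"
  and conv_scale_right: "conv K z (\<lambda>j. a * y j) j = a * conv K z y j"
  unfolding conv_eq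
  by (simp_all add: sum.distrib[symmetric] sum_subtractf[symmetric] sum_distrib_left case_prod_beta
      algebra_simps)

text \<open>
  The modes are representatives of least absolute value, so aliasing never raises the frequency. This
  is why the estimates of the continuous convolution survive discretization.
\<close>
lemma abs_le_of_cong:
  assumes "j \<in> modes K" and "[j = m] (mod (2 * int K))"
  shows "\<bar>j\<bar> \<le> \<bar>m\<bar>"
proof -
  obtain q where q: "m = j + 2 * int K * q"
    using assms(2) by (metis cong_iff_lin mult.commute cong_sym)
  have j: "- int K \<le> j" "j < int K" using assms(1) by (auto simp: modes_def)
  consider "q = 0" | "q \<ge> 1" | "q \<le> -1" by linarith
  then show ?thesis
  proof cases
    case 2
    then have "2 * int K * 1 \<le> 2 * int K * q" by (intro mult_left_mono) auto
    then show ?thesis using q j by linarith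
  next
    case 3
    then have "2 * int K * q \<le> 2 * int K * -1" by (intro mult_left_mono) auto
    then show ?thesis using q j by linarith
  qed (use q in simp)
qed

lemma jap_le_of_cong_add:
  assumes "j \<in> modes K" and "[j = k + l] (mod (2 * int K))"
  shows "jap j \<le> 2 * max (jap k) (jap l)"
proof -
  have "\<bar>j\<bar> \<le> \<bar>k + l\<bar>" using assms by (rule abs_le_of_cong)
  then have "\<bar>j\<bar> \<le> \<bar>k\<bar> + \<bar>l\<bar>" by linarith
  then have "real_of_int \<bar>j\<bar> \<le> real_of_int \<bar>k\<bar> + real_of_int \<bar>l\<bar>" by linarith
  then show ?thesis by (auto simp: jap_def freq_def)
qed

lemma jap_resonant:
  assumes "j \<in> modes K" and "(k, l) \<in> resonant_pairs K j"
  shows "jap j \<le> 2 * max (jap k) (jap l)" and "jap k \<le> 2 * max (jap j) (jap l)"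
proof -
  have kl: "k \<in> modes K" "l \<in> modes K" "[k + l = j] (mod (2 * int K))"
    using assms by (auto simp: resonant_pairs_def)
  show "jap j \<le> 2 * max (jap k) (jap l)"
    using jap_le_of_cong_add[OF assms(1)] kl(3) cong_sym by blast
  have "[k = j + (- l)] (mod (2 * int K))"
    using cong_diff[OF kl(3) cong_refl[of l]] by simp
  from jap_le_of_cong_add[OF kl(1) this] show "jap k \<le> 2 * max (jap j) (jap l)"
    by (simp add: jap_def freq_def)
qed

text \<open>
  This bound is where uniformity in \<open>K\<close> comes from: it is the embedding of order \<open>1\<close> into \<open>\<ell>\<^sup>1\<close>.
\<close>
lemma sum_inverse_jap_square: "(\<Sum>j\<in>modes K. (1 / jap j)\<^sup>2) \<le> 6"
proof -
  \<comment> \<open>The sharper bound absorbs the two terms that a larger \<open>K\<close> adds, each at most \<open>2 / (N (N + 1))\<close>.\<close>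
  have "(\<Sum>j\<in>modes (Suc n). (1 / jap j)\<^sup>2) \<le> 6 - 4 / real (Suc n)" for n
  proof (induction n)
    case 0
    have "modes (Suc 0) = {-1, 0}" by (auto simp: modes_def)
    then show ?case by (simp add: jap_def freq_def)
  next
    case (Suc n)
    define N where "N = real (Suc n)"
    have N: "1 \<le> N" by (simp add: N_def)
    have m: "modes (Suc (Suc n)) = insert (int (Suc n)) (insert (- int (Suc n) - 1) (modes (Suc n)))"
      by (auto simp: modes_def)
    have "int (Suc n) \<notin> insert (- int (Suc n) - 1) (modes (Suc n))"
         "- int (Suc n) - 1 \<notin> modes (Suc n)"
      by (auto simp: modes_def)
    then have "(\<Sum>j\<in>modes (Suc (Suc n)). (1 / jap j)\<^sup>2)
        = (1 / N)\<^sup>2 + (1 / (N + 1))\<^sup>2 + (\<Sum>j\<in>modes (Suc n). (1 / jap j)\<^sup>2)"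
      unfolding m by (simp add: jap_def freq_def N_def algebra_simps)
    also have "\<dots> \<le> (1 / N)\<^sup>2 + (1 / (N + 1))\<^sup>2 + (6 - 4 / N)"
      using Suc.IH by (simp add: N_def)
    also have "\<dots> \<le> 6 - 4 / (N + 1)"
    proof -
      have "(1 / N)\<^sup>2 \<le> 2 / (N * (N + 1))" "(1 / (N + 1))\<^sup>2 \<le> 2 / (N * (N + 1))"
        using N by (auto simp: divide_simps power2_eq_square) 
      moreover have "4 / N - 4 / (N + 1) = 2 / (N * (N + 1)) + 2 / (N * (N + 1))"
        using N by (simp add: divide_simps)
      ultimately show ?thesis by linarith
    qed
    finally show ?case by (simp add: N_def)
  qed
  from this[of "K - 1"] show ?thesis
    by (cases K) (auto simp: modes_def intro: order_trans)
qed

lemma L2_set_inverse_jap: "L2_set (\<lambda>j. 1 / jap j) (modes K) \<le> 3"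
  unfolding L2_set_def
  by (rule real_le_lsqrt) (use sum_inverse_jap_square[of K] in \<open>auto intro: order_trans\<close>)

lemma sum_le_sob_norm: "(\<Sum>k\<in>modes K. jap k powr \<sigma> * cmod (y k)) \<le> 3 * sob_norm K (\<sigma> + 1) y"
proof -
  have "(\<Sum>k\<in>modes K. jap k powr \<sigma> * cmod (y k))
      = (\<Sum>k\<in>modes K. \<bar>1 / jap k\<bar> * \<bar>jap k powr (\<sigma> + 1) * cmod (y k)\<bar>)"
    by (intro sum.cong) (auto simp: powr_add abs_mult)
  also have "\<dots> \<le> L2_set (\<lambda>j. 1 / jap j) (modes K) * sob_norm K (\<sigma> + 1) y"
    unfolding sob_norm_L2 by (rule L2_set_mult_ineq)
  also have "\<dots> \<le> 3 * sob_norm K (\<sigma> + 1) y"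
    by (intro mult_right_mono L2_set_inverse_jap) simp
  finally show ?thesis .
qed

lemma cmod_conv_le: "cmod (conv K y z j) \<le> (\<Sum>(k, l)\<in>resonant_pairs K j. cmod (y k) * cmod (z l))"
  unfolding conv_eq by (rule order_trans[OF norm_sum]) (simp add: case_prod_beta norm_mult)

lemma powr_le_double_max:
  fixes x a b \<rho> \<tau> :: real
  assumes "x \<le> 2 * max a b" "0 < x" "0 \<le> \<rho>" "\<rho> \<le> \<tau>"
  shows "x powr \<rho> \<le> 2 powr \<tau> * (max a b) powr \<rho>"
proof -
  have "x powr \<rho> \<le> (2 * max a b) powr \<rho>" using assms by (intro powr_mono2) auto
  also have "\<dots> = 2 powr \<rho> * (max a b) powr \<rho>" using assms by (subst powr_mult) auto
  also have "\<dots> \<le> 2 powr \<tau> * (max a b) powr \<rho>" using assms by (intro mult_right_mono powr_mono) auto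
  finally show ?thesis .
qed

text \<open>
  If \<open>\<langle>l\<rangle>\<close> dominates, then \<open>\<langle>l\<rangle> powr (\<rho> - \<tau>) \<le> \<langle>k\<rangle> powr (\<rho> - \<tau>)\<close> because the exponent is not positive;
  this lets the factor of high regularity \<open>\<tau>\<close> take all derivatives while the other factor receives a
  summable weight.
\<close>
lemma weight_split:
  assumes "jap i \<le> 2 * max (jap k) (jap l)" and "0 \<le> \<rho>" "\<rho> \<le> \<tau>"
  shows "jap i powr \<rho> \<le> 2 powr \<tau> * (jap k powr \<rho> + jap k powr (\<rho> - \<tau>) * jap l powr \<tau>)"
proof -
  have "(max (jap k) (jap l)) powr \<rho> \<le> jap k powr \<rho> + jap k powr (\<rho> - \<tau>) * jap l powr \<tau>"
  proof (cases "jap l \<le> jap k")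
    case True
    then show ?thesis by (simp add: max_def)
  next
    case False
    then have "jap l powr \<rho> = jap l powr (\<rho> - \<tau>) * jap l powr \<tau>"
      by (simp flip: powr_add)
    also have "\<dots> \<le> jap k powr (\<rho> - \<tau>) * jap l powr \<tau>"
      using False assms by (intro mult_right_mono powr_mono2') auto
    finally have "jap l powr \<rho> \<le> jap k powr \<rho> + jap k powr (\<rho> - \<tau>) * jap l powr \<tau>"
      by (simp add: add_increasing)
    then show ?thesis using False by (simp add: max_def)
  qed
  then have "2 powr \<tau> * (max (jap k) (jap l)) powr \<rho> \<le> 2 powr \<tau> * (jap k powr \<rho> + jap k powr (\<rho> - \<tau>) * jap l powr \<tau>)"
    by (intro mult_left_mono) auto
  then show ?thesis
    using powr_le_double_max[OF assms(1) _ assms(2,3)] by (meson jap_pos order_trans)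
qed

lemma sob_norm_conv_split:
  fixes X Y :: real
  assumes "\<And>j k l. j \<in> modes K \<Longrightarrow> (k, l) \<in> resonant_pairs K j \<Longrightarrow>
      jap j powr \<sigma> * (cmod (y k) * cmod (z l)) \<le> B * (f k l + g j k l)"
    and "L2_set (\<lambda>j. \<Sum>(k, l)\<in>resonant_pairs K j. f k l) (modes K) \<le> X"
    and "L2_set (\<lambda>j. \<Sum>(k, l)\<in>resonant_pairs K j. g j k l) (modes K) \<le> Y"
    and "0 \<le> B"
  shows "sob_norm K \<sigma> (conv K y z) \<le> B * (X + Y)"
proof -
  define S where "S = (\<lambda>j. \<Sum>(k, l)\<in>resonant_pairs K j. f k l)"
  define S' where "S' = (\<lambda>j. \<Sum>(k, l)\<in>resonant_pairs K j. g j k l)"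
  have pt: "jap j powr \<sigma> * cmod (conv K y z j) \<le> B * (S j + S' j)" if "j \<in> modes K" for j
  proof -
    have "jap j powr \<sigma> * cmod (conv K y z j)
        \<le> jap j powr \<sigma> * (\<Sum>(k, l)\<in>resonant_pairs K j. cmod (y k) * cmod (z l))"
      by (intro mult_left_mono cmod_conv_le) auto
    also have "\<dots> \<le> (\<Sum>(k, l)\<in>resonant_pairs K j. B * (f k l + g j k l))"
      unfolding sum_distrib_left using assms(1)[OF that] by (intro sum_mono) auto
    also have "\<dots> = B * (S j + S' j)"
      by (simp add: S_def S'_def sum_distrib_left case_prod_beta flip: sum.distrib)
    finally show ?thesis .
  qed
  have "sob_norm K \<sigma> (conv K y z) \<le> B * L2_set (\<lambda>j. S j + S' j) (modes K)"
    unfolding sob_norm_L2 L2_set_right_distrib[OF assms(4)] using pt by (intro L2_set_mono) auto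
  also have "\<dots> \<le> B * (X + Y)"
    using assms(2,3) L2_set_triangle_ineq[of S S' "modes K"] \<open>0 \<le> B\<close>
    unfolding S_def[symmetric] S'_def[symmetric] by (intro mult_left_mono) auto
  finally show ?thesis .
qed

text \<open>
  For \<open>\<sigma> \<ge> 0\<close> the weight of the product is split over the two factors, and both parts are of the form
  \<open>\<ell>\<^sup>1 * \<ell>\<^sup>2\<close>. For \<open>\<sigma> < 0\<close> the resonance is read backwards, splitting the weight of \<open>k\<close> over \<open>j\<close> and \<open>l\<close>;
  one part is again \<open>\<ell>\<^sup>1 * \<ell>\<^sup>2\<close>, the other is \<open>\<ell>\<^sup>2 * \<ell>\<^sup>2\<close> weighted by \<open>\<langle>j\<rangle> powr (-\<tau>)\<close>, which is square summable.
\<close>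
lemma sob_norm_conv:
  assumes "K \<ge> 1" and "\<bar>\<sigma>\<bar> \<le> \<tau>" and "1 \<le> \<tau>"
  shows "sob_norm K \<sigma> (conv K y z) \<le> 6 * 2 powr \<tau> * (sob_norm K \<sigma> y * sob_norm K \<tau> z)"
proof -
  have z: "(\<Sum>l\<in>modes K. cmod (z l)) \<le> 3 * sob_norm K \<tau> z"
    using sum_le_sob_norm[where K = K and \<sigma> = 0 and y = z] sob_norm_order_mono[OF assms(3), of K z] by simp
  have high: "L2_set (\<lambda>j. \<Sum>(k, l)\<in>resonant_pairs K j. jap k powr \<sigma> * cmod (y k) * cmod (z l)) (modes K)
      \<le> 3 * (sob_norm K \<sigma> y * sob_norm K \<tau> z)"
  proof -
    have "L2_set (\<lambda>j. \<Sum>(k, l)\<in>resonant_pairs K j. jap k powr \<sigma> * cmod (y k) * cmod (z l)) (modes K)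
       = L2_set (\<lambda>j. \<Sum>(k, l)\<in>resonant_pairs K j. cmod (z k) * (jap l powr \<sigma> * cmod (y l))) (modes K)"
      by (subst resonant_swap) (simp add: mult.commute)
    also have "\<dots> \<le> (\<Sum>l\<in>modes K. cmod (z l)) * sob_norm K \<sigma> y"
      unfolding sob_norm_L2 by (rule discrete_Young[OF assms(1)]) auto
    also have "\<dots> \<le> 3 * sob_norm K \<tau> z * sob_norm K \<sigma> y"
      by (intro mult_right_mono z) auto
    finally show ?thesis by (simp add: mult_ac)
  qed
  have "sob_norm K \<sigma> (conv K y z) \<le> 2 powr \<tau> * (3 * (sob_norm K \<sigma> y * sob_norm K \<tau> z)
      + 3 * (sob_norm K \<sigma> y * sob_norm K \<tau> z))"
  proof (cases "0 \<le> \<sigma>")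
    case True
    show ?thesis
    proof (rule sob_norm_conv_split[where f = "\<lambda>k l. jap k powr \<sigma> * cmod (y k) * cmod (z l)"
          and g = "\<lambda>j k l. jap k powr (\<sigma> - \<tau>) * cmod (y k) * (jap l powr \<tau> * cmod (z l))"])
      fix j k l assume jkl: "j \<in> modes K" "(k, l) \<in> resonant_pairs K j"
      have "jap j powr \<sigma> * (cmod (y k) * cmod (z l)) \<le>
         2 powr \<tau> * (jap k powr \<sigma> + jap k powr (\<sigma> - \<tau>) * jap l powr \<tau>) * (cmod (y k) * cmod (z l))"
        using weight_split[OF jap_resonant(1)[OF jkl], of \<sigma> \<tau>] True assms by (intro mult_right_mono) auto
      then show "jap j powr \<sigma> * (cmod (y k) * cmod (z l)) \<le> 2 powr \<tau> * (jap k powr \<sigma> * cmod (y k) * cmod (z l)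
          + jap k powr (\<sigma> - \<tau>) * cmod (y k) * (jap l powr \<tau> * cmod (z l)))"
        by (simp add: algebra_simps)
    next
      have "L2_set (\<lambda>j. \<Sum>(k, l)\<in>resonant_pairs K j. jap k powr (\<sigma> - \<tau>) * cmod (y k) * (jap l powr \<tau> * cmod (z l)))
        (modes K) \<le> (\<Sum>k\<in>modes K. jap k powr (\<sigma> - \<tau>) * cmod (y k)) * sob_norm K \<tau> z"
        unfolding sob_norm_L2 by (rule discrete_Young[OF assms(1)]) auto
      also have "\<dots> \<le> 3 * sob_norm K \<sigma> y * sob_norm K \<tau> z"
        using sum_le_sob_norm[where K = K and \<sigma> = "\<sigma> - \<tau>" and y = y] sob_norm_order_mono[of "\<sigma> - \<tau> + 1" \<sigma> K y] assms
        by (intro mult_right_mono) auto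
      finally show "L2_set (\<lambda>j. \<Sum>(k, l)\<in>resonant_pairs K j. jap k powr (\<sigma> - \<tau>) * cmod (y k) * (jap l powr \<tau> * cmod (z l)))
        (modes K) \<le> 3 * (sob_norm K \<sigma> y * sob_norm K \<tau> z)" by simp
    qed (use high in auto)
  next
    case False
    define \<rho> where "\<rho> = - \<sigma>"
    have \<rho>: "0 \<le> \<rho>" "\<rho> \<le> \<tau>" using False assms by (auto simp: \<rho>_def)
    show ?thesis
    proof (rule sob_norm_conv_split[where f = "\<lambda>k l. jap k powr \<sigma> * cmod (y k) * cmod (z l)"
          and g = "\<lambda>j k l. jap j powr (- \<tau>) * (jap k powr \<sigma> * cmod (y k) * (jap l powr \<tau> * cmod (z l)))"])
      fix j k l assume jkl: "j \<in> modes K" "(k, l) \<in> resonant_pairs K j"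
      have "jap k powr \<rho> \<le> 2 powr \<tau> * (jap j powr \<rho> + jap j powr (\<rho> - \<tau>) * jap l powr \<tau>)"
        by (rule weight_split[OF jap_resonant(2)[OF jkl] \<rho>])
      then have "jap k powr \<rho> * (jap j powr \<sigma> * jap k powr \<sigma> * (cmod (y k) * cmod (z l))) \<le>
         2 powr \<tau> * (jap j powr \<rho> + jap j powr (\<rho> - \<tau>) * jap l powr \<tau>) * (jap j powr \<sigma> * jap k powr \<sigma> * (cmod (y k) * cmod (z l)))"
        by (intro mult_right_mono) auto
      moreover have "jap k powr \<rho> * jap k powr \<sigma> = 1" "jap j powr \<rho> * jap j powr \<sigma> = 1"
         "jap j powr (\<rho> - \<tau>) * jap j powr \<sigma> = jap j powr (- \<tau>)"
        by (simp_all add: \<rho>_def flip: powr_add)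
      moreover have "jap k powr \<rho> * (jap j powr \<sigma> * jap k powr \<sigma> * (cmod (y k) * cmod (z l)))
         = (jap k powr \<rho> * jap k powr \<sigma>) * (jap j powr \<sigma> * (cmod (y k) * cmod (z l)))"
        by (simp add: mult_ac)
      moreover have "2 powr \<tau> * (jap j powr \<rho> + jap j powr (\<rho> - \<tau>) * jap l powr \<tau>) * (jap j powr \<sigma> * jap k powr \<sigma> * (cmod (y k) * cmod (z l)))
         = 2 powr \<tau> * ((jap j powr \<rho> * jap j powr \<sigma>) * (jap k powr \<sigma> * cmod (y k) * cmod (z l))
            + (jap j powr (\<rho> - \<tau>) * jap j powr \<sigma>) * (jap k powr \<sigma> * cmod (y k) * (jap l powr \<tau> * cmod (z l))))"
        by (simp add: algebra_simps)
      ultimately show "jap j powr \<sigma> * (cmod (y k) * cmod (z l)) \<le> 2 powr \<tau> * (jap k powr \<sigma> * cmod (y k) * cmod (z l)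
          + jap j powr (- \<tau>) * (jap k powr \<sigma> * cmod (y k) * (jap l powr \<tau> * cmod (z l))))"
        by simp
    next
      let ?P = "sob_norm K \<sigma> y * sob_norm K \<tau> z"
      have "(\<Sum>(k, l)\<in>resonant_pairs K j. jap j powr (- \<tau>) * (jap k powr \<sigma> * cmod (y k) * (jap l powr \<tau> * cmod (z l))))
          \<le> ?P * (1 / jap j)" for j
      proof -
        have "(\<Sum>(k, l)\<in>resonant_pairs K j. jap k powr \<sigma> * cmod (y k) * (jap l powr \<tau> * cmod (z l))) \<le> ?P"
          unfolding sob_norm_L2 by (rule resonant_Cauchy_Schwarz[OF assms(1)]) auto
        moreover have "jap j powr (- \<tau>) \<le> 1 / jap j"
          using powr_mono[of "-\<tau>" "-1" "jap j"] assms(3) by (simp add: powr_minus_divide)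
        ultimately have "jap j powr (- \<tau>) * (\<Sum>(k, l)\<in>resonant_pairs K j. jap k powr \<sigma> * cmod (y k) * (jap l powr \<tau> * cmod (z l)))
          \<le> (1 / jap j) * ?P"
          by (intro mult_mono) (auto intro!: sum_nonneg)
        then show ?thesis by (simp add: sum_distrib_left case_prod_beta mult_ac)
      qed
      then have "L2_set (\<lambda>j. \<Sum>(k, l)\<in>resonant_pairs K j. jap j powr (- \<tau>) * (jap k powr \<sigma> * cmod (y k) * (jap l powr \<tau> * cmod (z l))))
        (modes K) \<le> L2_set (\<lambda>j. ?P * (1 / jap j)) (modes K)"
        by (intro L2_set_mono) (auto intro!: sum_nonneg)
      also have "\<dots> = ?P * L2_set (\<lambda>j. 1 / jap j) (modes K)"
        by (rule L2_set_right_distrib[symmetric]) simp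
      also have "\<dots> \<le> ?P * 3"
        by (intro mult_left_mono L2_set_inverse_jap) simp
      finally show "L2_set (\<lambda>j. \<Sum>(k, l)\<in>resonant_pairs K j. jap j powr (- \<tau>) * (jap k powr \<sigma> * cmod (y k) * (jap l powr \<tau> * cmod (z l))))
        (modes K) \<le> 3 * ?P" by simp
    qed (use high in auto)
  qed
  then show ?thesis by (simp add: algebra_simps)
qed

text \<open>
  Order \<open>s\<close> need not be an algebra (for \<open>s = 0\<close> it is not, uniformly in \<open>K\<close>), but a product of two such
  vectors is bounded pointwise after distributing the weight, and one order less makes a bounded
  sequence square summable.
\<close>
lemma sob_norm_conv_lossy:
  assumes "K \<ge> 1" and "0 \<le> s"
  shows "sob_norm K (s - 1) (conv K a b) \<le> 6 * 2 powr s * (sob_norm K s a * sob_norm K s b)"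
proof -
  let ?P = "sob_norm K s a * sob_norm K s b"
  have "jap j powr (s - 1) * cmod (conv K a b j) \<le> 2 * 2 powr s * ?P * (1 / jap j)" if j: "j \<in> modes K" for j
  proof -
    have "jap j powr s * cmod (conv K a b j) \<le> jap j powr s * (\<Sum>(k, l)\<in>resonant_pairs K j. cmod (a k) * cmod (b l))"
      by (intro mult_left_mono cmod_conv_le) auto
    also have "\<dots> = (\<Sum>(k, l)\<in>resonant_pairs K j. jap j powr s * (cmod (a k) * cmod (b l)))"
      by (simp add: sum_distrib_left case_prod_beta)
    also have "\<dots> \<le> (\<Sum>(k, l)\<in>resonant_pairs K j. 2 * 2 powr s * (jap k powr s * cmod (a k) * (jap l powr s * cmod (b l))))"
    proof (intro sum_mono, safe)
      fix k l assume kl: "(k, l) \<in> resonant_pairs K j"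
      have "jap j powr s \<le> 2 powr s * (jap k powr s + jap k powr (s - s) * jap l powr s)"
        by (rule weight_split[OF jap_resonant(1)[OF j kl]]) (use assms in auto)
      also have "\<dots> \<le> 2 powr s * (jap k powr s * jap l powr s + jap k powr s * jap l powr s)"
        using ge_one_powr_ge_zero[of "jap k" s] ge_one_powr_ge_zero[of "jap l" s] assms(2)
        by (intro mult_left_mono add_mono) (auto simp: mult_le_cancel_left1 mult_le_cancel_right1 less_le_not_le)
      finally have "jap j powr s * (cmod (a k) * cmod (b l)) \<le>
         2 powr s * (jap k powr s * jap l powr s + jap k powr s * jap l powr s) * (cmod (a k) * cmod (b l))"
        by (intro mult_right_mono) auto
      then show "jap j powr s * (cmod (a k) * cmod (b l)) \<le> 2 * 2 powr s * (jap k powr s * cmod (a k) * (jap l powr s * cmod (b l)))"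
        by (simp add: algebra_simps)
    qed
    also have "\<dots> = 2 * 2 powr s * (\<Sum>(k, l)\<in>resonant_pairs K j. jap k powr s * cmod (a k) * (jap l powr s * cmod (b l)))"
      by (simp add: sum_distrib_left case_prod_beta)
    also have "\<dots> \<le> 2 * 2 powr s * ?P"
      unfolding sob_norm_L2 by (intro mult_left_mono resonant_Cauchy_Schwarz[OF assms(1)]) auto
    finally have "jap j powr s * cmod (conv K a b j) * (1 / jap j) \<le> 2 * 2 powr s * ?P * (1 / jap j)"
      by (intro mult_right_mono) auto
    then show ?thesis by (simp add: powr_diff)
  qed
  then have "sob_norm K (s - 1) (conv K a b) \<le> L2_set (\<lambda>j. 2 * 2 powr s * ?P * (1 / jap j)) (modes K)"
    unfolding sob_norm_L2[of _ "s - 1"] by (intro L2_set_mono) auto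
  also have "\<dots> = 2 * 2 powr s * ?P * L2_set (\<lambda>j. 1 / jap j) (modes K)"
    by (rule L2_set_right_distrib[symmetric]) simp
  also have "\<dots> \<le> 2 * 2 powr s * ?P * 3"
    by (intro mult_left_mono L2_set_inverse_jap) simp
  finally show ?thesis by simp
qed

section \<open>Powers\<close>

abbreviation cpow :: "nat \<Rightarrow> nat \<Rightarrow> cvec \<Rightarrow> cvec" where
  "cpow K q y \<equiv> (conv K y ^^ q) y"

lemma sob_norm_convex:
  assumes "sob_norm K \<sigma> u \<le> R" "sob_norm K \<sigma> z \<le> R" "0 \<le> \<theta>" "\<theta> \<le> 1"
  shows "sob_norm K \<sigma> (\<lambda>j. (1 - complex_of_real \<theta>) * u j + complex_of_real \<theta> * z j) \<le> R"
proof -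
  have "cmod (1 - complex_of_real \<theta>) = 1 - \<theta>"
    using assms by (metis abs_of_nonneg diff_ge_0_iff_ge norm_of_real of_real_1 of_real_diff)
  then have "sob_norm K \<sigma> (\<lambda>j. (1 - complex_of_real \<theta>) * u j + complex_of_real \<theta> * z j)
      \<le> (1 - \<theta>) * sob_norm K \<sigma> u + \<theta> * sob_norm K \<sigma> z"
    using sob_norm_triangle[of K \<sigma> "\<lambda>j. (1 - complex_of_real \<theta>) * u j" "\<lambda>j. complex_of_real \<theta> * z j"] assms
    by (simp add: sob_norm_scale)
  also have "\<dots> \<le> (1 - \<theta>) * R + \<theta> * R"
    using assms by (intro add_mono mult_left_mono) auto
  finally show ?thesis by (simp add: algebra_simps)
qed

lemma sob_norm_cpow_le:
  assumes "K \<ge> 1" and "1 \<le> \<tau>" and "sob_norm K \<tau> y \<le> R"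
  shows "sob_norm K \<tau> (cpow K q y) \<le> (6 * 2 powr \<tau>) ^ q * R ^ (q + 1)"
proof (induction q)
  case 0
  then show ?case using assms by simp
next
  case (Suc q)
  have R: "0 \<le> R" using assms(3) sob_norm_nonneg order_trans by blast
  have "sob_norm K \<tau> (cpow K (Suc q) y) \<le> 6 * 2 powr \<tau> * (sob_norm K \<tau> y * sob_norm K \<tau> (cpow K q y))"
    using sob_norm_conv[OF assms(1) _ assms(2), of \<tau> y "cpow K q y"] assms(2) by simp
  also have "\<dots> \<le> 6 * 2 powr \<tau> * (R * ((6 * 2 powr \<tau>) ^ q * R ^ (q + 1)))"
    using assms Suc.IH R by (intro mult_left_mono mult_mono) auto
  finally show ?case by (simp add: mult_ac)
qed

text \<open>
  Telescoping \<open>y * y\<^sup>q - z * z\<^sup>q = (y - z) * y\<^sup>q + z * (y\<^sup>q - z\<^sup>q)\<close>, with all factors but the difference in order \<open>\<tau>\<close>.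
\<close>
lemma sob_norm_cpow_diff_le:
  assumes "K \<ge> 1" and "1 \<le> \<tau>" and "\<bar>\<sigma>\<bar> \<le> \<tau>" and "sob_norm K \<tau> y \<le> R" and "sob_norm K \<tau> z \<le> R"
  shows "sob_norm K \<sigma> (\<lambda>j. cpow K q y j - cpow K q z j)
      \<le> real (q + 1) * (6 * 2 powr \<tau> * R) ^ q * sob_norm K \<sigma> (\<lambda>j. y j - z j)"
proof (induction q)
  case 0
  then show ?case using assms by simp
next
  case (Suc q)
  let ?A = "6 * 2 powr \<tau>" and ?d = "\<lambda>j. y j - z j" and ?e = "\<lambda>j. cpow K q y j - cpow K q z j"
  have R: "0 \<le> R" using assms(4) sob_norm_nonneg order_trans by blast
  have "(\<lambda>j. cpow K (Suc q) y j - cpow K (Suc q) z j)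
      = (\<lambda>j. conv K ?d (cpow K q y) j + conv K ?e z j)"
    by (simp add: conv_diff_left conv_diff_right conv_commute[of K ?e] del: funpow.simps(2))
       (simp add: conv_diff_right)
  then have "sob_norm K \<sigma> (\<lambda>j. cpow K (Suc q) y j - cpow K (Suc q) z j)
      \<le> sob_norm K \<sigma> (conv K ?d (cpow K q y)) + sob_norm K \<sigma> (conv K ?e z)"
    using sob_norm_triangle by metis
  also have "\<dots> \<le> ?A * (sob_norm K \<sigma> ?d * sob_norm K \<tau> (cpow K q y)) + ?A * (sob_norm K \<sigma> ?e * sob_norm K \<tau> z)"
    by (intro add_mono sob_norm_conv assms)
  also have "\<dots> \<le> ?A * (sob_norm K \<sigma> ?d * (?A ^ q * R ^ (q + 1)))
      + ?A * ((real (q + 1) * (?A * R) ^ q * sob_norm K \<sigma> ?d) * R)"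
    using assms Suc.IH R sob_norm_cpow_le[OF assms(1,2,4), of q] by (intro add_mono mult_left_mono mult_mono) auto
  also have "\<dots> = real (Suc q + 1) * (?A * R) ^ Suc q * sob_norm K \<sigma> ?d"
    by (simp add: algebra_simps power_mult_distrib)
  finally show ?case .
qed

text \<open>
  A power of an interpolated vector differs from the interpolated powers by terms that are quadratic
  in \<open>a = z - u\<close>. Being quadratic they are small of second order in the weak norm, although \<open>a\<close> itself
  is small only in order \<open>s\<close>.
\<close>
lemma cpow_linear_interpolation:
  assumes "0 \<le> s" and "0 \<le> R"
  shows "\<exists>Q\<ge>0. \<forall>K u z \<theta>. K \<ge> 1 \<longrightarrow> 0 \<le> \<theta> \<longrightarrow> \<theta> \<le> 1 \<longrightarrow> sob_norm K (s + 1) u \<le> R \<longrightarrow> sob_norm K (s + 1) z \<le> R \<longrightarrow>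
      sob_norm K (s - 1) (\<lambda>j. cpow K q (\<lambda>i. (1 - complex_of_real \<theta>) * u i + complex_of_real \<theta> * z i) j
        - ((1 - complex_of_real \<theta>) * cpow K q u j + complex_of_real \<theta> * cpow K q z j))
      \<le> Q * (sob_norm K s (\<lambda>j. z j - u j))\<^sup>2"
proof (induction q)
  case 0
  then show ?case by (intro exI[of _ 0]) simp
next
  case (Suc q)
  then obtain Q where Q: "0 \<le> Q" and IH: "\<And>K u z \<theta>. K \<ge> 1 \<Longrightarrow> 0 \<le> \<theta> \<Longrightarrow> \<theta> \<le> 1 \<Longrightarrow>
      sob_norm K (s + 1) u \<le> R \<Longrightarrow> sob_norm K (s + 1) z \<le> R \<Longrightarrow>
      sob_norm K (s - 1) (\<lambda>j. cpow K q (\<lambda>i. (1 - complex_of_real \<theta>) * u i + complex_of_real \<theta> * z i) j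
        - ((1 - complex_of_real \<theta>) * cpow K q u j + complex_of_real \<theta> * cpow K q z j))
      \<le> Q * (sob_norm K s (\<lambda>j. z j - u j))\<^sup>2"
    by blast
  define A where "A = 6 * 2 powr (s + 1)"
  define A' where "A' = 6 * 2 powr s"
  define L where "L = real (q + 1) * (A * R) ^ q"
  have A: "0 \<le> A" "0 \<le> A'" "0 \<le> L" using assms by (auto simp: A_def A'_def L_def)
  show ?case
  proof (rule exI[of _ "A * R * Q + A' * L"], intro conjI allI impI)
    show "0 \<le> A * R * Q + A' * L" using A Q assms by simp
    fix K :: nat and u z :: cvec and \<theta> :: real
    assume K: "K \<ge> 1" and \<theta>: "0 \<le> \<theta>" "\<theta> \<le> 1"
      and u: "sob_norm K (s + 1) u \<le> R" and z: "sob_norm K (s + 1) z \<le> R"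
    define \<eta> where "\<eta> = complex_of_real \<theta>"
    define x where "x = (\<lambda>i. (1 - \<eta>) * u i + \<eta> * z i)"
    define a where "a = (\<lambda>j. z j - u j)"
    define d where "d = (\<lambda>j. cpow K q z j - cpow K q u j)"
    define I where "I = (\<lambda>j. (1 - \<eta>) * cpow K q u j + \<eta> * cpow K q z j)"
    define e where "e = (\<lambda>j. cpow K q x j - I j)"
    have x: "sob_norm K (s + 1) x \<le> R"
      unfolding x_def \<eta>_def by (rule sob_norm_convex[OF u z \<theta>])
    \<comment> \<open>The defect for \<open>q + 1\<close> is \<open>x\<close> times the defect for \<open>q\<close> plus the explicit quadratic term.\<close>
    have eq: "cpow K (Suc q) x j - ((1 - \<eta>) * cpow K (Suc q) u j + \<eta> * cpow K (Suc q) z j)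
        = conv K e x j - \<eta> * (1 - \<eta>) * conv K a d j" for j
    proof -
      have 1: "conv K e x j = conv K x (cpow K q x) j - conv K x I j"
        by (simp add: e_def conv_diff_left conv_commute[of K x])
      have 2: "conv K x I j = (1 - \<eta>) * conv K x (cpow K q u) j + \<eta> * conv K x (cpow K q z) j"
        by (simp add: I_def conv_add_right conv_scale_right)
      have 3: "conv K x w j = (1 - \<eta>) * conv K u w j + \<eta> * conv K z w j" for w
        by (simp add: x_def conv_add_left conv_scale_left)
      have 4: "conv K a d j = conv K z (cpow K q z) j - conv K z (cpow K q u) j
          - conv K u (cpow K q z) j + conv K u (cpow K q u) j"
        by (simp add: a_def d_def conv_diff_left conv_diff_right)
      show ?thesis
        unfolding 1 2 3[of "cpow K q u"] 3[of "cpow K q z"] 4 by (simp add: algebra_simps)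
    qed
    have c1: "cmod (\<eta> * (1 - \<eta>)) \<le> 1"
    proof -
      have "cmod (1 - \<eta>) = 1 - \<theta>"
        unfolding \<eta>_def using \<theta> by (metis abs_of_nonneg diff_ge_0_iff_ge norm_of_real of_real_1 of_real_diff)
      moreover have "cmod \<eta> = \<theta>" using \<theta> by (simp add: \<eta>_def)
      ultimately show ?thesis using \<theta> by (simp add: norm_mult mult_le_one)
    qed
    have ad: "sob_norm K (s - 1) (conv K a d) \<le> A' * L * (sob_norm K s a)\<^sup>2"
    proof -
      have "sob_norm K s d \<le> L * sob_norm K s a"
        unfolding d_def a_def L_def A_def using assms u z K
        by (intro sob_norm_cpow_diff_le) auto
      then have "A' * (sob_norm K s a * sob_norm K s d) \<le> A' * (sob_norm K s a * (L * sob_norm K s a))"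
        using A by (intro mult_left_mono) auto
      moreover have "sob_norm K (s - 1) (conv K a d) \<le> A' * (sob_norm K s a * sob_norm K s d)"
        unfolding A'_def by (rule sob_norm_conv_lossy[OF K assms(1)])
      ultimately show ?thesis by (simp add: power2_eq_square mult_ac)
    qed
    have ex: "sob_norm K (s - 1) (conv K e x) \<le> A * R * Q * (sob_norm K s a)\<^sup>2"
    proof -
      have "sob_norm K (s - 1) (conv K e x) \<le> A * (sob_norm K (s - 1) e * sob_norm K (s + 1) x)"
        unfolding A_def using assms(1) by (intro sob_norm_conv K) auto
      also have "\<dots> \<le> A * ((Q * (sob_norm K s a)\<^sup>2) * R)"
        using IH[OF K \<theta> u z] A x Q unfolding e_def x_def I_def a_def \<eta>_def
        by (intro mult_left_mono mult_mono) auto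
      finally show ?thesis by (simp add: mult_ac)
    qed
    have "sob_norm K (s - 1) (\<lambda>j. conv K e x j - \<eta> * (1 - \<eta>) * conv K a d j)
        \<le> sob_norm K (s - 1) (conv K e x) + cmod (\<eta> * (1 - \<eta>)) * sob_norm K (s - 1) (conv K a d)"
      using sob_norm_triangle_diff[of K "s - 1" "conv K e x" "\<lambda>j. \<eta> * (1 - \<eta>) * conv K a d j"]
        sob_norm_scale[of K "s - 1" "\<eta> * (1 - \<eta>)" "conv K a d"] by simp
    also have "\<dots> \<le> A * R * Q * (sob_norm K s a)\<^sup>2 + 1 * (A' * L * (sob_norm K s a)\<^sup>2)"
      by (intro add_mono mult_mono ex ad c1) auto
    also have "\<dots> = (A * R * Q + A' * L) * (sob_norm K s a)\<^sup>2" by (simp add: algebra_simps)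
    finally show "sob_norm K (s - 1) (\<lambda>j. cpow K (Suc q) (\<lambda>i. (1 - complex_of_real \<theta>) * u i + complex_of_real \<theta> * z i) j
        - ((1 - complex_of_real \<theta>) * cpow K (Suc q) u j + complex_of_real \<theta> * cpow K (Suc q) z j))
      \<le> (A * R * Q + A' * L) * (sob_norm K s (\<lambda>j. z j - u j))\<^sup>2"
      unfolding \<eta>_def[symmetric] x_def[symmetric] a_def[symmetric] eq .
  qed
qed

section \<open>The free flow and variation of constants\<close>

lemma one_minus_cos_bounds:
  fixes x :: real
  assumes "0 \<le> x"
  shows "0 \<le> 1 - cos x" "1 - cos x \<le> x" "1 - cos x \<le> x\<^sup>2 / 2"
proof -
  have eq: "1 - cos x = 2 * (sin (x / 2))\<^sup>2"
    using cos_double_sin[of "x / 2"] by simp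
  have a: "\<bar>sin (x / 2)\<bar> \<le> x / 2" using abs_sin_x_le_abs_x[of "x / 2"] assms by simp
  have "\<bar>sin (x / 2)\<bar> * \<bar>sin (x / 2)\<bar> \<le> (x / 2) * 1"
    using a assms by (intro mult_mono) auto
  then show "1 - cos x \<le> x" unfolding eq by (simp add: power2_eq_square)
  have "\<bar>sin (x / 2)\<bar> * \<bar>sin (x / 2)\<bar> \<le> (x / 2) * (x / 2)"
    using a assms by (intro mult_mono) auto
  then show "1 - cos x \<le> x\<^sup>2 / 2" unfolding eq by (simp add: power2_eq_square)
  show "0 \<le> 1 - cos x" by simp
qed

lemma x_minus_sin_bounds:
  fixes x :: real
  assumes "0 \<le> x"
  shows "\<bar>sin x - x\<bar> \<le> x\<^sup>2"
proof (cases "x = 0")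
  case False
  then have "0 < x" using assms by simp
  have "((\<lambda>x. x - sin x) has_real_derivative 1 - cos u) (at u)" for u :: real
    by (auto intro!: derivative_eq_intros)
  from MVT2[OF \<open>0 < x\<close> this] obtain z where z: "0 < z" "z < x" "x - sin x = x * (1 - cos z)"
    by auto
  have "x * (1 - cos z) \<le> x * x" "0 \<le> x * (1 - cos z)"
    using one_minus_cos_bounds(2)[of z] z \<open>0 < x\<close> by (auto intro!: mult_left_mono)
  then show ?thesis unfolding power2_eq_square z(3)[symmetric] by linarith
qed simp

text \<open>
  The symbol of the integrated flow: the integral of \<open>cos (\<tau> w)\<close> over \<open>0 \<le> \<tau> \<le> r\<close>, which is
  \<open>sin (r w) / w\<close> with its limit at \<open>w = 0\<close>.
\<close>
definition sinc_kernel :: "real \<Rightarrow> real \<Rightarrow> real" where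
  "sinc_kernel r w = r * sinc (r * w)"

lemma sinc_kernel_eq: "sinc_kernel r w = (if w = 0 then r else sin (r * w) / w)"
  by (simp add: sinc_kernel_def)

lemma sinc_kernel_le_inverse: "0 \<le> r \<Longrightarrow> r \<le> 1 \<Longrightarrow> \<bar>sinc_kernel r (freq j)\<bar> \<le> jap j powr (-1)"
  by (cases "freq j = 0") (auto simp: sinc_kernel_eq jap_eq_1 jap_eq_freq powr_minus_divide divide_right_mono)

lemma sinc_kernel_le: "0 \<le> r \<Longrightarrow> 0 \<le> w \<Longrightarrow> \<bar>sinc_kernel r w\<bar> \<le> r"
  using abs_sin_x_le_abs_x[of "r * w"] by (auto simp: sinc_kernel_eq divide_simps abs_mult)

lemma sinc_kernel_minus_le: "0 \<le> r \<Longrightarrow> \<bar>sinc_kernel r (freq j) - r\<bar> \<le> r\<^sup>2 * jap j powr 1"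
proof (cases "freq j = 0")
  case False
  assume r: "0 \<le> r"
  let ?w = "freq j"
  have w: "0 < ?w" using False freq_nonneg[of j] by linarith
  have "\<bar>sin (r * ?w) - r * ?w\<bar> \<le> (r * ?w)\<^sup>2"
    using r by (intro x_minus_sin_bounds) simp
  then have "\<bar>sin (r * ?w) - r * ?w\<bar> / ?w \<le> (r * ?w)\<^sup>2 / ?w"
    using w by (intro divide_right_mono) auto
  moreover have "sinc_kernel r ?w - r = (sin (r * ?w) - r * ?w) / ?w"
    using w by (simp add: sinc_kernel_eq field_simps)
  ultimately show ?thesis
    using w by (simp add: jap_eq_freq abs_mult power2_eq_square)
qed (simp add: sinc_kernel_eq)

text \<open>
  The components of \<open>R(b - \<tau>)\<close> applied to \<open>(Y \<tau>, V \<tau>)\<close> would be constant for the free equation; their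
  derivative is the forcing seen through the flow. This is the variation of constants formula in
  differential form.
\<close>
lemma back_propagation_derivative:
  fixes Y V :: "real \<Rightarrow> complex"
  assumes Y: "(Y has_vector_derivative V t) (at t within S)"
    and V: "(V has_vector_derivative - complex_of_real (w\<^sup>2) * Y t + g) (at t within S)"
  shows "((\<lambda>\<tau>. complex_of_real (cos ((b - \<tau>) * w)) * Y \<tau> + complex_of_real (sinc_kernel (b - \<tau>) w) * V \<tau>)
      has_vector_derivative complex_of_real (sinc_kernel (b - t) w) * g) (at t within S)"
    and "((\<lambda>\<tau>. complex_of_real (- w * sin ((b - \<tau>) * w)) * Y \<tau> + complex_of_real (cos ((b - \<tau>) * w)) * V \<tau>)
      has_vector_derivative complex_of_real (cos ((b - t) * w)) * g) (at t within S)"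
proof -
  have c: "((\<lambda>\<tau>. complex_of_real (cos ((b - \<tau>) * w))) has_vector_derivative
      complex_of_real (w * sin ((b - t) * w))) (at t within S)"
    by (intro has_vector_derivative_of_real) (auto intro!: derivative_eq_intros)
  have sn: "((\<lambda>\<tau>. complex_of_real (- w * sin ((b - \<tau>) * w))) has_vector_derivative
      complex_of_real (w\<^sup>2 * cos ((b - t) * w))) (at t within S)"
    by (intro has_vector_derivative_of_real) (auto intro!: derivative_eq_intros simp: power2_eq_square)
  have dr: "((\<lambda>\<tau>. sinc_kernel (b - \<tau>) w) has_real_derivative - cos ((b - t) * w)) (at t within S)"
    by (cases "w = 0") (auto simp: sinc_kernel_eq intro!: derivative_eq_intros)
  have d: "((\<lambda>\<tau>. complex_of_real (sinc_kernel (b - \<tau>) w)) has_vector_derivative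
      complex_of_real (- cos ((b - t) * w))) (at t within S)"
    by (intro has_vector_derivative_of_real dr)
  have "w * sin ((b - t) * w) = w\<^sup>2 * sinc_kernel (b - t) w"
    by (simp add: sinc_kernel_eq power2_eq_square)
  then have k: "complex_of_real (w * sin ((b - t) * w))
      = complex_of_real (w\<^sup>2) * complex_of_real (sinc_kernel (b - t) w)"
    by (metis of_real_mult)
  have cancel: "p * x' + p' * x + (q * (- W * x + g) + q' * x') = q * g"
    if "p' = W * q" "q' = - p" for p p' q q' x x' W :: complex
    using that by (simp add: algebra_simps)
  show "((\<lambda>\<tau>. complex_of_real (cos ((b - \<tau>) * w)) * Y \<tau> + complex_of_real (sinc_kernel (b - \<tau>) w) * V \<tau>)
      has_vector_derivative complex_of_real (sinc_kernel (b - t) w) * g) (at t within S)"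
    by (rule has_vector_derivative_eq_rhs[OF has_vector_derivative_add[OF
          has_vector_derivative_mult[OF c Y] has_vector_derivative_mult[OF d V]]])
       (rule cancel, use k in simp_all)
  show "((\<lambda>\<tau>. complex_of_real (- w * sin ((b - \<tau>) * w)) * Y \<tau> + complex_of_real (cos ((b - \<tau>) * w)) * V \<tau>)
      has_vector_derivative complex_of_real (cos ((b - t) * w)) * g) (at t within S)"
    by (rule has_vector_derivative_eq_rhs[OF has_vector_derivative_add[OF
          has_vector_derivative_mult[OF sn Y] has_vector_derivative_mult[OF c V]]])
       (rule cancel, simp_all)
qed

section \<open>Defects of the unfiltered scheme along the exact solution\<close>

definition defect_const :: "real \<Rightarrow> real \<Rightarrow> real \<Rightarrow> real \<Rightarrow> real" where
  "defect_const M B L Q = 2 * B + 2 * L * M + 2 * L * (M + B) + Q * M\<^sup>2"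

text \<open>
  A bounded exact solution, together with the constants of the nonlinearity on the ball of radius \<open>R\<close>
  of order \<open>s + 1\<close>. Keeping \<open>B\<close>, \<open>L\<close> and \<open>Q\<close> as parameters makes it visible that all later constants are
  explicit expressions in them and hence independent of \<open>K\<close>. The radius exceeds \<open>M\<close> to leave room for
  the numerical solution.
\<close>
locale semidiscrete_wave =
  fixes K p :: nat and s T M t0 R B L Q :: real and y v :: "real \<Rightarrow> cvec"
  assumes K: "K \<ge> 1" and s: "0 \<le> s"
    and solution: "exact_solution K p t0 T y v"
    and y_bound: "\<And>t. t \<in> {t0..t0 + T} \<Longrightarrow> sob_norm K (s + 1) (y t) \<le> M"
    and v_bound: "\<And>t. t \<in> {t0..t0 + T} \<Longrightarrow> sob_norm K s (v t) \<le> M"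
    and const_nonneg: "0 \<le> M" "0 \<le> B" "0 \<le> L" "0 \<le> Q" and M_le_R: "M \<le> R"
    and f_bound: "\<And>u. sob_norm K (s + 1) u \<le> R \<Longrightarrow> sob_norm K (s + 1) (nonlin K p u) \<le> B"
    and f_lipschitz: "\<And>u w \<sigma>. sob_norm K (s + 1) u \<le> R \<Longrightarrow> sob_norm K (s + 1) w \<le> R \<Longrightarrow> \<bar>\<sigma>\<bar> \<le> s + 1 \<Longrightarrow>
      sob_norm K \<sigma> (\<lambda>j. nonlin K p u j - nonlin K p w j) \<le> L * sob_norm K \<sigma> (\<lambda>j. u j - w j)"
    and f_interpolation: "\<And>u z \<theta>. 0 \<le> \<theta> \<Longrightarrow> \<theta> \<le> 1 \<Longrightarrow> sob_norm K (s + 1) u \<le> R \<Longrightarrow> sob_norm K (s + 1) z \<le> R \<Longrightarrow>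
      sob_norm K (s - 1) (\<lambda>j. nonlin K p (\<lambda>i. (1 - complex_of_real \<theta>) * u i + complex_of_real \<theta> * z i) j
        - ((1 - complex_of_real \<theta>) * nonlin K p u j + complex_of_real \<theta> * nonlin K p z j))
      \<le> Q * (sob_norm K s (\<lambda>j. z j - u j))\<^sup>2"
begin

abbreviation F :: "real \<Rightarrow> cvec" where
  "F t \<equiv> nonlin K p (y t)"

lemma y_derivative:
  assumes "t \<in> S" "S \<subseteq> {t0..t0 + T}" "j \<in> modes K"
  shows "((\<lambda>\<tau>. y \<tau> j) has_vector_derivative v t j) (at t within S)"
  using solution assms has_vector_derivative_within_subset unfolding exact_solution_def by blast

lemma v_derivative:
  assumes "t \<in> S" "S \<subseteq> {t0..t0 + T}" "j \<in> modes K"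
  shows "((\<lambda>\<tau>. v \<tau> j) has_vector_derivative - complex_of_real ((freq j)\<^sup>2) * y t j + F t j) (at t within S)"
  using solution assms has_vector_derivative_within_subset unfolding exact_solution_def by blast

lemma F_bound: "t \<in> {t0..t0 + T} \<Longrightarrow> sob_norm K (s + 1) (F t) \<le> B"
  using y_bound M_le_R by (intro f_bound) force

lemma y_increment:
  assumes "a \<le> b" "{a..b} \<subseteq> {t0..t0 + T}"
  shows "sob_norm K s (\<lambda>j. y b j - y a j) \<le> M * (b - a)"
  by (rule sob_norm_increment_le[where x' = v])
     (use assms in \<open>auto intro!: y_derivative v_bound\<close>)

lemma F_increment:
  assumes "a \<le> b" "{a..b} \<subseteq> {t0..t0 + T}"
  shows "sob_norm K s (\<lambda>j. F b j - F a j) \<le> L * M * (b - a)"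
proof -
  have "sob_norm K s (\<lambda>j. F b j - F a j) \<le> L * sob_norm K s (\<lambda>j. y b j - y a j)"
    by (intro f_lipschitz order_trans[OF y_bound M_le_R]) (use assms s in auto)
  also have "\<dots> \<le> L * (M * (b - a))"
    using const_nonneg by (intro mult_left_mono y_increment assms)
  finally show ?thesis by simp
qed

text \<open>
  The equation gives \<open>\<Omega>\<^sup>2 y\<close> in order \<open>s - 1\<close>, two orders below \<open>y\<close>.
\<close>
lemma v_increment:
  assumes "a \<le> b" "{a..b} \<subseteq> {t0..t0 + T}"
  shows "sob_norm K (s - 1) (\<lambda>j. v b j - v a j) \<le> (M + B) * (b - a)"
proof (rule sob_norm_increment_le[where x' = "\<lambda>t j. - complex_of_real ((freq j)\<^sup>2) * y t j + F t j"])
  fix t assume "t \<in> {a..b}"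
  then have t: "t \<in> {t0..t0 + T}" using assms by auto
  have "sob_norm K (s - 1) (\<lambda>j. - complex_of_real ((freq j)\<^sup>2) * y t j) \<le> 1 * sob_norm K (s - 1 + 2) (y t)"
    by (rule sob_norm_multiplier)
       (auto simp: norm_mult norm_power intro!: mult_right_mono power_mono freq_le_jap)
  moreover have "s - 1 + 2 = s + 1" by simp
  ultimately have "sob_norm K (s - 1) (\<lambda>j. - complex_of_real ((freq j)\<^sup>2) * y t j) \<le> M"
    using y_bound[OF t] by (metis mult_1 order_trans)
  moreover have "sob_norm K (s - 1) (F t) \<le> B"
    using F_bound[OF t] sob_norm_order_mono[of "s - 1" "s + 1" K "F t"] by linarith
  ultimately show "sob_norm K (s - 1) (\<lambda>j. - complex_of_real ((freq j)\<^sup>2) * y t j + F t j) \<le> M + B"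
    using sob_norm_triangle[of K "s - 1" "\<lambda>j. - complex_of_real ((freq j)\<^sup>2) * y t j" "F t"] by linarith
qed (use assms v_derivative in blast)+

lemma y_taylor:
  assumes "a \<le> b" "{a..b} \<subseteq> {t0..t0 + T}"
  shows "sob_norm K (s - 1) (\<lambda>j. y b j - y a j - complex_of_real (b - a) * v a j) \<le> (M + B) * (b - a)\<^sup>2"
proof -
  have "sob_norm K (s - 1) (\<lambda>j. (y b j - complex_of_real (b - a) * v a j) - (y a j - complex_of_real (a - a) * v a j))
      \<le> (M + B) * (b - a) * (b - a)"
  proof (rule sob_norm_increment_le[where x = "\<lambda>\<tau> j. y \<tau> j - complex_of_real (\<tau> - a) * v a j"
        and x' = "\<lambda>\<tau> j. v \<tau> j - v a j"])
    fix t j assume tj: "t \<in> {a..b}" "j \<in> modes K"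
    have "((\<lambda>\<tau>. complex_of_real (\<tau> - a) * v a j) has_vector_derivative complex_of_real 1 * v a j) (at t within {a..b})"
      by (intro has_vector_derivative_mult_left has_vector_derivative_of_real) (auto intro!: derivative_eq_intros)
    then show "((\<lambda>\<tau>. y \<tau> j - complex_of_real (\<tau> - a) * v a j) has_vector_derivative v t j - v a j) (at t within {a..b})"
      using has_vector_derivative_diff[OF y_derivative[OF tj(1) assms(2) tj(2)]] by simp
  next
    fix t assume t: "t \<in> {a..b}"
    have "sob_norm K (s - 1) (\<lambda>j. v t j - v a j) \<le> (M + B) * (t - a)"
      using t assms by (intro v_increment) auto
    also have "\<dots> \<le> (M + B) * (b - a)" using t const_nonneg by (intro mult_left_mono) auto
    finally show "sob_norm K (s - 1) (\<lambda>j. v t j - v a j) \<le> (M + B) * (b - a)" .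
  qed (use assms in auto)
  then show ?thesis by (simp add: power2_eq_square algebra_simps)
qed

definition interpolant :: "(real \<Rightarrow> cvec) \<Rightarrow> real \<Rightarrow> real \<Rightarrow> real \<Rightarrow> cvec" where
  "interpolant g t h \<tau> j = (1 - complex_of_real ((\<tau> - t) / h)) * g t j + complex_of_real ((\<tau> - t) / h) * g (t + h) j"

abbreviation D :: real where
  "D \<equiv> defect_const M B L Q"

lemma D_ge: "0 \<le> D" "2 * B \<le> D" "B + 2 * L * M \<le> D" "B + (2 * L * (M + B) + Q * M\<^sup>2) \<le> D"
  using const_nonneg by (auto simp: defect_const_def)

context
  fixes t h :: real
  assumes t: "t0 \<le> t" "t + h \<le> t0 + T" and h: "0 < h" "h \<le> 1"
begin

lemma step_range: "t \<in> {t0..t0 + T}" "t + h \<in> {t0..t0 + T}" "{t..t + h} \<subseteq> {t0..t0 + T}"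
  using t h by auto

lemma slope: "\<tau> \<in> {t..t + h} \<Longrightarrow> 0 \<le> (\<tau> - t) / h \<and> (\<tau> - t) / h \<le> 1"
  using h by auto

lemma F_interpolation_high:
  assumes "\<tau> \<in> {t..t + h}"
  shows "sob_norm K (s + 1) (interpolant F t h \<tau>) \<le> B"
  unfolding interpolant_def
  by (rule sob_norm_convex) (use slope[OF assms] F_bound step_range in auto)

lemma F_interpolation_mid:
  assumes "\<tau> \<in> {t..t + h}"
  shows "sob_norm K s (\<lambda>j. F \<tau> j - interpolant F t h \<tau> j) \<le> 2 * L * M * h"
proof -
  define \<eta> where "\<eta> = complex_of_real ((\<tau> - t) / h)"
  have "cmod \<eta> \<le> 1" using slope[OF assms] by (auto simp: \<eta>_def simp flip: of_real_diff of_real_divide)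
  have 1: "sob_norm K s (\<lambda>j. F \<tau> j - F t j) \<le> L * M * h"
  proof -
    have "sob_norm K s (\<lambda>j. F \<tau> j - F t j) \<le> L * M * (\<tau> - t)"
      using assms step_range by (intro F_increment) auto
    also have "\<dots> \<le> L * M * h" using assms const_nonneg by (intro mult_left_mono) auto
    finally show ?thesis .
  qed
  have "sob_norm K s (\<lambda>j. F (t + h) j - F t j) \<le> L * M * h"
    using F_increment[of t "t + h"] step_range h by simp
  then have 2: "cmod \<eta> * sob_norm K s (\<lambda>j. F (t + h) j - F t j) \<le> 1 * (L * M * h)"
    using \<open>cmod \<eta> \<le> 1\<close> by (intro mult_mono) auto
  have "(\<lambda>j. F \<tau> j - interpolant F t h \<tau> j) = (\<lambda>j. (F \<tau> j - F t j) - \<eta> * (F (t + h) j - F t j))"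
    unfolding interpolant_def \<eta>_def[symmetric] by (simp add: algebra_simps)
  then show ?thesis
    using 1 2 sob_norm_triangle_diff[of K s "\<lambda>j. F \<tau> j - F t j" "\<lambda>j. \<eta> * (F (t + h) j - F t j)"]
      sob_norm_scale[of K s \<eta> "\<lambda>j. F (t + h) j - F t j"] by simp
qed

lemma y_interpolation_low:
  assumes "\<tau> \<in> {t..t + h}"
  shows "sob_norm K (s - 1) (\<lambda>j. y \<tau> j - interpolant y t h \<tau> j) \<le> 2 * (M + B) * h\<^sup>2"
proof -
  define \<theta> where "\<theta> = (\<tau> - t) / h"
  have \<theta>: "0 \<le> \<theta>" "\<theta> \<le> 1" "\<theta> * h = \<tau> - t" using slope[OF assms] h by (auto simp: \<theta>_def)
  let ?d = "\<lambda>\<tau> j. y \<tau> j - y t j - complex_of_real (\<tau> - t) * v t j"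
  have D: "sob_norm K (s - 1) (?d \<tau>) \<le> (M + B) * h\<^sup>2" if "\<tau> \<in> {t..t + h}" for \<tau>
  proof -
    have "sob_norm K (s - 1) (?d \<tau>) \<le> (M + B) * (\<tau> - t)\<^sup>2"
      using that step_range by (intro y_taylor) auto
    also have "\<dots> \<le> (M + B) * h\<^sup>2"
      using that const_nonneg by (intro mult_left_mono power_mono) auto
    finally show ?thesis .
  qed
  have e: "complex_of_real (\<tau> - t) = complex_of_real \<theta> * complex_of_real h"
    using \<theta>(3) by (metis of_real_mult)
  have d: "(\<lambda>j. y \<tau> j - interpolant y t h \<tau> j) = (\<lambda>j. ?d \<tau> j - complex_of_real \<theta> * ?d (t + h) j)"
    unfolding interpolant_def \<theta>_def[symmetric] e by (simp add: algebra_simps)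
  have "sob_norm K (s - 1) (\<lambda>j. y \<tau> j - interpolant y t h \<tau> j)
      \<le> sob_norm K (s - 1) (?d \<tau>) + \<theta> * sob_norm K (s - 1) (?d (t + h))"
    unfolding d using sob_norm_triangle_diff[of K "s - 1" "?d \<tau>" "\<lambda>j. complex_of_real \<theta> * ?d (t + h) j"] \<theta>
      sob_norm_scale[of K "s - 1" "complex_of_real \<theta>" "?d (t + h)"] by simp
  also have "\<dots> \<le> (M + B) * h\<^sup>2 + 1 * ((M + B) * h\<^sup>2)"
    using assms h \<theta> by (intro add_mono mult_mono D) auto
  finally show ?thesis by (simp add: algebra_simps)
qed

text \<open>
  Second order in \<open>h\<close> without differentiating \<open>f(y(t))\<close> twice: \<open>y\<close> is close to its interpolant, and \<open>f\<close>
  almost commutes with interpolation.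
\<close>
lemma F_interpolation_low:
  assumes "\<tau> \<in> {t..t + h}"
  shows "sob_norm K (s - 1) (\<lambda>j. F \<tau> j - interpolant F t h \<tau> j) \<le> (2 * L * (M + B) + Q * M\<^sup>2) * h\<^sup>2"
proof -
  have yR: "sob_norm K (s + 1) (y r) \<le> R" if "r \<in> {t0..t0 + T}" for r
    using y_bound[OF that] M_le_R by simp
  have IR: "sob_norm K (s + 1) (interpolant y t h \<tau>) \<le> R"
    unfolding interpolant_def by (rule sob_norm_convex) (use slope[OF assms] yR step_range in auto)
  have "sob_norm K (s - 1) (\<lambda>j. F \<tau> j - nonlin K p (interpolant y t h \<tau>) j)
      \<le> L * sob_norm K (s - 1) (\<lambda>j. y \<tau> j - interpolant y t h \<tau> j)"
    by (intro f_lipschitz yR IR) (use assms step_range s in auto)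
  also have "\<dots> \<le> L * (2 * (M + B) * h\<^sup>2)"
    using const_nonneg assms by (intro mult_left_mono y_interpolation_low)
  finally have 1: "sob_norm K (s - 1) (\<lambda>j. F \<tau> j - nonlin K p (interpolant y t h \<tau>) j) \<le> 2 * L * (M + B) * h\<^sup>2"
    by (simp add: mult_ac)
  have "sob_norm K (s - 1) (\<lambda>j. nonlin K p (interpolant y t h \<tau>) j - interpolant F t h \<tau> j)
      \<le> Q * (sob_norm K s (\<lambda>j. y (t + h) j - y t j))\<^sup>2"
    unfolding interpolant_def by (rule f_interpolation) (use slope[OF assms] yR step_range in auto)
  also have "\<dots> \<le> Q * (M * h)\<^sup>2"
    using y_increment[of t "t + h"] h step_range const_nonneg by (intro mult_left_mono power_mono) auto
  finally have "sob_norm K (s - 1) (\<lambda>j. nonlin K p (interpolant y t h \<tau>) j - interpolant F t h \<tau> j) \<le> Q * M\<^sup>2 * h\<^sup>2"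
    by (simp add: power_mult_distrib)
  with 1 have "sob_norm K (s - 1) (\<lambda>j. (F \<tau> j - nonlin K p (interpolant y t h \<tau>) j)
      + (nonlin K p (interpolant y t h \<tau>) j - interpolant F t h \<tau> j)) \<le> 2 * L * (M + B) * h\<^sup>2 + Q * M\<^sup>2 * h\<^sup>2"
    using sob_norm_triangle[of K "s - 1" "\<lambda>j. F \<tau> j - nonlin K p (interpolant y t h \<tau>) j"
        "\<lambda>j. nonlin K p (interpolant y t h \<tau>) j - interpolant F t h \<tau> j"] by linarith
  then show ?thesis by (simp add: algebra_simps)
qed

text \<open>
  Here \<open>G\<close> is an antiderivative of a quadrature integrand \<open>g\<close>, so a defect is bounded by comparing the
  true integrand with \<open>g\<close>.
\<close>
lemma position_defect_le:
  assumes G: "\<And>\<tau> j. \<tau> \<in> {t..t + h} \<Longrightarrow> j \<in> modes K \<Longrightarrow>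
      ((\<lambda>\<tau>. G \<tau> j) has_vector_derivative g \<tau> j) (at \<tau> within {t..t + h})"
    and bd: "\<And>\<tau>. \<tau> \<in> {t..t + h} \<Longrightarrow>
      sob_norm K \<sigma> (\<lambda>j. complex_of_real (sinc_kernel (t + h - \<tau>) (freq j)) * F \<tau> j - g \<tau> j) \<le> X"
  shows "sob_norm K \<sigma> (\<lambda>j. y (t + h) j - fst (R_flow h (y t, v t)) j - (G (t + h) j - G t j)) \<le> X * h"
proof -
  let ?W = "\<lambda>\<tau> j. complex_of_real (cos ((t + h - \<tau>) * freq j)) * y \<tau> j + complex_of_real (sinc_kernel (t + h - \<tau>) (freq j)) * v \<tau> j - G \<tau> j"
  have "sob_norm K \<sigma> (\<lambda>j. ?W (t + h) j - ?W t j) \<le> X * (t + h - t)"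
  proof (rule sob_norm_increment_le)
    fix \<tau> j assume \<tau>j: "\<tau> \<in> {t..t + h}" "j \<in> modes K"
    show "((\<lambda>\<tau>. ?W \<tau> j) has_vector_derivative (\<lambda>\<tau> j. complex_of_real (sinc_kernel (t + h - \<tau>) (freq j)) * F \<tau> j - g \<tau> j) \<tau> j)
        (at \<tau> within {t..t + h})"
      by (intro has_vector_derivative_diff G \<tau>j back_propagation_derivative(1) y_derivative v_derivative step_range)
  qed (use h bd in auto)
  moreover have "(\<lambda>j. ?W (t + h) j - ?W t j)
      = (\<lambda>j. y (t + h) j - fst (R_flow h (y t, v t)) j - (G (t + h) j - G t j))"
    by (intro ext) (simp add: R_flow_def sinc_kernel_def)
  ultimately show ?thesis by (simp only: add_diff_cancel_left')
qed

lemma velocity_defect_le: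
  assumes G: "\<And>\<tau> j. \<tau> \<in> {t..t + h} \<Longrightarrow> j \<in> modes K \<Longrightarrow>
      ((\<lambda>\<tau>. G \<tau> j) has_vector_derivative g \<tau> j) (at \<tau> within {t..t + h})"
    and bd: "\<And>\<tau>. \<tau> \<in> {t..t + h} \<Longrightarrow>
      sob_norm K \<sigma> (\<lambda>j. complex_of_real (cos ((t + h - \<tau>) * freq j)) * F \<tau> j - g \<tau> j) \<le> X"
  shows "sob_norm K \<sigma> (\<lambda>j. v (t + h) j - snd (R_flow h (y t, v t)) j - (G (t + h) j - G t j)) \<le> X * h"
proof -
  let ?W = "\<lambda>\<tau> j. complex_of_real (- freq j * sin ((t + h - \<tau>) * freq j)) * y \<tau> j + complex_of_real (cos ((t + h - \<tau>) * freq j)) * v \<tau> j - G \<tau> j"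
  have "sob_norm K \<sigma> (\<lambda>j. ?W (t + h) j - ?W t j) \<le> X * (t + h - t)"
  proof (rule sob_norm_increment_le)
    fix \<tau> j assume \<tau>j: "\<tau> \<in> {t..t + h}" "j \<in> modes K"
    show "((\<lambda>\<tau>. ?W \<tau> j) has_vector_derivative (\<lambda>\<tau> j. complex_of_real (cos ((t + h - \<tau>) * freq j)) * F \<tau> j - g \<tau> j) \<tau> j)
        (at \<tau> within {t..t + h})"
      by (intro has_vector_derivative_diff G \<tau>j back_propagation_derivative(2) y_derivative v_derivative step_range)
  qed (use h bd in auto)
  moreover have "(\<lambda>j. ?W (t + h) j - ?W t j)
      = (\<lambda>j. v (t + h) j - snd (R_flow h (y t, v t)) j - (G (t + h) j - G t j))"
    by (intro ext) (simp add: R_flow_def)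
  ultimately show ?thesis by (simp only: add_diff_cancel_left')
qed

text \<open>
  What the free flow alone misses. It is one order more regular than the position defect below, which
  is needed when \<open>\<alpha> < 0\<close>: there the filtered quadrature term is estimated on its own.
\<close>
definition free_defect :: cvec where
  "free_defect j = y (t + h) j - fst (R_flow h (y t, v t)) j"

definition position_defect :: cvec where
  "position_defect j = free_defect j - complex_of_real (h\<^sup>2 / 2) * F t j"

definition velocity_defect :: cvec where
  "velocity_defect j = v (t + h) j - snd (R_flow h (y t, v t)) j - complex_of_real (h / 2) * (F t j + F (t + h) j)"

text \<open>
  The kernel is bounded by \<open>\<langle>j\<rangle> powr (-1)\<close>, which gains one order, and by \<open>h\<close>, which gains one power.
\<close>
lemma free_defect_high: "sob_norm K (s + 2) free_defect \<le> D * h"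
  and free_defect_mid: "sob_norm K (s + 1) free_defect \<le> D * h * h"
proof -
  have a: "sob_norm K (s + 2) (\<lambda>j. complex_of_real (sinc_kernel (t + h - \<tau>) (freq j)) * F \<tau> j - 0) \<le> D"
      (is ?a)
    and b: "sob_norm K (s + 1) (\<lambda>j. complex_of_real (sinc_kernel (t + h - \<tau>) (freq j)) * F \<tau> j - 0) \<le> D * h"
      (is ?b)
    if \<tau>: "\<tau> \<in> {t..t + h}" for \<tau>
  proof -
    have FB: "sob_norm K (s + 1) (F \<tau>) \<le> B" using \<tau> step_range by (intro F_bound) auto
    have "sob_norm K (s + 2) (\<lambda>j. complex_of_real (sinc_kernel (t + h - \<tau>) (freq j)) * F \<tau> j) \<le> 1 * sob_norm K (s + 2 + -1) (F \<tau>)"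
    proof (rule sob_norm_multiplier)
      fix j
      have "\<bar>sinc_kernel (t + h - \<tau>) (freq j)\<bar> \<le> 1 * jap j powr -1"
        using sinc_kernel_le_inverse[of "t + h - \<tau>" j] \<tau> h by simp
      then show "cmod (complex_of_real (sinc_kernel (t + h - \<tau>) (freq j)) * F \<tau> j) \<le> 1 * jap j powr -1 * cmod (F \<tau> j)"
        unfolding norm_mult norm_of_real by (intro mult_right_mono) auto
    qed simp
    then show ?a using FB D_ge const_nonneg by (simp add: add.commute)
    have "sob_norm K (s + 1) (\<lambda>j. complex_of_real (sinc_kernel (t + h - \<tau>) (freq j)) * F \<tau> j) \<le> h * sob_norm K (s + 1 + 0) (F \<tau>)"
    proof (rule sob_norm_multiplier)
      fix j
      have "\<bar>sinc_kernel (t + h - \<tau>) (freq j)\<bar> \<le> h"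
        using sinc_kernel_le[of "t + h - \<tau>" "freq j"] \<tau> by simp
      then show "cmod (complex_of_real (sinc_kernel (t + h - \<tau>) (freq j)) * F \<tau> j) \<le> h * jap j powr 0 * cmod (F \<tau> j)"
        by (auto simp: norm_mult intro!: mult_right_mono)
    qed (use h in auto)
    also have "\<dots> \<le> h * D" using FB D_ge const_nonneg h by (intro mult_left_mono) auto
    finally show ?b by (simp add: mult.commute)
  qed
  show "sob_norm K (s + 2) free_defect \<le> D * h"
    using position_defect_le[where G = "\<lambda>_ _. 0" and g = "\<lambda>_ _. 0", OF _ a] by (simp add: free_defect_def[abs_def])
  show "sob_norm K (s + 1) free_defect \<le> D * h * h"
    using position_defect_le[where G = "\<lambda>_ _. 0" and g = "\<lambda>_ _. 0", OF _ b] by (simp add: free_defect_def[abs_def])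
qed

text \<open>
  The kernel \<open>r\<close> of the quadrature replaces \<open>sin (r w) / w\<close>, with an error \<open>r\<^sup>2 \<langle>j\<rangle>\<close>, and the forcing is frozen
  at the beginning of the step.
\<close>
lemma position_defect_mid: "sob_norm K (s + 1) position_defect \<le> D * h\<^sup>2"
  and position_defect_low: "sob_norm K s position_defect \<le> D * h\<^sup>2 * h"
proof -
  let ?G = "\<lambda>\<tau> j. complex_of_real (- ((t + h - \<tau>)\<^sup>2 / 2)) * F t j"
  let ?g = "\<lambda>\<tau> j. complex_of_real (t + h - \<tau>) * F t j"
  have G: "((\<lambda>\<tau>. ?G \<tau> j) has_vector_derivative ?g \<tau> j) (at \<tau> within {t..t + h})" for \<tau> j
    by (intro has_vector_derivative_mult_left has_vector_derivative_of_real)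
       (auto intro!: derivative_eq_intros simp: field_simps)
  have a: "sob_norm K (s + 1) (\<lambda>j. complex_of_real (sinc_kernel (t + h - \<tau>) (freq j)) * F \<tau> j - ?g \<tau> j) \<le> D * h"
      (is ?a)
    and b: "sob_norm K s (\<lambda>j. complex_of_real (sinc_kernel (t + h - \<tau>) (freq j)) * F \<tau> j - ?g \<tau> j) \<le> D * h\<^sup>2"
      (is ?b)
    if \<tau>: "\<tau> \<in> {t..t + h}" for \<tau>
  proof -
    let ?r = "t + h - \<tau>"
    have r: "0 \<le> ?r" "?r \<le> h" using \<tau> by auto
    have FB: "sob_norm K (s + 1) (F \<tau>) \<le> B" using \<tau> step_range by (intro F_bound) auto
    have "sob_norm K (s + 1) (\<lambda>j. complex_of_real (sinc_kernel ?r (freq j)) * F \<tau> j) \<le> h * sob_norm K (s + 1 + 0) (F \<tau>)"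
    proof (rule sob_norm_multiplier)
      fix j
      have "\<bar>sinc_kernel ?r (freq j)\<bar> \<le> h" using sinc_kernel_le[of ?r "freq j"] r by simp
      then show "cmod (complex_of_real (sinc_kernel ?r (freq j)) * F \<tau> j) \<le> h * jap j powr 0 * cmod (F \<tau> j)"
        by (auto simp: norm_mult intro!: mult_right_mono)
    qed (use h in auto)
    also have "\<dots> \<le> h * B" using FB h by (intro mult_left_mono) auto
    finally have 1: "sob_norm K (s + 1) (\<lambda>j. complex_of_real (sinc_kernel ?r (freq j)) * F \<tau> j) \<le> h * B" .
    have 2: "sob_norm K (s + 1) (?g \<tau>) \<le> h * B"
      using r F_bound[OF step_range(1)] h unfolding sob_norm_scale norm_of_real by (intro mult_mono) auto
    have "2 * B * h \<le> D * h" using D_ge h by (intro mult_right_mono) auto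
    then show ?a
      using 1 2 sob_norm_triangle_diff[of K "s + 1" "\<lambda>j. complex_of_real (sinc_kernel ?r (freq j)) * F \<tau> j" "?g \<tau>"]
      by (simp add: mult_ac)
    have "sob_norm K s (\<lambda>j. complex_of_real (sinc_kernel ?r (freq j) - ?r) * F \<tau> j) \<le> h\<^sup>2 * sob_norm K (s + 1) (F \<tau>)"
    proof (rule sob_norm_multiplier)
      fix j
      have "\<bar>sinc_kernel ?r (freq j) - ?r\<bar> \<le> ?r\<^sup>2 * jap j powr 1" by (rule sinc_kernel_minus_le[OF r(1)])
      also have "\<dots> \<le> h\<^sup>2 * jap j powr 1" using r by (intro mult_right_mono power_mono) auto
      finally show "cmod (complex_of_real (sinc_kernel ?r (freq j) - ?r) * F \<tau> j) \<le> h\<^sup>2 * jap j powr 1 * cmod (F \<tau> j)"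
        unfolding norm_mult norm_of_real by (intro mult_right_mono) auto
    qed simp
    also have "\<dots> \<le> h\<^sup>2 * B" using FB by (intro mult_left_mono) auto
    finally have 3: "sob_norm K s (\<lambda>j. complex_of_real (sinc_kernel ?r (freq j) - ?r) * F \<tau> j) \<le> h\<^sup>2 * B" .
    have "sob_norm K s (\<lambda>j. complex_of_real ?r * (F \<tau> j - F t j)) \<le> h * (L * M * h)"
      unfolding sob_norm_scale
    proof (intro mult_mono)
      have "sob_norm K s (\<lambda>j. F \<tau> j - F t j) \<le> L * M * (\<tau> - t)"
        using \<tau> step_range by (intro F_increment) auto
      also have "\<dots> \<le> L * M * h" using \<tau> const_nonneg by (intro mult_left_mono) auto
      finally show "sob_norm K s (\<lambda>j. F \<tau> j - F t j) \<le> L * M * h" .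
    qed (use r h in \<open>auto simp del: of_real_add of_real_diff\<close>)
    moreover have "h\<^sup>2 * B + h * (L * M * h) \<le> D * h\<^sup>2"
    proof -
      have "(B + L * M) * h\<^sup>2 \<le> D * h\<^sup>2"
        using D_ge(3) mult_nonneg_nonneg[OF const_nonneg(3,1)] by (intro mult_right_mono) auto
      then show ?thesis by (simp add: algebra_simps power2_eq_square)
    qed
    moreover have "(\<lambda>j. complex_of_real (sinc_kernel ?r (freq j)) * F \<tau> j - ?g \<tau> j)
      = (\<lambda>j. complex_of_real (sinc_kernel ?r (freq j) - ?r) * F \<tau> j + complex_of_real ?r * (F \<tau> j - F t j))"
      by (simp add: algebra_simps)
    ultimately show ?b
      using 3 sob_norm_triangle[of K s "\<lambda>j. complex_of_real (sinc_kernel ?r (freq j) - ?r) * F \<tau> j" "\<lambda>j. complex_of_real ?r * (F \<tau> j - F t j)"]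
      by simp
  qed
  have e: "position_defect = (\<lambda>j. y (t + h) j - fst (R_flow h (y t, v t)) j - (?G (t + h) j - ?G t j))"
    by (simp add: position_defect_def[abs_def] free_defect_def)
  show "sob_norm K (s + 1) position_defect \<le> D * h\<^sup>2"
    unfolding e by (rule order_trans[OF position_defect_le[where G = ?G and g = ?g, OF G a]]) (auto simp: power2_eq_square)
  show "sob_norm K s position_defect \<le> D * h\<^sup>2 * h"
    unfolding e by (rule position_defect_le[where G = ?G and g = ?g, OF G b])
qed

text \<open>
  The trapezoidal sum is the integral of the linear interpolant of the forcing. So the defect splits
  into \<open>cos - 1\<close>, bounded by \<open>h\<^sup>k \<langle>j\<rangle>\<^sup>k\<close> for \<open>k \<le> 2\<close>, and the interpolation error of the forcing.
\<close>
lemma velocity_defect_high: "sob_norm K (s + 1) velocity_defect \<le> D * h"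
  and velocity_defect_mid: "sob_norm K s velocity_defect \<le> D * h * h"
  and velocity_defect_low: "sob_norm K (s - 1) velocity_defect \<le> D * h\<^sup>2 * h"
proof -
  let ?G = "\<lambda>\<tau> j. complex_of_real ((\<tau> - t) - (\<tau> - t)\<^sup>2 / (2 * h)) * F t j + complex_of_real ((\<tau> - t)\<^sup>2 / (2 * h)) * F (t + h) j"
  let ?g = "interpolant F t h"
  have G: "((\<lambda>\<tau>. ?G \<tau> j) has_vector_derivative ?g \<tau> j) (at \<tau> within {t..t + h})" for \<tau> j
  proof -
    have "((\<lambda>\<tau>. ?G \<tau> j) has_vector_derivative
       complex_of_real (1 - (\<tau> - t) / h) * F t j + complex_of_real ((\<tau> - t) / h) * F (t + h) j) (at \<tau> within {t..t + h})"
      by (intro has_vector_derivative_add has_vector_derivative_mult_left has_vector_derivative_of_real)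
         (use h in \<open>auto intro!: derivative_eq_intros simp: field_simps\<close>)
    then show ?thesis by (simp add: interpolant_def)
  qed
  have a: "sob_norm K (s + 1) (\<lambda>j. complex_of_real (cos ((t + h - \<tau>) * freq j)) * F \<tau> j - ?g \<tau> j) \<le> D" (is ?a)
    and b: "sob_norm K s (\<lambda>j. complex_of_real (cos ((t + h - \<tau>) * freq j)) * F \<tau> j - ?g \<tau> j) \<le> D * h" (is ?b)
    and c: "sob_norm K (s - 1) (\<lambda>j. complex_of_real (cos ((t + h - \<tau>) * freq j)) * F \<tau> j - ?g \<tau> j) \<le> D * h\<^sup>2" (is ?c)
    if \<tau>: "\<tau> \<in> {t..t + h}" for \<tau>
  proof -
    let ?r = "t + h - \<tau>"
    let ?d = "\<lambda>j. complex_of_real (cos (?r * freq j) - 1) * F \<tau> j"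
    have r: "0 \<le> ?r" "?r \<le> h" using \<tau> by auto
    have FB: "sob_norm K (s + 1) (F \<tau>) \<le> B" using \<tau> step_range by (intro F_bound) auto
    have "sob_norm K (s + 1) (\<lambda>j. complex_of_real (cos (?r * freq j)) * F \<tau> j) \<le> sob_norm K (s + 1) (F \<tau>)"
      by (rule sob_norm_mono) (auto simp: norm_mult intro!: mult_left_le_one_le)
    then show ?a
      using FB F_interpolation_high[OF \<tau>] D_ge(2)
        sob_norm_triangle_diff[of K "s + 1" "\<lambda>j. complex_of_real (cos (?r * freq j)) * F \<tau> j" "?g \<tau>"] by linarith
    have rj: "0 \<le> ?r * freq j" "?r * freq j \<le> h * jap j" for j
      using r h freq_le_jap[of j] by (auto intro!: mult_mono)
    have "sob_norm K s ?d \<le> h * sob_norm K (s + 1) (F \<tau>)"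
    proof (rule sob_norm_multiplier)
      fix j
      have "\<bar>cos (?r * freq j) - 1\<bar> \<le> h * jap j powr 1"
        using one_minus_cos_bounds(1,2)[OF rj(1)[of j]] rj(2)[of j] by simp
      then show "cmod (?d j) \<le> h * jap j powr 1 * cmod (F \<tau> j)"
        unfolding norm_mult norm_of_real by (intro mult_right_mono) auto
    qed (use h in auto)
    then have d1: "sob_norm K s ?d \<le> B * h" using mult_left_mono[OF FB, of h] h unfolding mult.commute[of B] by linarith
    have "sob_norm K (s - 1) ?d \<le> h\<^sup>2 * sob_norm K (s - 1 + 2) (F \<tau>)"
    proof (rule sob_norm_multiplier)
      fix j
      have "(?r * freq j)\<^sup>2 \<le> (h * jap j)\<^sup>2" using rj by (intro power_mono) auto
      moreover have "1 - cos (?r * freq j) \<le> (?r * freq j)\<^sup>2"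
        using one_minus_cos_bounds(3)[OF rj(1)[of j]] zero_le_power2[of "?r * freq j"] by linarith
      ultimately have "\<bar>cos (?r * freq j) - 1\<bar> \<le> (h * jap j)\<^sup>2"
        using cos_le_one[of "?r * freq j"] by linarith
      then have "\<bar>cos (?r * freq j) - 1\<bar> \<le> h\<^sup>2 * jap j powr 2"
        by (simp add: power_mult_distrib powr_numeral)
      then show "cmod (?d j) \<le> h\<^sup>2 * jap j powr 2 * cmod (F \<tau> j)"
        unfolding norm_mult norm_of_real by (intro mult_right_mono) auto
    qed simp
    moreover have "s - 1 + 2 = s + 1" by simp
    ultimately have "sob_norm K (s - 1) ?d \<le> h\<^sup>2 * sob_norm K (s + 1) (F \<tau>)" by metis
    then have d2: "sob_norm K (s - 1) ?d \<le> B * h\<^sup>2" using mult_left_mono[OF FB, of "h\<^sup>2"] unfolding mult.commute[of B] by (meson order_trans zero_le_power2)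
    have e: "(\<lambda>j. complex_of_real (cos (?r * freq j)) * F \<tau> j - ?g \<tau> j) = (\<lambda>j. ?d j + (F \<tau> j - ?g \<tau> j))"
      by (simp add: algebra_simps)
    have "(B + 2 * L * M) * h \<le> D * h" using D_ge(3) h by (intro mult_right_mono) auto
    then show ?b
      unfolding e using d1 F_interpolation_mid[OF \<tau>] sob_norm_triangle[of K s ?d "\<lambda>j. F \<tau> j - ?g \<tau> j"]
      by (simp add: algebra_simps)
    have "(B + (2 * L * (M + B) + Q * M\<^sup>2)) * h\<^sup>2 \<le> D * h\<^sup>2" using D_ge(4) by (intro mult_right_mono) auto
    then show ?c
      unfolding e using d2 F_interpolation_low[OF \<tau>] sob_norm_triangle[of K "s - 1" ?d "\<lambda>j. F \<tau> j - ?g \<tau> j"]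
      by (simp add: algebra_simps)
  qed
  have G_diff: "?G (t + h) j - ?G t j = complex_of_real (h / 2) * (F t j + F (t + h) j)" for j
  proof -
    have "h - h\<^sup>2 / (2 * h) = h / 2" "h\<^sup>2 / (2 * h) = h / 2" using h by (simp_all add: power2_eq_square)
    then have "?G (t + h) j = complex_of_real (h / 2) * F t j + complex_of_real (h / 2) * F (t + h) j"
      by (simp only: add_diff_cancel_left')
    then show ?thesis by (simp add: distrib_left)
  qed
  have e: "velocity_defect = (\<lambda>j. v (t + h) j - snd (R_flow h (y t, v t)) j - (?G (t + h) j - ?G t j))"
    by (intro ext) (simp only: velocity_defect_def G_diff)
  show "sob_norm K (s + 1) velocity_defect \<le> D * h"
    unfolding e by (rule velocity_defect_le[where G = ?G and g = ?g, OF G a])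
  show "sob_norm K s velocity_defect \<le> D * h * h"
    unfolding e by (rule velocity_defect_le[where G = ?G and g = ?g, OF G b])
  show "sob_norm K (s - 1) velocity_defect \<le> D * h\<^sup>2 * h"
    unfolding e by (rule velocity_defect_le[where G = ?G and g = ?g, OF G c])
qed

end

end

section \<open>Energy norm and discrete Gronwall lemma\<close>

definition energy_norm :: "nat \<Rightarrow> real \<Rightarrow> cvec \<Rightarrow> cvec \<Rightarrow> real" where
  "energy_norm K \<sigma> a b = sqrt ((sob_norm K (\<sigma> + 1) a)\<^sup>2 + (sob_norm K \<sigma> b)\<^sup>2)"

lemma energy_norm_nonneg [simp]: "0 \<le> energy_norm K \<sigma> a b"
  by (simp add: energy_norm_def)

lemma sob_norm_le_energy_norm:
  "sob_norm K (\<sigma> + 1) a \<le> energy_norm K \<sigma> a b" "sob_norm K \<sigma> b \<le> energy_norm K \<sigma> a b"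
  by (auto simp: energy_norm_def intro!: real_le_rsqrt)

lemma energy_norm_triangle:
  "energy_norm K \<sigma> (\<lambda>j. a j + x j) (\<lambda>j. b j + z j)
    \<le> energy_norm K \<sigma> a b + (sob_norm K (\<sigma> + 1) x + sob_norm K \<sigma> z)"
proof -
  have "energy_norm K \<sigma> (\<lambda>j. a j + x j) (\<lambda>j. b j + z j)
      \<le> sqrt ((sob_norm K (\<sigma> + 1) a + sob_norm K (\<sigma> + 1) x)\<^sup>2 + (sob_norm K \<sigma> b + sob_norm K \<sigma> z)\<^sup>2)"
    unfolding energy_norm_def
    by (intro real_sqrt_le_mono add_mono power_mono sob_norm_triangle) auto
  also have "\<dots> \<le> energy_norm K \<sigma> a b + energy_norm K \<sigma> x z"
    unfolding energy_norm_def by (rule real_sqrt_sum_squares_triangle_ineq)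
  also have "energy_norm K \<sigma> x z \<le> sob_norm K (\<sigma> + 1) x + sob_norm K \<sigma> z"
    unfolding energy_norm_def by (rule sqrt_sum_squares_le_sum) auto
  finally show ?thesis by simp
qed

lemma energy_norm_sum:
  "(energy_norm K \<sigma> a b)\<^sup>2
    = (\<Sum>j\<in>modes K. (jap j powr \<sigma>)\<^sup>2 * ((jap j * cmod (a j))\<^sup>2 + (cmod (b j))\<^sup>2))"
  by (simp add: energy_norm_def sob_norm_L2 L2_set_def sum_nonneg powr_add power_mult_distrib
      distrib_left mult_ac flip: sum.distrib)

lemma rotation_cmod:
  assumes "c\<^sup>2 + s\<^sup>2 = 1"
  shows "(cmod (complex_of_real c * a + complex_of_real s * b))\<^sup>2 + (cmod (- complex_of_real s * a + complex_of_real c * b))\<^sup>2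
      = (cmod a)\<^sup>2 + (cmod b)\<^sup>2"
proof -
  have "(cmod (complex_of_real c * a + complex_of_real s * b))\<^sup>2 + (cmod (- complex_of_real s * a + complex_of_real c * b))\<^sup>2
      = (c\<^sup>2 + s\<^sup>2) * ((cmod a)\<^sup>2 + (cmod b)\<^sup>2)"
    unfolding cmod_power2 by (simp add: power2_eq_square algebra_simps)
  then show ?thesis using assms by simp
qed

text \<open>
  On a mode of positive frequency the flow rotates \<open>(w y, v)\<close>. On the zero mode it is the shear
  \<open>(y, v) \<mapsto> (y + h v, v)\<close>, which is the only source of growth.
\<close>
lemma R_flow_mode_growth:
  assumes "0 \<le> h"
  shows "(jap j * cmod (fst (R_flow h (a, b)) j))\<^sup>2 + (cmod (snd (R_flow h (a, b)) j))\<^sup>2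
      \<le> (1 + h)\<^sup>2 * ((jap j * cmod (a j))\<^sup>2 + (cmod (b j))\<^sup>2)"
proof (cases "freq j = 0")
  case True
  define x where "x = cmod (a j)"
  define z where "z = cmod (b j)"
  have xz: "0 \<le> x" "0 \<le> z" by (auto simp: x_def z_def)
  have "cmod (a j + complex_of_real h * b j) \<le> x + h * z"
    using norm_triangle_ineq[of "a j" "complex_of_real h * b j"] assms by (simp add: norm_mult x_def z_def)
  then have "(cmod (a j + complex_of_real h * b j))\<^sup>2 \<le> (x + h * z)\<^sup>2" by (intro power_mono) auto
  also have "(x + h * z)\<^sup>2 + z\<^sup>2 \<le> (1 + h)\<^sup>2 * (x\<^sup>2 + z\<^sup>2)"
  proof -
    have "2 * (x * z) \<le> x\<^sup>2 + z\<^sup>2" using sum_squares_bound[of x z] by simp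
    then have "h * (2 * (x * z)) \<le> h * (x\<^sup>2 + z\<^sup>2)" using assms by (intro mult_left_mono)
    moreover have "0 \<le> h * (x\<^sup>2 + z\<^sup>2)" "0 \<le> h\<^sup>2 * x\<^sup>2" using assms by auto
    moreover have "(1 + h)\<^sup>2 * (x\<^sup>2 + z\<^sup>2) - ((x + h * z)\<^sup>2 + z\<^sup>2)
       = 2 * (h * (x\<^sup>2 + z\<^sup>2)) + h\<^sup>2 * x\<^sup>2 - h * (2 * (x * z))"
      by (simp add: power2_eq_square algebra_simps)
    ultimately show ?thesis by linarith
  qed
  finally show ?thesis
    using True by (simp add: R_flow_def jap_eq_1 x_def z_def)
next
  case False
  define w where "w = freq j"
  have w: "0 < w" using False freq_nonneg[of j] unfolding w_def by linarith
  have J: "jap j = w" using False by (simp add: w_def jap_eq_freq)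
  let ?a = "complex_of_real w * a j"
  have 1: "jap j * cmod (fst (R_flow h (a, b)) j)
      = cmod (complex_of_real (cos (h * w)) * ?a + complex_of_real (sin (h * w)) * b j)"
  proof -
    have "h * sinc (h * w) = sin (h * w) / w" using w by simp
    then have "complex_of_real w * fst (R_flow h (a, b)) j
       = complex_of_real w * (complex_of_real (cos (h * w)) * a j + complex_of_real (sin (h * w) / w) * b j)"
      by (simp only: R_flow_def w_def[symmetric] split fst_conv)
    also have "\<dots> = complex_of_real (cos (h * w)) * ?a + complex_of_real (sin (h * w)) * b j"
      using w by (simp add: algebra_simps)
    finally have "cmod (complex_of_real w * fst (R_flow h (a, b)) j)
      = cmod (complex_of_real (cos (h * w)) * ?a + complex_of_real (sin (h * w)) * b j)"
      by simp
    then show ?thesis using w by (simp add: J norm_mult)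
  qed
  have 2: "snd (R_flow h (a, b)) j = - complex_of_real (sin (h * w)) * ?a + complex_of_real (cos (h * w)) * b j"
    by (simp add: R_flow_def w_def)
  have "(jap j * cmod (fst (R_flow h (a, b)) j))\<^sup>2 + (cmod (snd (R_flow h (a, b)) j))\<^sup>2 = (cmod ?a)\<^sup>2 + (cmod (b j))\<^sup>2"
    unfolding 1 2 by (rule rotation_cmod) simp
  also have "\<dots> = 1 * ((jap j * cmod (a j))\<^sup>2 + (cmod (b j))\<^sup>2)"
    using w by (simp add: J norm_mult)
  also have "\<dots> \<le> (1 + h)\<^sup>2 * ((jap j * cmod (a j))\<^sup>2 + (cmod (b j))\<^sup>2)"
    using assms by (intro mult_right_mono) auto
  finally show ?thesis .
qed

lemma energy_norm_R_flow:
  assumes "0 \<le> h"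
  shows "energy_norm K \<sigma> (fst (R_flow h (a, b))) (snd (R_flow h (a, b))) \<le> (1 + h) * energy_norm K \<sigma> a b"
proof (rule power2_le_imp_le)
  have "(energy_norm K \<sigma> (fst (R_flow h (a, b))) (snd (R_flow h (a, b))))\<^sup>2
    \<le> (\<Sum>j\<in>modes K. (jap j powr \<sigma>)\<^sup>2 * ((1 + h)\<^sup>2 * ((jap j * cmod (a j))\<^sup>2 + (cmod (b j))\<^sup>2)))"
    unfolding energy_norm_sum by (intro sum_mono mult_left_mono R_flow_mode_growth assms) auto
  also have "\<dots> = ((1 + h) * energy_norm K \<sigma> a b)\<^sup>2"
    by (simp add: power_mult_distrib energy_norm_sum sum_distrib_left mult_ac)
  finally show "(energy_norm K \<sigma> (fst (R_flow h (a, b))) (snd (R_flow h (a, b))))\<^sup>2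
      \<le> ((1 + h) * energy_norm K \<sigma> a b)\<^sup>2" .
qed (use assms in simp)

lemma R_flow_diff:
  "fst (R_flow h (y, v)) j - fst (R_flow h (y', v')) j = fst (R_flow h (\<lambda>j. y j - y' j, \<lambda>j. v j - v' j)) j"
  "snd (R_flow h (y, v)) j - snd (R_flow h (y', v')) j = snd (R_flow h (\<lambda>j. y j - y' j, \<lambda>j. v j - v' j)) j"
  by (auto simp: R_flow_def algebra_simps)

text \<open>
  The recursion is required only while the asserted bound holds, as is needed when the step estimate
  presupposes that the numerical solution has not yet left a ball.
\<close>
lemma discrete_Gronwall:
  fixes e :: "nat \<Rightarrow> real"
  assumes "e 0 = 0" and "0 \<le> a" "0 \<le> b" "0 < h"
    and step: "\<And>n. real (Suc n) * h \<le> T \<Longrightarrow> e n \<le> b * T * exp (a * T) \<Longrightarrow> e (Suc n) \<le> (1 + a * h) * e n + b * h"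
    and "real n * h \<le> T"
  shows "e n \<le> b * T * exp (a * T)"
proof -
  have mono: "b * (real n * h) * exp (a * (real n * h)) \<le> b * T * exp (a * T)" if "real n * h \<le> T" for n
  proof -
    have "0 \<le> real n * h" using \<open>0 < h\<close> by simp
    then show ?thesis using that assms(2,3)
      by (intro mult_mono) (auto intro!: mult_left_mono simp del: mult_nonneg_nonneg intro: mult_nonneg_nonneg order_trans)
  qed
  have "e n \<le> b * (real n * h) * exp (a * (real n * h))"
    using \<open>real n * h \<le> T\<close>
  proof (induction n)
    case 0
    then show ?case using assms(1) by simp
  next
    case (Suc n)
    define r where "r = real n * h"
    have r: "0 \<le> r" using assms by (simp add: r_def)
    have n: "real n * h \<le> T" using Suc.prems assms(4) by (simp add: algebra_simps)
    have ih: "e n \<le> b * r * exp (a * r)" using Suc.IH[OF n] by (simp add: r_def)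
    have "e (Suc n) \<le> (1 + a * h) * e n + b * h"
      using Suc.prems order_trans[OF Suc.IH[OF n] mono[OF n]] by (rule step)
    also have "\<dots> \<le> exp (a * h) * (b * r * exp (a * r)) + b * h * exp (a * (r + h))"
    proof (intro add_mono)
      have "(1 + a * h) * e n \<le> (1 + a * h) * (b * r * exp (a * r))"
        using ih assms by (intro mult_left_mono) auto
      also have "\<dots> \<le> exp (a * h) * (b * r * exp (a * r))"
        using r assms by (intro mult_right_mono exp_ge_add_one_self) auto
      finally show "(1 + a * h) * e n \<le> exp (a * h) * (b * r * exp (a * r))" .
      show "b * h \<le> b * h * exp (a * (r + h))"
        using mult_left_mono[of 1 "exp (a * (r + h))" "b * h"] r assms by simp
    qed
    also have "\<dots> = b * (r + h) * exp (a * (r + h))"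
      by (simp add: algebra_simps exp_add)
    also have "r + h = real (Suc n) * h" by (simp add: r_def algebra_simps)
    finally show ?case .
  qed
  also have "\<dots> \<le> b * T * exp (a * T)" by (rule mono[OF assms(6)])
  finally show ?thesis .
qed

section \<open>Filters and local errors\<close>

definition local_error_const :: "real \<Rightarrow> real \<Rightarrow> real \<Rightarrow> real \<Rightarrow> real \<Rightarrow> real" where
  "local_error_const c M B L Q = 2 * defect_const M B L Q + c * B + L * (1 + c) * M"

text \<open>
  The method with one fixed \<open>\<alpha>\<close>. It will be used twice for the same filters, with \<open>\<alpha> = 0\<close> and with the
  given \<open>\<alpha>\<close>. The radius \<open>R\<close> is large enough that filtering by \<open>\<phi>\<close>, of norm at most \<open>c\<close>, maps the ball of
  radius \<open>M + 1\<close> into the domain of the Lipschitz estimate.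
\<close>
locale trigonometric_method = semidiscrete_wave +
  fixes c h \<alpha> :: real and \<phi> \<psi> \<psi>0 \<psi>1 :: "real \<Rightarrow> complex"
  assumes c: "1 \<le> c" and h: "0 < h" "h \<le> 1" and \<alpha>: "-1 \<le> \<alpha>" "\<alpha> \<le> 1"
    and filters_0: "\<phi> 0 = 1" "\<psi> 0 = 1" "\<psi>0 0 = 1" "\<psi>1 0 = 1"
    and filter_assm_0: "filter_assm K h \<phi> \<psi> \<psi>0 \<psi>1 0 c"
    and filter_assm_\<alpha>: "filter_assm K h \<phi> \<psi> \<psi>0 \<psi>1 \<alpha> c"
    and R_large: "c * (M + 1) \<le> R"
begin

lemma filter_unfold:
  assumes "filter_assm K h \<phi> \<psi> \<psi>0 \<psi>1 \<beta> c" "j \<in> modes K" "freq j \<noteq> 0"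
  shows "cmod (\<phi> (h * freq j)) \<le> c"
    "-1 \<le> \<beta> \<and> \<beta> \<le> 0 \<Longrightarrow> cmod (\<psi> (h * freq j)) \<le> c * (h powr \<beta> * jap j powr \<beta>)"
    "0 < \<beta> \<and> \<beta> \<le> 1 \<Longrightarrow> cmod (1 - \<psi> (h * freq j)) \<le> c * (h powr \<beta> * jap j powr \<beta>)"
    "g \<in> {\<phi>, \<psi>0, \<psi>1} \<Longrightarrow> cmod (1 - g (h * freq j)) \<le> c * (h powr (1 + \<beta>) * jap j powr (1 + \<beta>))"
proof -
  have "h * freq j \<in> {h * freq j | j. j \<in> modes K \<and> freq j \<noteq> 0}"
    using assms by blast
  note * = bspec[OF assms(1)[unfolded filter_assm_def] this]
  have e: "(h * freq j) powr b = h powr b * jap j powr b" for b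
    using h assms(3) by (simp add: powr_mult jap_eq_freq)
  show "cmod (\<phi> (h * freq j)) \<le> c"
    "-1 \<le> \<beta> \<and> \<beta> \<le> 0 \<Longrightarrow> cmod (\<psi> (h * freq j)) \<le> c * (h powr \<beta> * jap j powr \<beta>)"
    "0 < \<beta> \<and> \<beta> \<le> 1 \<Longrightarrow> cmod (1 - \<psi> (h * freq j)) \<le> c * (h powr \<beta> * jap j powr \<beta>)"
    "g \<in> {\<phi>, \<psi>0, \<psi>1} \<Longrightarrow> cmod (1 - g (h * freq j)) \<le> c * (h powr (1 + \<beta>) * jap j powr (1 + \<beta>))"
    using * unfolding e by blast+
qed

lemma \<phi>_le: "j \<in> modes K \<Longrightarrow> cmod (\<phi> (h * freq j)) \<le> c"
  using filter_unfold(1)[OF filter_assm_0] c by (cases "freq j = 0") (auto simp: filters_0)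

lemma \<psi>_le: "j \<in> modes K \<Longrightarrow> cmod (\<psi> (h * freq j)) \<le> c"
  using filter_unfold(2)[OF filter_assm_0] c h by (cases "freq j = 0") (auto simp: filters_0)

lemma \<psi>_le_powr:
  assumes "j \<in> modes K" "\<alpha> \<le> 0"
  shows "cmod (\<psi> (h * freq j)) \<le> c * h powr \<alpha> * jap j powr \<alpha>"
proof (cases "freq j = 0")
  case True
  have "1 \<le> h powr \<alpha>" using powr_mono'[of \<alpha> 0 h] h assms by simp
  then have "1 * 1 \<le> c * h powr \<alpha>" using c by (intro mult_mono) auto
  then show ?thesis using True by (simp add: filters_0 jap_eq_1)
next
  case False
  then show ?thesis using filter_unfold(2)[OF filter_assm_\<alpha> assms(1)] assms \<alpha> by (simp add: mult.assoc)
qed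

lemma one_minus_\<psi>_le:
  assumes "j \<in> modes K" "0 < \<alpha>"
  shows "cmod (1 - \<psi> (h * freq j)) \<le> c * h powr \<alpha> * jap j powr \<alpha>"
  using filter_unfold(3)[OF filter_assm_\<alpha> assms(1)] assms \<alpha> c
  by (cases "freq j = 0") (auto simp: filters_0 mult.assoc)

lemma one_minus_filter_le:
  assumes "j \<in> modes K" "g \<in> {\<phi>, \<psi>0, \<psi>1}"
  shows "cmod (1 - g (h * freq j)) \<le> c * h powr (1 + \<alpha>) * jap j powr (1 + \<alpha>)"
    and "cmod (1 - g (h * freq j)) \<le> c * h * jap j"
proof -
  have g0: "g 0 = 1" using assms(2) filters_0 by auto
  show "cmod (1 - g (h * freq j)) \<le> c * h powr (1 + \<alpha>) * jap j powr (1 + \<alpha>)"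
    using filter_unfold(4)[OF filter_assm_\<alpha> assms(1) _ assms(2)] c
    by (cases "freq j = 0") (auto simp: g0 mult.assoc)
  show "cmod (1 - g (h * freq j)) \<le> c * h * jap j"
    using filter_unfold(4)[OF filter_assm_0 assms(1) _ assms(2)] c h
    by (cases "freq j = 0") (auto simp: g0 mult.assoc)
qed

text \<open>
  Interpolates between \<open>1 + c\<close> and \<open>c h \<langle>j\<rangle>\<close>, both of which come from the assumption for \<open>\<beta> = 0\<close>.
\<close>
lemma one_minus_\<phi>_le:
  assumes "j \<in> modes K" "0 \<le> \<alpha>"
  shows "cmod (1 - \<phi> (h * freq j)) \<le> (1 + c) * h powr \<alpha> * jap j powr \<alpha>"
proof -
  define x where "x = h * jap j"
  have x: "0 < x" using h by (simp add: x_def)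
  have "cmod (1 - \<phi> (h * freq j)) \<le> (1 + c) * x powr \<alpha>"
  proof (cases "x \<le> 1")
    case True
    have "cmod (1 - \<phi> (h * freq j)) \<le> c * x"
      using one_minus_filter_le(2)[OF assms(1), of \<phi>] by (simp add: x_def mult.assoc)
    also have "\<dots> \<le> (1 + c) * x powr \<alpha>"
      using powr_mono'[of \<alpha> 1 x] True x \<alpha> c by (intro mult_mono) auto
    finally show ?thesis .
  next
    case False
    have "cmod (1 - \<phi> (h * freq j)) \<le> cmod 1 + cmod (\<phi> (h * freq j))" by (rule norm_triangle_ineq4)
    also have "\<dots> \<le> (1 + c) * 1" using \<phi>_le[OF assms(1)] by simp
    also have "\<dots> \<le> (1 + c) * x powr \<alpha>"
      using ge_one_powr_ge_zero[of x \<alpha>] False assms c by (intro mult_left_mono) auto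
    finally show ?thesis .
  qed
  then show ?thesis using h by (simp add: x_def powr_mult mult.assoc)
qed

abbreviation \<Phi> :: "cvec \<Rightarrow> cvec" where "\<Phi> \<equiv> diag_op \<phi> h"
abbreviation F\<Phi> :: "real \<Rightarrow> cvec" where "F\<Phi> t \<equiv> nonlin K p (\<Phi> (y t))"

abbreviation E :: real where "E \<equiv> local_error_const c M B L Q"

lemma E_nonneg: "0 \<le> E"
  using const_nonneg c D_ge(1) by (simp add: local_error_const_def)

lemma sob_norm_\<Phi>: "sob_norm K \<sigma> (\<Phi> u) \<le> c * sob_norm K \<sigma> u"
  using sob_norm_multiplier[of K "\<Phi> u" c 0 u \<sigma>] c
  by (simp add: diag_op_def norm_mult mult_right_mono \<phi>_le)

lemma \<Phi>_in_ball: "sob_norm K (s + 1) u \<le> M + 1 \<Longrightarrow> sob_norm K (s + 1) (\<Phi> u) \<le> R"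
  using sob_norm_\<Phi>[of "s + 1" u] R_large c mult_left_mono[of "sob_norm K (s + 1) u" "M + 1" c]
  by linarith

lemma y_in_ball: "t \<in> {t0..t0 + T} \<Longrightarrow> sob_norm K (s + 1) (y t) \<le> M + 1"
  using y_bound by force

lemma F\<Phi>_bound: "t \<in> {t0..t0 + T} \<Longrightarrow> sob_norm K (s + 1) (F\<Phi> t) \<le> B"
  by (intro f_bound \<Phi>_in_ball y_in_ball)

text \<open>
  A filter \<open>g\<close> outside and the filter \<open>\<phi>\<close> inside the nonlinearity. The outer one acts on a vector of order
  \<open>s + 1\<close>, and the inner one is moved out by the Lipschitz estimate in the weak order \<open>\<sigma>\<close>.
\<close>
lemma filter_error:
  assumes t: "t \<in> {t0..t0 + T}" and "\<bar>\<sigma>\<bar> \<le> s + 1" "\<sigma> + \<beta> = s + 1" and q: "0 \<le> q" "0 \<le> q'"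
    and g: "\<And>j. j \<in> modes K \<Longrightarrow> cmod (1 - g (h * freq j)) \<le> q * jap j powr \<beta>"
    and "\<And>j. j \<in> modes K \<Longrightarrow> cmod (1 - \<phi> (h * freq j)) \<le> q' * jap j powr \<beta>"
  shows "sob_norm K \<sigma> (\<lambda>j. F t j - diag_op g h (F\<Phi> t) j) \<le> q * B + L * q' * M"
proof -
  have "sob_norm K \<sigma> (\<lambda>j. (1 - g (h * freq j)) * F\<Phi> t j) \<le> q * sob_norm K (\<sigma> + \<beta>) (F\<Phi> t)"
    by (rule sob_norm_multiplier) (auto simp: norm_mult q intro!: mult_right_mono g)
  then have 1: "sob_norm K \<sigma> (\<lambda>j. (1 - g (h * freq j)) * F\<Phi> t j) \<le> q * B"
    unfolding assms(3) using mult_left_mono[OF F\<Phi>_bound[OF t] q(1)] by (rule order_trans)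
  have "sob_norm K \<sigma> (\<lambda>j. y t j - \<Phi> (y t) j) \<le> q' * sob_norm K (\<sigma> + \<beta>) (y t)"
  proof (rule sob_norm_multiplier)
    fix j assume j: "j \<in> modes K"
    have "y t j - \<Phi> (y t) j = (1 - \<phi> (h * freq j)) * y t j" by (simp add: diag_op_def algebra_simps)
    then show "cmod (y t j - \<Phi> (y t) j) \<le> q' * jap j powr \<beta> * cmod (y t j)"
      using assms(7)[OF j] by (simp add: norm_mult mult_right_mono)
  qed (rule q)
  then have "sob_norm K \<sigma> (\<lambda>j. y t j - \<Phi> (y t) j) \<le> q' * M"
    unfolding assms(3) using mult_left_mono[OF y_bound[OF t] q(2)] by (rule order_trans)
  then have "L * sob_norm K \<sigma> (\<lambda>j. y t j - \<Phi> (y t) j) \<le> L * (q' * M)"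
    using const_nonneg by (intro mult_left_mono)
  moreover have "sob_norm K \<sigma> (\<lambda>j. F t j - F\<Phi> t j) \<le> L * sob_norm K \<sigma> (\<lambda>j. y t j - \<Phi> (y t) j)"
    using y_bound[OF t] M_le_R by (intro f_lipschitz \<Phi>_in_ball y_in_ball t assms(2)) auto
  ultimately have 2: "sob_norm K \<sigma> (\<lambda>j. F t j - F\<Phi> t j) \<le> L * q' * M" by simp
  have e: "(\<lambda>j. F t j - diag_op g h (F\<Phi> t) j) = (\<lambda>j. (1 - g (h * freq j)) * F\<Phi> t j + (F t j - F\<Phi> t j))"
    by (simp add: diag_op_def algebra_simps)
  show ?thesis
    unfolding e using 1 2 sob_norm_triangle[of K \<sigma> "\<lambda>j. (1 - g (h * freq j)) * F\<Phi> t j" "\<lambda>j. F t j - F\<Phi> t j"]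
    by linarith
qed

lemma powr_h: "h powr (2 + \<alpha>) = h\<^sup>2 * h powr \<alpha>" "h powr (2 + \<alpha>) = h * h powr (1 + \<alpha>)"
  using h by (simp_all add: powr_add power2_eq_square)

lemma cmod_half_square: "cmod (complex_of_real (h\<^sup>2 / 2)) \<le> h\<^sup>2"
  unfolding norm_of_real by simp

definition position_local_error :: "real \<Rightarrow> cvec" where
  "position_local_error t j = free_defect t h j - complex_of_real (h\<^sup>2 / 2) * diag_op \<psi> h (F\<Phi> t) j"

definition velocity_local_error :: "real \<Rightarrow> cvec" where
  "velocity_local_error t j = v (t + h) j - snd (R_flow h (y t, v t)) j - complex_of_real (h / 2) * diag_op \<psi>0 h (F\<Phi> t) j
     - complex_of_real (h / 2) * diag_op \<psi>1 h (F\<Phi> (t + h)) j"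

text \<open>
  For \<open>\<alpha> \<le> 0\<close> the assumption bounds \<open>\<psi>\<close> itself, so the quadrature term is small on its own in the
  stronger norm. For \<open>\<alpha> > 0\<close> it bounds \<open>1 - \<psi>\<close>, so the term has to be compared with the unfiltered one.
\<close>
lemma position_local_error_le:
  assumes t: "t0 \<le> t" "t + h \<le> t0 + T"
  shows "sob_norm K (s + 1 - \<alpha>) (position_local_error t) \<le> E * h powr (2 + \<alpha>)"
proof (cases "\<alpha> \<le> 0")
  case True
  have "sob_norm K (s + 2 - (1 + \<alpha>)) (free_defect t h) \<le> 2 * (D * h) * h powr (1 + \<alpha>)"
    using free_defect_high[OF t h] free_defect_mid[OF t h] True \<alpha> h
    by (intro sob_norm_interpolation) (auto simp: add.commute)
  moreover have "s + 2 - (1 + \<alpha>) = s + 1 - \<alpha>" by simp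
  ultimately have 1: "sob_norm K (s + 1 - \<alpha>) (free_defect t h) \<le> 2 * D * h powr (2 + \<alpha>)"
    by (simp add: powr_h(2) mult_ac)
  have "sob_norm K (s + 1 - \<alpha>) (diag_op \<psi> h (F\<Phi> t)) \<le> c * h powr \<alpha> * sob_norm K (s + 1 - \<alpha> + \<alpha>) (F\<Phi> t)"
    by (rule sob_norm_multiplier)
       (use c in \<open>auto simp: diag_op_def norm_mult intro!: mult_right_mono \<psi>_le_powr True\<close>)
  also have "\<dots> \<le> c * h powr \<alpha> * B"
    using F\<Phi>_bound[of t] t h c by (intro mult_left_mono) auto
  finally have "cmod (complex_of_real (h\<^sup>2 / 2)) * sob_norm K (s + 1 - \<alpha>) (diag_op \<psi> h (F\<Phi> t)) \<le> h\<^sup>2 * (c * h powr \<alpha> * B)"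
    by (intro mult_mono cmod_half_square) auto
  then have 2: "sob_norm K (s + 1 - \<alpha>) (\<lambda>j. complex_of_real (h\<^sup>2 / 2) * diag_op \<psi> h (F\<Phi> t) j) \<le> c * B * h powr (2 + \<alpha>)"
    unfolding sob_norm_scale powr_h(1) by (simp add: mult_ac)
  have "0 \<le> L * (1 + c) * M * h powr (2 + \<alpha>)" using const_nonneg c by simp
  then show ?thesis
    using 1 2 sob_norm_triangle_diff[of K "s + 1 - \<alpha>" "free_defect t h" "\<lambda>j. complex_of_real (h\<^sup>2 / 2) * diag_op \<psi> h (F\<Phi> t) j"]
    unfolding position_local_error_def[abs_def] local_error_const_def by (simp add: algebra_simps)
next
  case False
  have "sob_norm K (s + 1 - \<alpha>) (position_defect t h) \<le> 2 * (D * h\<^sup>2) * h powr \<alpha>"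
    using position_defect_mid[OF t h] position_defect_low[OF t h] False \<alpha> h
    by (intro sob_norm_interpolation) auto
  then have 1: "sob_norm K (s + 1 - \<alpha>) (position_defect t h) \<le> 2 * D * h powr (2 + \<alpha>)"
    by (simp add: powr_h(1) mult_ac)
  have "sob_norm K (s + 1 - \<alpha>) (\<lambda>j. F t j - diag_op \<psi> h (F\<Phi> t) j) \<le> (c * h powr \<alpha>) * B + L * ((1 + c) * h powr \<alpha>) * M"
    using False \<alpha> s t h c
    by (intro filter_error[where \<beta> = \<alpha>] one_minus_\<psi>_le one_minus_\<phi>_le) auto
  then have "cmod (complex_of_real (h\<^sup>2 / 2)) * sob_norm K (s + 1 - \<alpha>) (\<lambda>j. F t j - diag_op \<psi> h (F\<Phi> t) j)
      \<le> h\<^sup>2 * ((c * h powr \<alpha>) * B + L * ((1 + c) * h powr \<alpha>) * M)"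
    by (intro mult_mono cmod_half_square) auto
  then have 2: "sob_norm K (s + 1 - \<alpha>) (\<lambda>j. complex_of_real (h\<^sup>2 / 2) * (F t j - diag_op \<psi> h (F\<Phi> t) j))
      \<le> (c * B + L * (1 + c) * M) * h powr (2 + \<alpha>)"
    unfolding sob_norm_scale powr_h(1) by (simp add: algebra_simps)
  have e: "position_local_error t = (\<lambda>j. position_defect t h j + complex_of_real (h\<^sup>2 / 2) * (F t j - diag_op \<psi> h (F\<Phi> t) j))"
    unfolding position_local_error_def[abs_def] position_defect_def[OF t h] right_diff_distrib by simp
  show ?thesis
    using 1 2 sob_norm_triangle[of K "s + 1 - \<alpha>" "position_defect t h" "\<lambda>j. complex_of_real (h\<^sup>2 / 2) * (F t j - diag_op \<psi> h (F\<Phi> t) j)"]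
    unfolding e local_error_const_def by (simp add: algebra_simps)
qed

lemma velocity_local_error_le:
  assumes t: "t0 \<le> t" "t + h \<le> t0 + T"
  shows "sob_norm K (s - \<alpha>) (velocity_local_error t) \<le> E * h powr (2 + \<alpha>)"
proof -
  have 1: "sob_norm K (s - \<alpha>) (velocity_defect t h) \<le> 2 * D * h powr (2 + \<alpha>)"
  proof (cases "\<alpha> \<le> 0")
    case True
    have "sob_norm K (s + 1 - (1 + \<alpha>)) (velocity_defect t h) \<le> 2 * (D * h) * h powr (1 + \<alpha>)"
      using velocity_defect_high[OF t h] velocity_defect_mid[OF t h] True \<alpha> h
      by (intro sob_norm_interpolation) auto
    moreover have "s + 1 - (1 + \<alpha>) = s - \<alpha>" by simp
    ultimately show ?thesis by (simp add: powr_h(2) mult_ac)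
  next
    case False
    have "sob_norm K (s - \<alpha>) (velocity_defect t h) \<le> 2 * (D * h\<^sup>2) * h powr \<alpha>"
      using velocity_defect_mid[OF t h] velocity_defect_low[OF t h] False \<alpha> h
      by (intro sob_norm_interpolation) (auto simp: power2_eq_square mult.assoc)
    then show ?thesis by (simp add: powr_h(1) mult_ac)
  qed
  let ?q = "h powr (1 + \<alpha>)"
  let ?e = "\<lambda>g t j. complex_of_real (h / 2) * (F t j - diag_op g h (F\<Phi> t) j)"
  have 2: "sob_norm K (s - \<alpha>) (?e g r) \<le> (c * B + L * c * M) * h powr (2 + \<alpha>) / 2"
    if "g \<in> {\<phi>, \<psi>0, \<psi>1}" "r \<in> {t0..t0 + T}" for g r
  proof -
    have "sob_norm K (s - \<alpha>) (\<lambda>j. F r j - diag_op g h (F\<Phi> r) j) \<le> (c * ?q) * B + L * (c * ?q) * M"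
      using \<alpha> s c that by (intro filter_error[where \<beta> = "1 + \<alpha>"] one_minus_filter_le) auto
    then have "h / 2 * sob_norm K (s - \<alpha>) (\<lambda>j. F r j - diag_op g h (F\<Phi> r) j) \<le> h / 2 * ((c * ?q) * B + L * (c * ?q) * M)"
      using h by (intro mult_left_mono) auto
    moreover have "cmod (complex_of_real (h / 2)) = h / 2" using h by (metis abs_of_pos half_gt_zero norm_of_real)
    ultimately show ?thesis unfolding sob_norm_scale powr_h(2) by (simp add: algebra_simps)
  qed
  have regroup: "V - R - \<kappa> * z0 - \<kappa> * z1 = (V - R - \<kappa> * (f0 + f1)) + (\<kappa> * (f0 - z0) + \<kappa> * (f1 - z1))"
    for V R \<kappa> f0 f1 z0 z1 :: complex
    by (simp add: algebra_simps)
  have e: "velocity_local_error t = (\<lambda>j. velocity_defect t h j + (?e \<psi>0 t j + ?e \<psi>1 (t + h) j))"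
    unfolding velocity_local_error_def[abs_def] velocity_defect_def[OF t h] by (intro ext regroup)
  have "sob_norm K (s - \<alpha>) (velocity_local_error t) \<le> sob_norm K (s - \<alpha>) (velocity_defect t h)
      + (sob_norm K (s - \<alpha>) (?e \<psi>0 t) + sob_norm K (s - \<alpha>) (?e \<psi>1 (t + h)))"
    unfolding e by (intro order_trans[OF sob_norm_triangle] add_mono order_refl sob_norm_triangle)
  also have "\<dots> \<le> 2 * D * h powr (2 + \<alpha>) + ((c * B + L * c * M) * h powr (2 + \<alpha>) / 2 + (c * B + L * c * M) * h powr (2 + \<alpha>) / 2)"
    using t h by (intro add_mono 1 2) auto
  also have "\<dots> = (2 * D + c * B + L * c * M) * h powr (2 + \<alpha>)" by (simp add: algebra_simps)
  also have "\<dots> \<le> E * h powr (2 + \<alpha>)"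
  proof (intro mult_right_mono)
    have "L * c * M \<le> L * (1 + c) * M"
      using const_nonneg by (intro mult_right_mono mult_left_mono) auto
    then show "2 * D + c * B + L * c * M \<le> E"
      unfolding local_error_const_def by linarith
  qed simp
  finally show ?thesis .
qed

end

section \<open>Propagation of errors over one step\<close>

definition position_growth :: "real \<Rightarrow> real \<Rightarrow> real" where
  "position_growth c L = 1 + c\<^sup>2 * L"

definition step_growth :: "real \<Rightarrow> real \<Rightarrow> real" where
  "step_growth c L = 1 + c\<^sup>2 * L + (1 + c) * c * L * (2 + position_growth c L)"

definition step_error :: "real \<Rightarrow> real \<Rightarrow> real \<Rightarrow> real" where
  "step_error c L E = ((1 + c) * c * L + 2) * E"

context trigonometric_method
begin

abbreviation position_error :: "real \<Rightarrow> cvec \<times> cvec \<Rightarrow> cvec" where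
  "position_error t u \<equiv> (\<lambda>j. y t j - fst u j)"

abbreviation velocity_error :: "real \<Rightarrow> cvec \<times> cvec \<Rightarrow> cvec" where
  "velocity_error t u \<equiv> (\<lambda>j. v t j - snd u j)"

abbreviation error :: "real \<Rightarrow> cvec \<times> cvec \<Rightarrow> real" where
  "error t u \<equiv> energy_norm K (s - \<alpha>) (position_error t u) (velocity_error t u)"

abbreviation step :: "cvec \<times> cvec \<Rightarrow> cvec \<times> cvec" where
  "step \<equiv> trig_step K p \<phi> \<psi> \<psi>0 \<psi>1 h"

abbreviation f_error :: "real \<Rightarrow> cvec \<times> cvec \<Rightarrow> cvec" where
  "f_error t u \<equiv> (\<lambda>j. F\<Phi> t j - nonlin K p (\<Phi> (fst u)) j)"

lemma step_error_recursion:
  assumes t: "t0 \<le> t" "t + h \<le> t0 + T"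
  shows "position_error (t + h) (step u) = (\<lambda>j. fst (R_flow h (position_error t u, velocity_error t u)) j
     + (complex_of_real (h\<^sup>2 / 2) * diag_op \<psi> h (f_error t u) j + position_local_error t j))"
  "velocity_error (t + h) (step u) = (\<lambda>j. snd (R_flow h (position_error t u, velocity_error t u)) j
     + (complex_of_real (h / 2) * diag_op \<psi>0 h (f_error t u) j
       + complex_of_real (h / 2) * diag_op \<psi>1 h (f_error (t + h) (step u)) j + velocity_local_error t j))"
proof -
  let ?f = "nonlin K p (\<Phi> (fst u))"
  have fst_step: "fst (step u) j = fst (R_flow h u) j + complex_of_real (h\<^sup>2 / 2) * diag_op \<psi> h ?f j" for j
    by (simp add: trig_step_def Let_def)
  have snd_step: "snd (step u) j = snd (R_flow h u) j + complex_of_real (h / 2) * diag_op \<psi>0 h ?f j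
      + complex_of_real (h / 2) * diag_op \<psi>1 h (nonlin K p (\<Phi> (fst (step u)))) j" for j
    by (simp add: trig_step_def Let_def)
  have diag: "diag_op g h (\<lambda>j. a j - b j) j = diag_op g h a j - diag_op g h b j" for g a b j
    by (simp add: diag_op_def right_diff_distrib)
  have R1: "fst (R_flow h (position_error t u, velocity_error t u)) j
      = fst (R_flow h (y t, v t)) j - fst (R_flow h u) j" for j
    using R_flow_diff(1)[of h "y t" "v t" j "fst u" "snd u"] by simp
  have R2: "snd (R_flow h (position_error t u, velocity_error t u)) j
      = snd (R_flow h (y t, v t)) j - snd (R_flow h u) j" for j
    using R_flow_diff(2)[of h "y t" "v t" j "fst u" "snd u"] by simp
  have regroup: "V - (R' + \<kappa> * z) = (R - R') + (\<kappa> * (z' - z) + (V - R - \<kappa> * z'))" for V R R' \<kappa> z z' :: complex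
    by (simp add: algebra_simps)
  have regroup2: "V - (R' + \<kappa> * z + \<kappa> * x) = (R - R') + (\<kappa> * (z' - z) + \<kappa> * (x' - x) + (V - R - \<kappa> * z' - \<kappa> * x'))"
    for V R R' \<kappa> z z' x x' :: complex
    by (simp add: algebra_simps)
  show "position_error (t + h) (step u) = (\<lambda>j. fst (R_flow h (position_error t u, velocity_error t u)) j
     + (complex_of_real (h\<^sup>2 / 2) * diag_op \<psi> h (f_error t u) j + position_local_error t j))"
    unfolding fst_step R1 diag position_local_error_def free_defect_def[OF t h] by (intro ext regroup)
  show "velocity_error (t + h) (step u) = (\<lambda>j. snd (R_flow h (position_error t u, velocity_error t u)) j
     + (complex_of_real (h / 2) * diag_op \<psi>0 h (f_error t u) j
       + complex_of_real (h / 2) * diag_op \<psi>1 h (f_error (t + h) (step u)) j + velocity_local_error t j))"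
    unfolding snd_step R2 diag velocity_local_error_def by (intro ext regroup2)
qed

lemma f_error_le:
  assumes "t \<in> {t0..t0 + T}" "sob_norm K (s + 1) (fst u) \<le> M + 1" "\<bar>\<sigma>\<bar> \<le> s + 1"
  shows "sob_norm K \<sigma> (f_error t u) \<le> c * L * sob_norm K \<sigma> (position_error t u)"
proof -
  have "sob_norm K \<sigma> (f_error t u) \<le> L * sob_norm K \<sigma> (\<lambda>j. \<Phi> (y t) j - \<Phi> (fst u) j)"
    by (intro f_lipschitz \<Phi>_in_ball y_in_ball assms)
  also have "(\<lambda>j. \<Phi> (y t) j - \<Phi> (fst u) j) = \<Phi> (position_error t u)"
    by (simp add: diag_op_def right_diff_distrib)
  also have "L * sob_norm K \<sigma> (\<Phi> (position_error t u)) \<le> L * (c * sob_norm K \<sigma> (position_error t u))"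
    using const_nonneg by (intro mult_left_mono sob_norm_\<Phi>)
  finally show ?thesis by (simp add: mult_ac)
qed

text \<open>
  The assumption bounds \<open>1 - g\<close> only, so \<open>g\<close> may grow; the growth is at most \<open>\<langle>j\<rangle> powr (1 + min \<alpha> 0)\<close> since
  \<open>h \<le> 1\<close>, and the velocity norm is weak enough to absorb it.
\<close>
lemma velocity_filter_le:
  assumes "g \<in> {\<psi>0, \<psi>1}"
  shows "sob_norm K (s - \<alpha>) (\<lambda>j. complex_of_real (h / 2) * diag_op g h z j)
      \<le> h / 2 * ((1 + c) * sob_norm K (s + 1 - max \<alpha> 0) z)"
proof -
  have "sob_norm K (s - \<alpha>) (diag_op g h z) \<le> (1 + c) * sob_norm K (s - \<alpha> + (1 + min \<alpha> 0)) z"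
  proof (rule sob_norm_multiplier)
    fix j assume j: "j \<in> modes K"
    define b where "b = 1 + min \<alpha> 0"
    have b: "0 \<le> b" using \<alpha> by (simp add: b_def)
    have "cmod (1 - g (h * freq j)) \<le> c * jap j powr b"
    proof (cases "\<alpha> \<le> 0")
      case True
      have "cmod (1 - g (h * freq j)) \<le> c * h powr (1 + \<alpha>) * jap j powr (1 + \<alpha>)"
        using assms by (intro one_minus_filter_le j) auto
      also have "\<dots> \<le> c * 1 * jap j powr (1 + \<alpha>)"
        using h c \<alpha> by (intro mult_mono powr_le1) auto
      finally show ?thesis using True by (simp add: b_def min_def)
    next
      case False
      have "cmod (1 - g (h * freq j)) \<le> c * h * jap j"
        using assms by (intro one_minus_filter_le j) auto
      also have "\<dots> \<le> c * 1 * jap j" using h c by (intro mult_mono) auto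
      finally show ?thesis using False by (simp add: b_def min_def)
    qed
    moreover have "cmod (g (h * freq j)) \<le> 1 + cmod (1 - g (h * freq j))"
      using norm_triangle_ineq4[of 1 "1 - g (h * freq j)"] by simp
    moreover have "1 \<le> jap j powr b" using b by (simp add: ge_one_powr_ge_zero)
    ultimately have "cmod (g (h * freq j)) \<le> (1 + c) * jap j powr b" by (simp add: distrib_right)
    then show "cmod (diag_op g h z j) \<le> (1 + c) * jap j powr (1 + min \<alpha> 0) * cmod (z j)"
      by (simp add: diag_op_def norm_mult b_def mult_right_mono)
  qed (use c in simp)
  moreover have "s - \<alpha> + (1 + min \<alpha> 0) = s + 1 - max \<alpha> 0" by (simp add: min_def max_def)
  moreover have "cmod (complex_of_real (h / 2)) = h / 2" using h by (metis abs_of_pos half_gt_zero norm_of_real)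
  ultimately show ?thesis unfolding sob_norm_scale using h by (simp add: mult_left_mono)
qed

text \<open>
  The new position depends on the old iterate only, so it can be estimated before the velocity, in
  which the nonlinearity is evaluated at the new position.
\<close>
lemma position_step_le:
  assumes t: "t0 \<le> t" "t + h \<le> t0 + T" and \<alpha>0: "0 \<le> \<alpha>" and u: "sob_norm K (s + 1) (fst u) \<le> M + 1"
  shows "sob_norm K (s + 1 - \<alpha>) (\<lambda>j. complex_of_real (h\<^sup>2 / 2) * diag_op \<psi> h (f_error t u) j)
        \<le> c\<^sup>2 * L * h * error t u"
    and "sob_norm K (s + 1 - \<alpha>) (position_error (t + h) (step u))
        \<le> (1 + position_growth c L * h) * error t u + E * h powr (2 + \<alpha>)"
proof -
  let ?e = "error t u"
  have "sob_norm K (s + 1 - \<alpha>) (diag_op \<psi> h (f_error t u)) \<le> c * sob_norm K (s + 1 - \<alpha> + 0) (f_error t u)"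
    by (rule sob_norm_multiplier) (use c in \<open>auto simp: diag_op_def norm_mult intro!: mult_right_mono \<psi>_le\<close>)
  also have "\<dots> \<le> c * (c * L * sob_norm K (s + 1 - \<alpha>) (position_error t u))"
    using c \<alpha> \<alpha>0 s t h u by (intro mult_left_mono) (auto intro!: f_error_le)
  also have "\<dots> \<le> c * (c * L * ?e)"
    using c const_nonneg sob_norm_le_energy_norm(1)[of K "s - \<alpha>"]
    by (intro mult_left_mono) (auto simp: algebra_simps)
  finally have "cmod (complex_of_real (h\<^sup>2 / 2)) * sob_norm K (s + 1 - \<alpha>) (diag_op \<psi> h (f_error t u)) \<le> h * (c * (c * L * ?e))"
  proof (intro mult_mono)
    have "h * h \<le> h * 1" using h by (intro mult_left_mono) auto
    then show "cmod (complex_of_real (h\<^sup>2 / 2)) \<le> h" unfolding norm_of_real power2_eq_square using h by simp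
  qed (use h in auto)
  then show 1: "sob_norm K (s + 1 - \<alpha>) (\<lambda>j. complex_of_real (h\<^sup>2 / 2) * diag_op \<psi> h (f_error t u) j)
        \<le> c\<^sup>2 * L * h * ?e"
    unfolding sob_norm_scale by (simp add: power2_eq_square mult_ac)
  have "sob_norm K (s + 1 - \<alpha>) (fst (R_flow h (position_error t u, velocity_error t u))) \<le> (1 + h) * ?e"
    using sob_norm_le_energy_norm(1)[of K "s - \<alpha>" "fst (R_flow h (position_error t u, velocity_error t u))"
       "snd (R_flow h (position_error t u, velocity_error t u))"]
      energy_norm_R_flow[of h K "s - \<alpha>" "position_error t u" "velocity_error t u"] h
    by (simp add: algebra_simps)
  moreover note position_local_error_le[OF t] 1
  moreover have "sob_norm K (s + 1 - \<alpha>) (position_error (t + h) (step u))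
     \<le> sob_norm K (s + 1 - \<alpha>) (fst (R_flow h (position_error t u, velocity_error t u)))
       + (sob_norm K (s + 1 - \<alpha>) (\<lambda>j. complex_of_real (h\<^sup>2 / 2) * diag_op \<psi> h (f_error t u) j)
       + sob_norm K (s + 1 - \<alpha>) (position_local_error t))"
    unfolding step_error_recursion[OF t]
    by (intro order_trans[OF sob_norm_triangle] add_mono order_refl sob_norm_triangle)
  ultimately show "sob_norm K (s + 1 - \<alpha>) (position_error (t + h) (step u))
        \<le> (1 + position_growth c L * h) * ?e + E * h powr (2 + \<alpha>)"
    by (simp add: position_growth_def algebra_simps)
qed

lemma error_step_le:
  assumes t: "t0 \<le> t" "t + h \<le> t0 + T"
  shows "error (t + h) (step u) \<le> (1 + h) * error t u
      + sob_norm K (s + 1 - \<alpha>) (\<lambda>j. complex_of_real (h\<^sup>2 / 2) * diag_op \<psi> h (f_error t u) j)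
      + h / 2 * ((1 + c) * sob_norm K (s + 1 - max \<alpha> 0) (f_error t u))
      + h / 2 * ((1 + c) * sob_norm K (s + 1 - max \<alpha> 0) (f_error (t + h) (step u)))
      + 2 * (E * h powr (2 + \<alpha>))"
proof -
  let ?P = "\<lambda>j. complex_of_real (h\<^sup>2 / 2) * diag_op \<psi> h (f_error t u) j"
  let ?V = "\<lambda>j. complex_of_real (h / 2) * diag_op \<psi>0 h (f_error t u) j"
  let ?V' = "\<lambda>j. complex_of_real (h / 2) * diag_op \<psi>1 h (f_error (t + h) (step u)) j"
  have eq: "s - \<alpha> + 1 = s + 1 - \<alpha>" by simp
  have "error (t + h) (step u)
     \<le> energy_norm K (s - \<alpha>) (fst (R_flow h (position_error t u, velocity_error t u)))
          (snd (R_flow h (position_error t u, velocity_error t u)))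
       + (sob_norm K (s + 1 - \<alpha>) (\<lambda>j. ?P j + position_local_error t j) + sob_norm K (s - \<alpha>) (\<lambda>j. ?V j + ?V' j + velocity_local_error t j))"
    unfolding step_error_recursion[OF t] by (rule energy_norm_triangle[of K "s - \<alpha>", unfolded eq])
  moreover have "energy_norm K (s - \<alpha>) (fst (R_flow h (position_error t u, velocity_error t u)))
          (snd (R_flow h (position_error t u, velocity_error t u))) \<le> (1 + h) * error t u"
    using h by (intro energy_norm_R_flow) simp
  moreover have "sob_norm K (s + 1 - \<alpha>) (\<lambda>j. ?P j + position_local_error t j) \<le> sob_norm K (s + 1 - \<alpha>) ?P + E * h powr (2 + \<alpha>)"
    using sob_norm_triangle[of K "s + 1 - \<alpha>" ?P "position_local_error t"] position_local_error_le[OF t] by linarith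
  moreover have "sob_norm K (s - \<alpha>) (\<lambda>j. ?V j + ?V' j + velocity_local_error t j)
      \<le> h / 2 * ((1 + c) * sob_norm K (s + 1 - max \<alpha> 0) (f_error t u))
      + h / 2 * ((1 + c) * sob_norm K (s + 1 - max \<alpha> 0) (f_error (t + h) (step u))) + E * h powr (2 + \<alpha>)"
    by (intro order_trans[OF sob_norm_triangle] add_mono velocity_local_error_le t velocity_filter_le) auto
  ultimately show ?thesis by linarith
qed

lemma error_step_nonneg:
  assumes t: "t0 \<le> t" "t + h \<le> t0 + T" and \<alpha>0: "0 \<le> \<alpha>"
    and u: "sob_norm K (s + 1) (fst u) \<le> M + 1" and u': "sob_norm K (s + 1) (fst (step u)) \<le> M + 1"
  shows "error (t + h) (step u) \<le> (1 + step_growth c L * h) * error t u + step_error c L E * h powr (2 + \<alpha>)"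
proof -
  let ?e = "error t u" and ?q = "h powr (2 + \<alpha>)"
  have ml: "max \<alpha> 0 = \<alpha>" using \<alpha>0 by simp
  have tr: "t \<in> {t0..t0 + T}" "t + h \<in> {t0..t0 + T}" using t h by auto
  have \<sigma>: "\<bar>s + 1 - \<alpha>\<bar> \<le> s + 1" using \<alpha> \<alpha>0 s by simp
  have cL: "0 \<le> c * L" "0 \<le> (1 + c) * (c * L)" using c const_nonneg by auto
  have pg: "0 \<le> position_growth c L" using const_nonneg by (simp add: position_growth_def)
  have e1: "sob_norm K (s + 1 - \<alpha>) (position_error t u) \<le> ?e"
    using sob_norm_le_energy_norm(1)[of K "s - \<alpha>"] by (simp add: algebra_simps)
  have z0: "sob_norm K (s + 1 - \<alpha>) (f_error t u) \<le> c * L * ?e"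
    using f_error_le[OF tr(1) u \<sigma>] mult_left_mono[OF e1 cL(1)] by linarith
  have "(1 + position_growth c L * h) * ?e \<le> (1 + position_growth c L * 1) * ?e"
    using h pg by (intro mult_right_mono add_left_mono mult_left_mono) auto
  then have "sob_norm K (s + 1 - \<alpha>) (position_error (t + h) (step u)) \<le> (1 + position_growth c L) * ?e + E * ?q"
    using position_step_le(2)[OF t \<alpha>0 u] by simp
  then have z1: "sob_norm K (s + 1 - \<alpha>) (f_error (t + h) (step u)) \<le> c * L * ((1 + position_growth c L) * ?e + E * ?q)"
    using f_error_le[OF tr(2) u' \<sigma>] mult_left_mono[OF _ cL(1)] order_trans by blast
  have A: "h / 2 * ((1 + c) * sob_norm K (s + 1 - \<alpha>) (f_error t u)) \<le> h * ((1 + c) * (c * L * ?e))"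
    using h c z0 by (intro mult_mono) auto
  have "h / 2 * ((1 + c) * sob_norm K (s + 1 - \<alpha>) (f_error (t + h) (step u)))
      \<le> h * ((1 + c) * (c * L * ((1 + position_growth c L) * ?e + E * ?q)))"
    using h c z1 by (intro mult_mono) auto
  also have "\<dots> \<le> h * ((1 + c) * (c * L * ((1 + position_growth c L) * ?e))) + 1 * ((1 + c) * (c * L) * (E * ?q))"
  proof -
    have "h * ((1 + c) * (c * L) * (E * ?q)) \<le> 1 * ((1 + c) * (c * L) * (E * ?q))"
      using h cL E_nonneg c const_nonneg by (intro mult_right_mono mult_nonneg_nonneg) auto
    then show ?thesis by (simp add: algebra_simps)
  qed
  finally have B: "h / 2 * ((1 + c) * sob_norm K (s + 1 - \<alpha>) (f_error (t + h) (step u)))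
      \<le> h * ((1 + c) * (c * L * ((1 + position_growth c L) * ?e))) + 1 * ((1 + c) * (c * L) * (E * ?q))" .
  have "error (t + h) (step u) \<le> (1 + h) * ?e + c\<^sup>2 * L * h * ?e + h * ((1 + c) * (c * L * ?e))
     + (h * ((1 + c) * (c * L * ((1 + position_growth c L) * ?e))) + 1 * ((1 + c) * (c * L) * (E * ?q))) + 2 * (E * ?q)"
    using error_step_le[OF t, of u, unfolded ml] position_step_le(1)[OF t \<alpha>0 u] A B by linarith
  also have "\<dots> = (1 + step_growth c L * h) * ?e + step_error c L E * ?q"
    by (simp add: step_growth_def step_error_def algebra_simps)
  finally show ?thesis .
qed

text \<open>
  For \<open>\<alpha> < 0\<close> the error norm is too strong for the Lipschitz estimate. But the filter \<open>\<psi>\<close> and the weaker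
  velocity norm both lower the required order to \<open>s + 1\<close>, in which the error is already known to be \<open>O(h)\<close>; the
  nonlinear terms then count as part of the local error.
\<close>
lemma error_step_nonpos:
  assumes t: "t0 \<le> t" "t + h \<le> t0 + T" and \<alpha>0: "\<alpha> \<le> 0" and X: "0 \<le> X"
    and u: "sob_norm K (s + 1) (fst u) \<le> M + 1" and u': "sob_norm K (s + 1) (fst (step u)) \<le> M + 1"
    and e: "sob_norm K (s + 1) (position_error t u) \<le> X * h"
    and e': "sob_norm K (s + 1) (position_error (t + h) (step u)) \<le> X * h"
  shows "error (t + h) (step u) \<le> (1 + h) * error t u + ((2 * c + 1) * c * L * X + 2 * E) * h powr (2 + \<alpha>)"
proof -
  let ?q = "h powr (2 + \<alpha>)"
  have ml: "s + 1 - max \<alpha> 0 = s + 1" using \<alpha>0 by simp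
  have tr: "t \<in> {t0..t0 + T}" "t + h \<in> {t0..t0 + T}" using t h by auto
  have cL: "0 \<le> c * L" using c const_nonneg by auto
  have h1: "1 \<le> h powr \<alpha>" using powr_mono'[of \<alpha> 0 h] h \<alpha>0 by simp
  have hh: "h * h \<le> ?q" using mult_left_mono[OF h1, of "h\<^sup>2"] by (simp add: powr_h(1) power2_eq_square)
  have z0: "sob_norm K (s + 1) (f_error t u) \<le> c * L * (X * h)"
    using f_error_le[OF tr(1) u, of "s + 1"] mult_left_mono[OF e cL] s by linarith
  have z1: "sob_norm K (s + 1) (f_error (t + h) (step u)) \<le> c * L * (X * h)"
    using f_error_le[OF tr(2) u', of "s + 1"] mult_left_mono[OF e' cL] s by linarith
  have half: "h / 2 * ((1 + c) * z) \<le> (1 + c) * c * L * X * ?q / 2" if "z \<le> c * L * (X * h)" for z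
  proof -
    have "h / 2 * ((1 + c) * z) \<le> h / 2 * ((1 + c) * (c * L * (X * h)))"
      using that h c by (intro mult_left_mono) auto
    also have "\<dots> = (1 + c) * (c * L) * X / 2 * (h * h)" by simp
    also have "\<dots> \<le> (1 + c) * (c * L) * X / 2 * ?q" using hh cL c X by (intro mult_left_mono) auto
    finally show ?thesis by (simp add: mult_ac)
  qed
  have "sob_norm K (s + 1 - \<alpha>) (diag_op \<psi> h (f_error t u)) \<le> c * h powr \<alpha> * sob_norm K (s + 1 - \<alpha> + \<alpha>) (f_error t u)"
    by (rule sob_norm_multiplier)
       (use c in \<open>auto simp: diag_op_def norm_mult intro!: mult_right_mono \<psi>_le_powr \<alpha>0\<close>)
  also have "\<dots> \<le> c * h powr \<alpha> * (c * L * (X * 1))"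
  proof (intro mult_left_mono)
    have "c * L * (X * h) \<le> c * L * (X * 1)" using cL X h by (intro mult_left_mono) auto
    then show "sob_norm K (s + 1 - \<alpha> + \<alpha>) (f_error t u) \<le> c * L * (X * 1)" using z0 by simp
  qed (use c in auto)
  finally have "cmod (complex_of_real (h\<^sup>2 / 2)) * sob_norm K (s + 1 - \<alpha>) (diag_op \<psi> h (f_error t u))
      \<le> h\<^sup>2 * (c * h powr \<alpha> * (c * L * (X * 1)))"
    by (intro mult_mono cmod_half_square) auto
  then have P: "sob_norm K (s + 1 - \<alpha>) (\<lambda>j. complex_of_real (h\<^sup>2 / 2) * diag_op \<psi> h (f_error t u) j)
      \<le> c * (c * L * X) * ?q"
    unfolding sob_norm_scale powr_h(1) by (simp add: mult_ac)
  show ?thesis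
    using error_step_le[OF t, of u, unfolded ml] P half[OF z0] half[OF z1] by (simp add: algebra_simps)
qed

end

section \<open>Convergence\<close>

definition global_const_nonneg :: "real \<Rightarrow> real \<Rightarrow> real \<Rightarrow> real \<Rightarrow> real" where
  "global_const_nonneg c L E T = step_error c L E * T * exp (step_growth c L * T)"

definition global_const_nonpos :: "real \<Rightarrow> real \<Rightarrow> real \<Rightarrow> real \<Rightarrow> real" where
  "global_const_nonpos c L E T
    = ((2 * c + 1) * c * L * global_const_nonneg c L E T + 2 * E) * T * exp T"

context trigonometric_method
begin

abbreviation grid :: "nat \<Rightarrow> real" where
  "grid n \<equiv> t0 + real n * h"

abbreviation iterate :: "nat \<Rightarrow> cvec \<times> cvec" where
  "iterate n \<equiv> trig_integrator K p \<phi> \<psi> \<psi>0 \<psi>1 h (y t0, v t0) n"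

lemma iterate_simps: "iterate 0 = (y t0, v t0)" "iterate (Suc n) = step (iterate n)"
  by (simp_all add: trig_integrator_def)

lemma grid_Suc: "grid (Suc n) = grid n + h"
  by (simp add: algebra_simps)

lemma grid_range:
  assumes "real (Suc n) * h \<le> T"
  shows "t0 \<le> grid n" "grid n + h \<le> t0 + T"
  using assms h by (auto simp: algebra_simps)

lemma error_0: "error (grid 0) (iterate 0) = 0"
  by (simp add: iterate_simps energy_norm_def)

lemma growth_nonneg: "0 \<le> position_growth c L" "0 \<le> step_growth c L" "0 \<le> step_error c L E"
  using c const_nonneg E_nonneg by (auto simp: position_growth_def step_growth_def step_error_def)

lemma T_nonneg_of_grid: "real n * h \<le> T \<Longrightarrow> 0 \<le> T"
  using h by (meson mult_nonneg_nonneg of_nat_0_le_iff order_trans less_imp_le)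

lemma global_error_nonneg:
  assumes \<alpha>0: "0 \<le> \<alpha>" and n: "real n * h \<le> T"
    and ball: "\<And>n. real (Suc n) * h \<le> T \<Longrightarrow>
      error (grid n) (iterate n) \<le> global_const_nonneg c L E T * h powr (1 + \<alpha>) \<Longrightarrow>
      sob_norm K (s + 1) (fst (iterate n)) \<le> M + 1 \<and> sob_norm K (s + 1) (fst (iterate (Suc n))) \<le> M + 1"
  shows "error (grid n) (iterate n) \<le> global_const_nonneg c L E T * h powr (1 + \<alpha>)"
proof -
  let ?b = "step_error c L E * h powr (1 + \<alpha>)"
  have const: "?b * T * exp (step_growth c L * T) = global_const_nonneg c L E T * h powr (1 + \<alpha>)"
    by (simp add: global_const_nonneg_def)
  have "error (grid n) (iterate n) \<le> ?b * T * exp (step_growth c L * T)"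
  proof (rule discrete_Gronwall[where e = "\<lambda>n. error (grid n) (iterate n)" and h = h])
    fix n assume Sn: "real (Suc n) * h \<le> T"
      and small: "error (grid n) (iterate n) \<le> ?b * T * exp (step_growth c L * T)"
    have "error (grid n + h) (step (iterate n))
        \<le> (1 + step_growth c L * h) * error (grid n) (iterate n) + step_error c L E * h powr (2 + \<alpha>)"
      using ball[OF Sn small[unfolded const]] unfolding iterate_simps
      by (intro error_step_nonneg grid_range Sn \<alpha>0) auto
    then show "error (grid (Suc n)) (iterate (Suc n)) \<le> (1 + step_growth c L * h) * error (grid n) (iterate n) + ?b * h"
      unfolding grid_Suc iterate_simps powr_h(2) by (simp add: mult_ac)
  qed (use growth_nonneg h n error_0 in auto)
  then show ?thesis unfolding const .
qed

lemma iterate_in_ball: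
  assumes "grid n \<in> {t0..t0 + T}" and "sob_norm K (s + 1) (position_error (grid n) u) \<le> 1"
  shows "sob_norm K (s + 1) (fst u) \<le> M + 1"
proof -
  have "(\<lambda>j. y (grid n) j - position_error (grid n) u j) = fst u" by simp
  then show ?thesis
    using sob_norm_triangle_diff[of K "s + 1" "y (grid n)" "position_error (grid n) u"] y_bound[OF assms(1)] assms(2)
    by simp
qed

text \<open>
  The smallness condition makes both the current and the next error at most \<open>1\<close> in order \<open>s + 1\<close>, so the
  iterates stay within distance \<open>1\<close> of the exact solution and the induction continues.
\<close>
lemma global_error_bootstrap:
  assumes \<alpha>0: "\<alpha> = 0" and n: "real n * h \<le> T"
    and small: "((1 + position_growth c L) * global_const_nonneg c L E T + E) * h \<le> 1"
  shows "sob_norm K (s + 1) (position_error (grid n) (iterate n)) \<le> global_const_nonneg c L E T * h"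
proof -
  let ?C = "global_const_nonneg c L E T"
  have C: "0 \<le> ?C" using growth_nonneg T_nonneg_of_grid[OF n] by (simp add: global_const_nonneg_def)
  have pe: "sob_norm K (s + 1) (position_error t u) \<le> error t u" for t u
    using sob_norm_le_energy_norm(1)[of K s] \<alpha>0 by simp
  have hp: "h powr (1 + \<alpha>) = h" "h powr (2 + \<alpha>) = h * h"
    using \<alpha>0 h by (auto simp: power2_eq_square)
  have "error (grid n) (iterate n) \<le> ?C * h powr (1 + \<alpha>)"
  proof (rule global_error_nonneg[OF _ n])
    fix m assume m: "real (Suc m) * h \<le> T" and em: "error (grid m) (iterate m) \<le> ?C * h powr (1 + \<alpha>)"
    note range = grid_range[OF m]
    have em: "error (grid m) (iterate m) \<le> ?C * h" using em by (simp add: hp)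
    have le1: "?C * h \<le> ((1 + position_growth c L) * ?C + E) * h"
      using C growth_nonneg E_nonneg h by (intro mult_right_mono) (auto simp: distrib_right)
    have "sob_norm K (s + 1) (position_error (grid m) (iterate m)) \<le> 1"
      using em pe[of "grid m" "iterate m"] le1 small by linarith
    then have b: "sob_norm K (s + 1) (fst (iterate m)) \<le> M + 1"
      by (rule iterate_in_ball[rotated]) (use range h in auto)
    have "sob_norm K (s + 1) (position_error (grid m + h) (step (iterate m)))
        \<le> (1 + position_growth c L * h) * error (grid m) (iterate m) + E * (h * h)"
      using position_step_le(2)[OF range _ b] \<alpha>0 unfolding hp by simp
    also have "\<dots> \<le> (1 + position_growth c L * 1) * (?C * h) + E * (h * 1)"
      using em growth_nonneg E_nonneg h C by (intro add_mono mult_mono) auto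
    also have "\<dots> \<le> 1" using small by (simp add: algebra_simps)
    finally have "sob_norm K (s + 1) (position_error (grid (Suc m)) (iterate (Suc m))) \<le> 1"
      unfolding grid_Suc iterate_simps .
    then have "sob_norm K (s + 1) (fst (iterate (Suc m))) \<le> M + 1"
      by (rule iterate_in_ball[rotated]) (use m h in auto)
    with b show "sob_norm K (s + 1) (fst (iterate m)) \<le> M + 1 \<and> sob_norm K (s + 1) (fst (iterate (Suc m))) \<le> M + 1"
      by blast
  qed (use \<alpha>0 in simp)
  then show ?thesis using pe[of "grid n" "iterate n"] by (simp add: hp)
qed

lemma global_error:
  assumes n: "real n * h \<le> T" and X: "X = global_const_nonneg c L E T" "X * h \<le> 1"
    and base: "\<And>n. real n * h \<le> T \<Longrightarrow> sob_norm K (s + 1) (position_error (grid n) (iterate n)) \<le> X * h"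
  shows "error (grid n) (iterate n) \<le> (global_const_nonneg c L E T + global_const_nonpos c L E T) * h powr (1 + \<alpha>)"
proof -
  have T: "0 \<le> T" by (rule T_nonneg_of_grid[OF n])
  have X0: "0 \<le> X" using growth_nonneg T by (simp add: global_const_nonneg_def X)
  have b0: "0 \<le> (2 * c + 1) * c * L * X + 2 * E" using c const_nonneg E_nonneg X0 by simp
  have N0: "0 \<le> global_const_nonpos c L E T"
    using b0 T unfolding global_const_nonpos_def X(1) by simp
  have ball: "sob_norm K (s + 1) (fst (iterate n)) \<le> M + 1" if n: "real n * h \<le> T" for n
    using base[OF n] X(2) by (intro iterate_in_ball[of n]) (use n h in auto)
  have prev: "real n * h \<le> T" if "real (Suc n) * h \<le> T" for n
    using that h by (simp add: algebra_simps)
  show ?thesis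
  proof (cases "0 \<le> \<alpha>")
    case True
    have "error (grid n) (iterate n) \<le> global_const_nonneg c L E T * h powr (1 + \<alpha>)"
      using ball prev by (intro global_error_nonneg True n) blast
    also have "\<dots> \<le> (global_const_nonneg c L E T + global_const_nonpos c L E T) * h powr (1 + \<alpha>)"
      using N0 by (intro mult_right_mono) auto
    finally show ?thesis .
  next
    case False
    let ?b = "((2 * c + 1) * c * L * X + 2 * E) * h powr (1 + \<alpha>)"
    have "error (grid n) (iterate n) \<le> ?b * T * exp (1 * T)"
    proof (rule discrete_Gronwall[where e = "\<lambda>n. error (grid n) (iterate n)" and h = h])
      fix n assume Sn: "real (Suc n) * h \<le> T"
      have "error (grid n + h) (step (iterate n))
          \<le> (1 + h) * error (grid n) (iterate n) + ((2 * c + 1) * c * L * X + 2 * E) * h powr (2 + \<alpha>)"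
        using base[OF Sn] base[OF prev[OF Sn]] ball[OF Sn] ball[OF prev[OF Sn]] False X0
        unfolding grid_Suc iterate_simps by (intro error_step_nonpos grid_range Sn) auto
      then show "error (grid (Suc n)) (iterate (Suc n)) \<le> (1 + 1 * h) * error (grid n) (iterate n) + ?b * h"
        unfolding grid_Suc iterate_simps powr_h(2) by (simp add: mult_ac)
    qed (use b0 h n error_0 in auto)
    also have "\<dots> = global_const_nonpos c L E T * h powr (1 + \<alpha>)"
      by (simp add: global_const_nonpos_def X(1) mult_ac)
    also have "\<dots> \<le> (global_const_nonneg c L E T + global_const_nonpos c L E T) * h powr (1 + \<alpha>)"
      using X0 X(1) by (intro mult_right_mono) auto
    finally show ?thesis .
  qed
qed

end

text \<open>
  The constants of the nonlinearity are chosen before \<open>K\<close> and the solution; this order of quantifiers is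
  the uniformity claimed in the theorem.
\<close>
lemma semidiscrete_wave_constants:
  assumes "0 \<le> s" "0 \<le> M" "M \<le> R"
  obtains B L Q where "0 \<le> B" "0 \<le> L" "0 \<le> Q"
    and "\<And>K T t0 y v. K \<ge> 1 \<Longrightarrow> exact_solution K p t0 T y v \<Longrightarrow>
      (\<And>t. t \<in> {t0..t0 + T} \<Longrightarrow> sob_norm K (s + 1) (y t) \<le> M) \<Longrightarrow>
      (\<And>t. t \<in> {t0..t0 + T} \<Longrightarrow> sob_norm K s (v t) \<le> M) \<Longrightarrow>
      semidiscrete_wave K p s T M t0 R B L Q y v"
proof -
  have R: "0 \<le> R" using assms by simp
  obtain Q where Q: "0 \<le> Q" and interp: "\<And>K u z \<theta>. K \<ge> 1 \<Longrightarrow> 0 \<le> \<theta> \<Longrightarrow> \<theta> \<le> 1 \<Longrightarrow>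
      sob_norm K (s + 1) u \<le> R \<Longrightarrow> sob_norm K (s + 1) z \<le> R \<Longrightarrow>
      sob_norm K (s - 1) (\<lambda>j. cpow K (p - 1) (\<lambda>i. (1 - complex_of_real \<theta>) * u i + complex_of_real \<theta> * z i) j
        - ((1 - complex_of_real \<theta>) * cpow K (p - 1) u j + complex_of_real \<theta> * cpow K (p - 1) z j))
      \<le> Q * (sob_norm K s (\<lambda>j. z j - u j))\<^sup>2"
    using cpow_linear_interpolation[OF assms(1) R, of "p - 1"] by blast
  define B where "B = (6 * 2 powr (s + 1)) ^ (p - 1) * R ^ (p - 1 + 1)"
  define L where "L = real (p - 1 + 1) * (6 * 2 powr (s + 1) * R) ^ (p - 1)"
  have BL: "0 \<le> B" "0 \<le> L" using R by (auto simp: B_def L_def)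
  show thesis
  proof (rule that[OF BL Q])
    fix K :: nat and T t0 :: real and y v :: "real \<Rightarrow> cvec"
    assume K: "K \<ge> 1" and sol: "exact_solution K p t0 T y v"
      and yb: "\<And>t. t \<in> {t0..t0 + T} \<Longrightarrow> sob_norm K (s + 1) (y t) \<le> M"
      and vb: "\<And>t. t \<in> {t0..t0 + T} \<Longrightarrow> sob_norm K s (v t) \<le> M"
    show "semidiscrete_wave K p s T M t0 R B L Q y v"
    proof
      show "sob_norm K (s + 1) (nonlin K p u) \<le> B" if "sob_norm K (s + 1) u \<le> R" for u
        using sob_norm_cpow_le[OF K _ that, of "p - 1"] assms by (simp add: nonlin_def B_def)
      show "sob_norm K \<sigma> (\<lambda>j. nonlin K p u j - nonlin K p w j) \<le> L * sob_norm K \<sigma> (\<lambda>j. u j - w j)"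
        if "sob_norm K (s + 1) u \<le> R" "sob_norm K (s + 1) w \<le> R" "\<bar>\<sigma>\<bar> \<le> s + 1" for u w \<sigma>
        using sob_norm_cpow_diff_le[OF K _ that(3,1,2), of "p - 1"] assms by (simp add: nonlin_def L_def)
    qed (use assms K sol yb vb Q BL interp in \<open>auto simp: nonlin_def\<close>)
  qed
qed

theorem theorem2p1:
  fixes p :: nat and c s M T :: real
  assumes "p \<ge> 2" and "c \<ge> 1" and "s \<ge> 0" and "T > 0"
  shows "\<exists>h0 > 0. \<exists>C :: real.
    \<forall>(K :: nat) (t0 :: real) (y :: real \<Rightarrow> cvec) (v :: real \<Rightarrow> cvec).
      K \<ge> 1 \<and> exact_solution K p t0 T y v \<and>
      (\<forall>t. 0 \<le> t - t0 \<and> t - t0 \<le> T \<longrightarrow> sob_norm K (s + 1) (y t) + sob_norm K s (v t) \<le> M) \<longrightarrow>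
      (\<forall>(h :: real) (\<phi> :: real \<Rightarrow> complex) (\<psi> :: real \<Rightarrow> complex)
          (\<psi>0 :: real \<Rightarrow> complex) (\<psi>1 :: real \<Rightarrow> complex) (\<alpha> :: real).
        0 < h \<and> h \<le> h0 \<and>
        \<phi> 0 = 1 \<and> \<psi> 0 = 1 \<and> \<psi>0 0 = 1 \<and> \<psi>1 0 = 1 \<and>
        -1 \<le> \<alpha> \<and> \<alpha> \<le> 1 \<and>
        filter_assm K h \<phi> \<psi> \<psi>0 \<psi>1 0 c \<and> filter_assm K h \<phi> \<psi> \<psi>0 \<psi>1 \<alpha> c \<longrightarrow>
        (\<forall>n :: nat. real n * h \<le> T \<longrightarrow>
          (let tn = t0 + real n * h;
               (yn, vn) = trig_integrator K p \<phi> \<psi> \<psi>0 \<psi>1 h (y t0, v t0) n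
           in sob_norm K (s + 1 - \<alpha>) (\<lambda>j. y tn j - yn j)
                + sob_norm K (s - \<alpha>) (\<lambda>j. v tn j - vn j)
              \<le> C * h powr (1 + \<alpha>))))"
proof -
  \<comment> \<open>No solution satisfies a negative bound; the constants are formed with a nonnegative one.\<close>
  define M' where "M' = max M 0"
  define R where "R = c * (M' + 1)"
  have M': "0 \<le> M'" "M \<le> M'" by (auto simp: M'_def)
  have "1 * M' \<le> c * (M' + 1)" using assms M' by (intro mult_mono) auto
  then have MR: "M' \<le> R" by (simp add: R_def)
  obtain B L Q where nonneg: "0 \<le> B" "0 \<le> L" "0 \<le> Q"
    and wave: "\<And>K T t0 y v. K \<ge> 1 \<Longrightarrow> exact_solution K p t0 T y v \<Longrightarrow>
      (\<And>t. t \<in> {t0..t0 + T} \<Longrightarrow> sob_norm K (s + 1) (y t) \<le> M') \<Longrightarrow>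
      (\<And>t. t \<in> {t0..t0 + T} \<Longrightarrow> sob_norm K s (v t) \<le> M') \<Longrightarrow>
      semidiscrete_wave K p s T M' t0 R B L Q y v"
    using semidiscrete_wave_constants[OF \<open>s \<ge> 0\<close> M'(1) MR] by metis
  define E where "E = local_error_const c M' B L Q"
  define X where "X = global_const_nonneg c L E T"
  define N where "N = (1 + position_growth c L) * X + E"
  define C where "C = X + global_const_nonpos c L E T"
  have E: "0 \<le> E" using nonneg M' assms by (simp add: E_def local_error_const_def defect_const_def)
  have pg: "0 \<le> position_growth c L" using nonneg by (simp add: position_growth_def)
  have X: "0 \<le> X"
    using E nonneg assms by (simp add: X_def global_const_nonneg_def step_error_def)
  have XN: "X \<le> N" "0 \<le> N" using X pg E by (auto simp: N_def distrib_right)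
  define h0 where "h0 = 1 / (N + 1)"
  have h0: "0 < h0" "h0 \<le> 1" "N * h0 \<le> 1" using XN by (auto simp: h0_def divide_simps)
  show ?thesis
  proof (rule exI[of _ h0], rule conjI[OF h0(1)], rule exI[of _ "2 * C"], intro allI impI)
    fix K t0 y v h \<phi> \<psi> \<psi>0 \<psi>1 \<alpha> n
    assume sol: "K \<ge> 1 \<and> exact_solution K p t0 T y v \<and>
      (\<forall>t. 0 \<le> t - t0 \<and> t - t0 \<le> T \<longrightarrow> sob_norm K (s + 1) (y t) + sob_norm K s (v t) \<le> M)"
    assume scheme: "0 < h \<and> h \<le> h0 \<and>
        \<phi> 0 = 1 \<and> \<psi> 0 = 1 \<and> \<psi>0 0 = 1 \<and> \<psi>1 0 = 1 \<and>
        -1 \<le> \<alpha> \<and> \<alpha> \<le> 1 \<and>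
        filter_assm K h \<phi> \<psi> \<psi>0 \<psi>1 0 c \<and> filter_assm K h \<phi> \<psi> \<psi>0 \<psi>1 \<alpha> c"
    assume n: "real n * h \<le> T"
    have bounds: "sob_norm K (s + 1) (y t) \<le> M'" "sob_norm K s (v t) \<le> M'" if "t \<in> {t0..t0 + T}" for t
      using sol that M'(2) sob_norm_nonneg[of K "s + 1" "y t"] sob_norm_nonneg[of K s "v t"]
      by (smt (verit) atLeastAtMost_iff)+
    interpret wave: semidiscrete_wave K p s T M' t0 R B L Q y v
      using sol bounds by (intro wave) auto
    have h: "0 < h" "h \<le> 1" using scheme h0 by auto
    have "N * h \<le> N * h0" using scheme XN by (intro mult_left_mono) auto
    then have Nh: "N * h \<le> 1" using h0 by simp
    have Xh: "X * h \<le> 1" using mult_right_mono[OF XN(1), of h] h Nh by linarith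
    interpret base: trigonometric_method K p s T M' t0 R B L Q y v c h 0 \<phi> \<psi> \<psi>0 \<psi>1
      by unfold_locales (use scheme h assms in \<open>auto simp: R_def\<close>)
    interpret trigonometric_method K p s T M' t0 R B L Q y v c h \<alpha> \<phi> \<psi> \<psi>0 \<psi>1
      by unfold_locales (use scheme h assms in \<open>auto simp: R_def\<close>)
    let ?e1 = "\<lambda>j. y (t0 + real n * h) j - fst (trig_integrator K p \<phi> \<psi> \<psi>0 \<psi>1 h (y t0, v t0) n) j"
    let ?e2 = "\<lambda>j. v (t0 + real n * h) j - snd (trig_integrator K p \<phi> \<psi> \<psi>0 \<psi>1 h (y t0, v t0) n) j"
    have "energy_norm K (s - \<alpha>) ?e1 ?e2 \<le> C * h powr (1 + \<alpha>)"
      unfolding C_def X_def E_def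
    proof (rule global_error[OF n refl])
      show "global_const_nonneg c L (local_error_const c M' B L Q) T * h \<le> 1"
        using Xh by (simp add: X_def E_def)
      show "sob_norm K (s + 1) (position_error (grid m) (iterate m))
          \<le> global_const_nonneg c L (local_error_const c M' B L Q) T * h" if "real m * h \<le> T" for m
        using Nh by (intro base.global_error_bootstrap that refl) (simp add: N_def X_def E_def)
    qed
    then have "sob_norm K (s - \<alpha> + 1) ?e1 + sob_norm K (s - \<alpha>) ?e2 \<le> 2 * (C * h powr (1 + \<alpha>))"
      using sob_norm_le_energy_norm[where K = K and \<sigma> = "s - \<alpha>" and a = ?e1 and b = ?e2] by linarith
    moreover have "s - \<alpha> + 1 = s + 1 - \<alpha>" by simp
    ultimately show "let tn = t0 + real n * h;
               (yn, vn) = trig_integrator K p \<phi> \<psi> \<psi>0 \<psi>1 h (y t0, v t0) n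
           in sob_norm K (s + 1 - \<alpha>) (\<lambda>j. y tn j - yn j)
                + sob_norm K (s - \<alpha>) (\<lambda>j. v tn j - vn j)
              \<le> 2 * C * h powr (1 + \<alpha>)"
      unfolding Let_def case_prod_beta mult.assoc by simp
  qed
qed

end
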